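(* Let $r,t\ge 3$ be integers. There exist constants $c,C>0$ such that for every function $0<p=p(n)\le 1$: (1) if $p\gg n^{-r+\frac{3t-2}{2t-1}}$, then a.a.s. $$\max\left\{c\,p\,n^{r-1},\ n^{\frac{3t-2}{2t-1}}(\log n)^{-C}\right\}\le \mathrm{ex}(G^r_{n,p},K_{2,t}^{(r)})\le \max\left\{C\,p\,n^{r-1},\ n^{\frac{3t-2}{2t-1}}(\log n)^{C}\right\};$$ (2) if $n^{-r}\ll p\ll n^{-r+\frac{3t-2}{2t-1}}$, then a.a.s. $\mathrm{ex}(G^r_{n,p},K_{2,t}^{(r)})=(1+o(1))\,p\binom{n}{r}$.
   Context: An $r$-graph is a finite $r$-uniform hypergraph. For a graph $F$ and $r\ge 2$, the expansion $F^{(r)}$ is the $r$-graph obtained by inserting $r-2$ new vertices into each edge of $F$, all new vertices (over all edges) being distinct. $K_{2,t}$ is the complete bipartite graph with parts of sizes $2$ and $t$. $G^r_{n,p}$ is the random $r$-graph on $n$ vertices in which each $r$-set is an edge independently with probability $p$. $\mathrm{ex}(G^r_{n,p},F)$ is the maximum number of edges in an $F$-free subgraph of $G^r_{n,p}$. Events $A_n$ hold a.a.s. if $\Pr[A_n]\to1$ as $n\to\infty$. $f(n)\ll g(n)$ (equivalently $g\gg f$) means $f(n)/g(n)\to0$. *)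

theory Defs
  imports Complex_Main "HOL-Probability.Product_PMF"
begin

datatype 'a hypergraph = Hypergraph (verts: "'a set") (edges: "'a set set")

definition r_graph :: "nat \<Rightarrow> 'a hypergraph \<Rightarrow> bool" where
  "r_graph r H \<longleftrightarrow> finite (verts H) \<and> (\<forall>e\<in>edges H. e \<subseteq> verts H \<and> card e = r)"

definition subhypergraph :: "'a hypergraph \<Rightarrow> 'a hypergraph \<Rightarrow> bool" where
  "subhypergraph H G \<longleftrightarrow>
     verts H \<subseteq> verts G \<and> edges H \<subseteq> edges G \<and> (\<forall>e\<in>edges H. e \<subseteq> verts H)"

text \<open>Containment means a not necessarily induced copy.\<close>

definition contains_copy :: "'a hypergraph \<Rightarrow> 'b hypergraph \<Rightarrow> bool" where
  "contains_copy H F \<longleftrightarrow>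
     (\<exists>\<phi>. inj_on \<phi> (verts F) \<and> \<phi> ` verts F \<subseteq> verts H \<and> (\<forall>e\<in>edges F. \<phi> ` e \<in> edges H))"

text \<open>
  The maximum is over a finite set whenever \<open>G\<close> is finite, and over a nonempty one whenever
  \<open>F\<close> has at least one vertex.
\<close>

definition ex_num :: "'a hypergraph \<Rightarrow> 'b hypergraph \<Rightarrow> nat" where
  "ex_num G F = Max {card (edges H) | H. subhypergraph H G \<and> \<not> contains_copy H F}"

text \<open>
  A graph is a 2-graph. The new vertices inserted into the edge \<open>e\<close> are the \<open>Inr (e, i)\<close>
  with \<open>i < r - 2\<close>, so those of different edges are distinct.
\<close>

definition expansion :: "nat \<Rightarrow> 'a hypergraph \<Rightarrow> ('a + 'a set \<times> nat) hypergraph" where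
  "expansion r F = Hypergraph
     (verts F <+> edges F \<times> {..<r - 2})
     ((\<lambda>e. e <+> {e} \<times> {..<r - 2}) ` edges F)"

definition complete_bipartite :: "nat \<Rightarrow> nat \<Rightarrow> (nat + nat) hypergraph" where
  "complete_bipartite s t = Hypergraph
     ({..<s} <+> {..<t}) {{Inl i, Inr j} | i j. i < s \<and> j < t}"

definition r_sets :: "nat \<Rightarrow> nat \<Rightarrow> nat set set" where
  "r_sets r n = {e. e \<subseteq> {..<n} \<and> card e = r}"

definition random_r_graph :: "nat \<Rightarrow> nat \<Rightarrow> real \<Rightarrow> nat hypergraph pmf" where
  "random_r_graph r n p =
     map_pmf (\<lambda>\<omega>. Hypergraph {..<n} {e \<in> r_sets r n. \<omega> e})
       (Pi_pmf (r_sets r n) False (\<lambda>_. bernoulli_pmf p))"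

definition aas :: "(nat \<Rightarrow> 'a pmf) \<Rightarrow> (nat \<Rightarrow> 'a \<Rightarrow> bool) \<Rightarrow> bool" where
  "aas M A \<longleftrightarrow> (\<lambda>n. measure_pmf.prob (M n) {x. A n x}) \<longlonglongrightarrow> 1"

definition much_less :: "(nat \<Rightarrow> real) \<Rightarrow> (nat \<Rightarrow> real) \<Rightarrow> bool" where
  "much_less f g \<longleftrightarrow> (\<lambda>n. f n / g n) \<longlonglongrightarrow> 0"

text \<open>
  A.a.s. \<open>X n = (1 + o(1)) * a n\<close> for random \<open>X n\<close> and deterministic \<open>a n\<close>: for each fixed
  \<open>\<epsilon> > 0\<close>, a.a.s. the relative error is at most \<open>\<epsilon>\<close>.
\<close>

definition aas_asymp :: "(nat \<Rightarrow> 'a pmf) \<Rightarrow> (nat \<Rightarrow> 'a \<Rightarrow> real) \<Rightarrow> (nat \<Rightarrow> real) \<Rightarrow> bool" where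
  "aas_asymp M X a \<longleftrightarrow> (\<forall>\<epsilon>>0. aas M (\<lambda>n x. \<bar>X n x - a n\<bar> \<le> \<epsilon> * \<bar>a n\<bar>))"

lemma r_graph_complete_bipartite: "r_graph 2 (complete_bipartite s t)"
  by (auto simp: r_graph_def complete_bipartite_def)

lemma r_graph_expansion:
  assumes "r_graph 2 F" "r \<ge> 2"
  shows "r_graph r (expansion r F)"
proof -
  have fin: "finite (verts F)" and e: "\<And>e. e \<in> edges F \<Longrightarrow> e \<subseteq> verts F \<and> card e = 2"
    using assms(1) by (auto simp: r_graph_def)
  have finE: "finite (edges F)"
    by (rule finite_subset[of _ "Pow (verts F)"]) (use e fin in auto)
  have "card (e <+> {e} \<times> {..<r - 2}) = r" if "e \<in> edges F" for e
    using e[OF that] fin assms(2) finite_subset[of e "verts F"]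
    by (subst card_Plus) (auto simp: card_cartesian_product)
  then show ?thesis
    using fin finE e by (fastforce simp: r_graph_def expansion_def)
qed

lemma r_graph_random_r_graph:
  "G \<in> set_pmf (random_r_graph r n p) \<Longrightarrow> r_graph r G"
  by (auto simp: random_r_graph_def r_graph_def r_sets_def)

end

theory Submission
  imports Defs "HOL-Real_Asymp.Real_Asymp"
begin

text \<open>
  Write \<open>\<alpha> = (3t - 2) / (2t - 1)\<close> and \<open>s = n\<^sup>\<alpha>\<close>. The density \<open>n\<^sup>-\<^sup>r\<^sup>+\<^sup>\<alpha>\<close> is the one at which the expected numbers of
  edges and of copies agree, so below it one deletes an edge from every copy. Above it, the lower bounds
  come from a star and from thinning out to density \<open>n\<^sup>-\<^sup>r\<^sup>+\<^sup>\<alpha> / ln n\<close> before deleting.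

  The upper bound is a union bound over containers, which are obtained from balanced supersaturation: if
  \<open>H\<close> has \<open>h \<ge> K n\<^sup>r\<^sup>-\<^sup>1\<close> edges, then there is a random copy in \<open>H\<close> that contains any \<open>j \<ge> 1\<close> given edges
  with probability \<open>O(s\<^sup>j\<^sup>-\<^sup>1 / h\<^sup>j)\<close>. The copy consists of a random pair \<open>u, v\<close> and, given it, \<open>t\<close> independent
  triples of a vertex \<open>w\<close> and edges through \<open>u, w\<close> and \<open>v, w\<close>. Let \<open>d = h s / n\<^sup>3\<close>. If many edges contain a pair
  of degree below \<open>d\<close>, then these pairs form a graph with about \<open>n\<^sup>3 / s\<close> edges or more, and
  \<open>u, w, v\<close> is a random path of length two in it. Otherwise one may assume that all pairs inside edges have
  degree of order \<open>d\<close>, and chooses \<open>u, v, w\<close> inside a common edge.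
\<close>

section \<open>Weighted hypergraph containers\<close>

text \<open>The exponent \<alpha> is dictated by j = 2t. On pairs of degree at most d, a given edge
  in a triple has conditional probability O(s / h) given u, v, as desired. Two given edges at the
  same w, however, are only bounded by O(n^3 / h^2), which exceeds (s / h)^2 because \<alpha> < 3/2.
  What compensates is the triple over which u, v are averaged: there the bound is n / h^2, smaller
  than s / h^2. For b triples with both edges given, the two effects balance if n^(3b-2) \<le>
  s^(2b-1), and b = t gives equality.

  The cut-off d = h s / n^3 is the largest degree, up to constants, at which a path of length two
  still gives O(s / h) for a single edge. Above it such paths are too concentrated on edges, and u,
  v, w are put into a common edge instead, where the trivial bound n^(r-3) on triple degrees
  suffices.

  The logarithms in the upper bound come from the containers: they are refined in O(ln n) rounds,
  each round multiplying their number by exp(O(s ln n)). The logarithms in the lower bound come from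
  thinning and from Markov's inequality.\<close>

definition uniform_weight :: "'a set \<Rightarrow> nat \<Rightarrow> ('a set \<Rightarrow> real) \<Rightarrow> bool" where
  "uniform_weight V k w \<longleftrightarrow> (\<forall>S. 0 \<le> w S) \<and> (\<forall>S. w S \<noteq> 0 \<longrightarrow> S \<subseteq> V \<and> card S = k)"

text \<open>A weighted codegree; \<open>wdeg V w {}\<close> is the total mass and replaces the
  number of hyperedges throughout. Weights allow the law of a random copy to be used directly as a
  hypergraph.\<close>

definition wdeg :: "'a set \<Rightarrow> ('a set \<Rightarrow> real) \<Rightarrow> 'a set \<Rightarrow> real" where
  "wdeg V w \<sigma> = (\<Sum>S | S \<subseteq> V \<and> \<sigma> \<subseteq> S. w S)"

text \<open>The independent sets of the hypergraph formed by the sets of nonzero weight.\<close>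

definition weight_free :: "('a set \<Rightarrow> real) \<Rightarrow> 'a set \<Rightarrow> bool" where
  "weight_free w I \<longleftrightarrow> (\<forall>S. S \<subseteq> I \<longrightarrow> w S = 0)"

text \<open>\<open>x\<close> bounds the size of the containers and \<open>Q\<close> their number.
  The predicate \<open>P\<close> is arbitrary so that the case distinctions made while a container
  is being constructed can be expressed by restricting it.\<close>

definition has_containers :: "'a set \<Rightarrow> real \<Rightarrow> real \<Rightarrow> ('a set \<Rightarrow> bool) \<Rightarrow> bool" where
  "has_containers V x Q P \<longleftrightarrow> (\<exists>\<C>. finite \<C> \<and> real (card \<C>) \<le> Q \<and>
     (\<forall>C\<in>\<C>. C \<subseteq> V \<and> real (card C) \<le> x) \<and> (\<forall>I. I \<subseteq> V \<longrightarrow> P I \<longrightarrow> (\<exists>C\<in>\<C>. I \<subseteq> C)))"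

lemma has_containers_mono:
  assumes "has_containers V x Q P" "x \<le> x'" "Q \<le> Q'" "\<And>I. I \<subseteq> V \<Longrightarrow> P' I \<Longrightarrow> P I"
  shows "has_containers V x' Q' P'"
  using assms unfolding has_containers_def by (meson order_trans)

lemma has_containers_single:
  assumes "finite V" "C \<subseteq> V" "real (card C) \<le> x" "\<And>I. I \<subseteq> V \<Longrightarrow> P I \<Longrightarrow> I \<subseteq> C" "1 \<le> Q"
  shows "has_containers V x Q P"
  unfolding has_containers_def using assms by (intro exI[of _ "{C}"]) auto

lemma has_containers_Union:
  assumes "finite A" "\<And>a. a \<in> A \<Longrightarrow> has_containers V x Q (P a)" "0 \<le> Q"
    "\<And>I. I \<subseteq> V \<Longrightarrow> P' I \<Longrightarrow> \<exists>a\<in>A. P a I"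
  shows "has_containers V x (real (card A) * Q) P'"
proof -
  have "\<forall>a\<in>A. \<exists>\<C>. finite \<C> \<and> real (card \<C>) \<le> Q \<and>
     (\<forall>C\<in>\<C>. C \<subseteq> V \<and> real (card C) \<le> x) \<and> (\<forall>I. I \<subseteq> V \<longrightarrow> P a I \<longrightarrow> (\<exists>C\<in>\<C>. I \<subseteq> C))"
    using assms(2) unfolding has_containers_def by blast
  then obtain c where c: "\<And>a. a \<in> A \<Longrightarrow> finite (c a) \<and> real (card (c a)) \<le> Q \<and>
     (\<forall>C\<in>c a. C \<subseteq> V \<and> real (card C) \<le> x) \<and> (\<forall>I. I \<subseteq> V \<longrightarrow> P a I \<longrightarrow> (\<exists>C\<in>c a. I \<subseteq> C))"
    by metis
  have "real (card (\<Union>a\<in>A. c a)) \<le> real (\<Sum>a\<in>A. card (c a))"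
    using card_UN_le[OF assms(1)] of_nat_le_iff by blast
  also have "\<dots> \<le> (\<Sum>a\<in>A. Q)" unfolding of_nat_sum using c by (intro sum_mono) auto
  finally have "real (card (\<Union>a\<in>A. c a)) \<le> real (card A) * Q" by simp
  then show ?thesis unfolding has_containers_def
    by (intro exI[of _ "\<Union>a\<in>A. c a"]) (use c assms in \<open>auto; meson\<close>)
qed

lemma has_containers_Un:
  assumes "has_containers V x Q P" "has_containers V x Q' P'" "\<And>I. I \<subseteq> V \<Longrightarrow> R I \<Longrightarrow> P I \<or> P' I"
  shows "has_containers V x (Q + Q') R"
proof -
  obtain c where c: "finite c" "real (card c) \<le> Q"
     "\<forall>C\<in>c. C \<subseteq> V \<and> real (card C) \<le> x" "\<forall>I. I \<subseteq> V \<longrightarrow> P I \<longrightarrow> (\<exists>C\<in>c. I \<subseteq> C)"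
    using assms(1) unfolding has_containers_def by blast
  obtain d where d: "finite d" "real (card d) \<le> Q'"
     "\<forall>C\<in>d. C \<subseteq> V \<and> real (card C) \<le> x" "\<forall>I. I \<subseteq> V \<longrightarrow> P' I \<longrightarrow> (\<exists>C\<in>d. I \<subseteq> C)"
    using assms(2) unfolding has_containers_def by blast
  have "real (card (c \<union> d)) \<le> Q + Q'" using card_Un_le[of c d] c(2) d(2) by linarith
  moreover have "\<exists>C\<in>c \<union> d. I \<subseteq> C" if "I \<subseteq> V" "R I" for I
    using assms(3)[OF that] c(4) d(4) that(1) by (meson UnI1 UnI2)
  ultimately show ?thesis unfolding has_containers_def
    using c(1,3) d(1,3) by (intro exI[of _ "c \<union> d"]) auto
qed

lemma sum_subsets_if:
  "finite V \<Longrightarrow> (\<Sum>S\<in>Pow V. if R S then w S else 0) = (\<Sum>S | S \<subseteq> V \<and> R S. w S)"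
  for w :: "'a set \<Rightarrow> real"
  by (subst sum.inter_filter[symmetric]) (auto intro!: sum.cong)

lemma wdeg_nonneg: "uniform_weight V k w \<Longrightarrow> 0 \<le> wdeg V w \<sigma>"
  unfolding wdeg_def uniform_weight_def by (intro sum_nonneg) auto

lemma wdeg_add: "wdeg V (\<lambda>S. w S + w' S) \<sigma> = wdeg V w \<sigma> + wdeg V w' \<sigma>"
  unfolding wdeg_def by (rule sum.distrib)

text \<open>Adding x is injective on sets that avoid x. The filter \<open>R\<close> stands for the
  removal of saturated sets from the link.\<close>

lemma wdeg_link_le:
  assumes V: "finite V" and w: "\<And>S. 0 \<le> w S" and x: "x \<in> V" "\<sigma> \<subseteq> V"
  shows "wdeg V (\<lambda>S. if x \<notin> S \<and> R S then w (insert x S) else 0) \<sigma> \<le> wdeg V w (insert x \<sigma>)"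
proof -
  have "wdeg V (\<lambda>S. if x \<notin> S \<and> R S then w (insert x S) else 0) \<sigma>
    = (\<Sum>S | S \<subseteq> V \<and> \<sigma> \<subseteq> S \<and> x \<notin> S \<and> R S. w (insert x S))"
    unfolding wdeg_def using V by (intro sum.mono_neutral_cong_right) auto
  also have "\<dots> = sum w (insert x ` {S. S \<subseteq> V \<and> \<sigma> \<subseteq> S \<and> x \<notin> S \<and> R S})"
    by (subst sum.reindex) (auto simp: inj_on_def)
  also have "\<dots> \<le> (\<Sum>S | S \<subseteq> V \<and> insert x \<sigma> \<subseteq> S. w S)"
    using V w x by (intro sum_mono2) auto
  finally show ?thesis unfolding wdeg_def .
qed

text \<open>Every set of nonzero weight has exactly 2^k subsets \<sigma>.\<close>

lemma sum_wdeg_le: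
  assumes V: "finite V" and w: "uniform_weight V k w"
  shows "(\<Sum>\<sigma>\<in>Pow V. wdeg V w \<sigma>) \<le> 2 ^ k * wdeg V w {}"
proof -
  have "(\<Sum>\<sigma>\<in>Pow V. wdeg V w \<sigma>) = (\<Sum>\<sigma>\<in>Pow V. \<Sum>S\<in>Pow V. if \<sigma> \<subseteq> S then w S else 0)"
    unfolding wdeg_def by (simp add: sum_subsets_if[OF V])
  also have "\<dots> = (\<Sum>S\<in>Pow V. \<Sum>\<sigma>\<in>Pow V. if \<sigma> \<subseteq> S then w S else 0)"
    by (rule sum.swap)
  also have "\<dots> \<le> (\<Sum>S\<in>Pow V. 2 ^ k * w S)"
  proof (rule sum_mono)
    fix S assume S: "S \<in> Pow V"
    have "(\<Sum>\<sigma>\<in>Pow V. if \<sigma> \<subseteq> S then w S else 0) = (\<Sum>\<sigma>\<in>Pow S. w S)"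
      using S V by (subst sum.inter_filter[symmetric]) (auto intro!: arg_cong[where f = card] simp del: card_Pow)
    also have "\<dots> = 2 ^ card S * w S"
      using S V by (simp add: card_Pow finite_subset)
    also have "\<dots> = 2 ^ k * w S" using w by (cases "w S = 0") (auto simp: uniform_weight_def)
    finally show "(\<Sum>\<sigma>\<in>Pow V. if \<sigma> \<subseteq> S then w S else 0) \<le> 2 ^ k * w S" by simp
  qed
  also have "\<dots> = 2 ^ k * wdeg V w {}"
    unfolding wdeg_def by (simp add: sum_distrib_left Pow_def)
  finally show ?thesis .
qed

text \<open>In the 1-uniform case an independent set avoids all vertices of positive weight. None of
  them carries more than a fraction \<beta> / |V| of the mass, so there are at least |V| / \<beta>
  of them, and their complement is the only container.\<close>

lemma container_base:
  assumes V: "finite V" "V \<noteq> {}" and w: "uniform_weight V 1 w" and M: "wdeg V w {} > 0"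
    and \<beta>: "\<beta> \<ge> 1"
    and deg: "\<And>\<sigma>. \<sigma> \<subseteq> V \<Longrightarrow> \<sigma> \<noteq> {} \<Longrightarrow> wdeg V w \<sigma> \<le> \<beta> * wdeg V w {} * \<tau> ^ (card \<sigma> - 1) / card V"
  shows "has_containers V ((1 - 1 / \<beta>) * card V) 1 (weight_free w)"
proof (rule has_containers_single)
  let ?S = "{x\<in>V. w {x} \<noteq> 0}" let ?M = "wdeg V w {}"
  have N: "real (card V) > 0" using V by (simp add: card_gt_0_iff)
  have "?M = (\<Sum>S\<in>(\<lambda>x. {x}) ` ?S. w S)"
  proof -
    have "w S = 0" if "S \<subseteq> V" "S \<notin> (\<lambda>x. {x}) ` ?S" for S
    proof (rule ccontr)
      assume "w S \<noteq> 0"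
      then obtain x where "S = {x}" using w by (metis card_1_singletonE uniform_weight_def)
      with that \<open>w S \<noteq> 0\<close> show False by auto
    qed
    then show ?thesis unfolding wdeg_def using V by (intro sum.mono_neutral_right) auto
  qed
  also have "\<dots> = (\<Sum>x\<in>?S. w {x})" by (subst sum.reindex) auto
  also have "\<dots> \<le> (\<Sum>x\<in>?S. \<beta> * ?M / card V)"
  proof (rule sum_mono)
    fix x assume x: "x \<in> ?S"
    have "w {x} \<le> wdeg V w {x}"
      unfolding wdeg_def using x V w by (intro member_le_sum) (auto simp: uniform_weight_def)
    also have "\<dots> \<le> \<beta> * ?M / card V" using deg[of "{x}"] x by simp
    finally show "w {x} \<le> \<beta> * ?M / card V" .
  qed
  finally have "?M \<le> card ?S * (\<beta> * ?M / card V)" by simp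
  then have "?M * 1 \<le> ?M * (card ?S * \<beta> / card V)" by (simp add: mult_ac)
  then have "1 \<le> card ?S * \<beta> / card V" using M by (simp only: mult_le_cancel_left_pos)
  then have "card V \<le> card ?S * \<beta>" using N by (simp add: field_simps)
  then have *: "card V / \<beta> \<le> card ?S" using \<beta> by (simp add: field_simps)
  have "real (card (V - ?S)) = real (card V) - real (card ?S)"
    using V by (simp add: card_Diff_subset card_mono of_nat_diff)
  then show "real (card (V - ?S)) \<le> (1 - 1 / \<beta>) * real (card V)"
    using * by (simp add: field_simps)
qed (use V in \<open>auto simp: weight_free_def\<close>)

text \<open>
  The sets \<open>\<sigma>\<close> whose degree in the link weight \<open>w'\<close> is already at the cap are saturated, and only the part
  of \<open>w\<close> avoiding them is used further; the cap is chosen so that at most half of the mass is lost.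
\<close>

lemma many_good_vertices:
  assumes V: "finite V" "V \<noteq> {}" and w: "uniform_weight V (Suc i) w" and M: "wdeg V w {} = M" "M > 0"
    and \<beta>: "\<beta> \<ge> 1" and \<tau>: "\<tau> > 0"
    and deg: "\<And>\<sigma>. \<sigma> \<subseteq> V \<Longrightarrow> \<sigma> \<noteq> {} \<Longrightarrow> wdeg V w \<sigma> \<le> \<beta> * M * \<tau> ^ (card \<sigma> - 1) / card V"
    and w': "uniform_weight V i w'" and m': "wdeg V w' {} \<le> 2 * \<tau> * \<beta> * M"
    and L: "L = 2 ^ (i + 2) * \<beta>"
    and sat: "sat = {\<sigma>. \<sigma> \<subseteq> V \<and> \<sigma> \<noteq> {} \<and> wdeg V w' \<sigma> > L * \<tau> * (\<beta> * M * \<tau> ^ (card \<sigma> - 1) / card V)}"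
    and link: "\<And>x. link x = (\<lambda>S. if x \<notin> S \<and> (\<forall>\<sigma>\<in>sat. \<not> \<sigma> \<subseteq> S) then w (insert x S) else 0)"
  shows "real (card {x\<in>V. wdeg V (link x) {} \<ge> M / (4 * real (card V))}) \<ge> card V / (4 * \<beta>)"
proof -
  let ?N = "real (card V)" let ?ok = "\<lambda>S. \<forall>\<sigma>\<in>sat. \<not> \<sigma> \<subseteq> S"
  let ?good = "{x\<in>V. wdeg V (link x) {} \<ge> M / (4 * ?N)}"
  have N: "?N > 0" using V by (simp add: card_gt_0_iff)
  have w0: "0 \<le> w S" for S using w by (simp add: uniform_weight_def)
  have Lp: "L > 0" using \<beta> by (simp add: L)
  have sats: "sat \<subseteq> Pow V" by (auto simp: sat)
  then have fsat: "finite sat" using V finite_subset by blast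
  \<comment> \<open>Each set lost to saturation is charged to a saturated \<sigma> inside it. The
    degree of \<sigma> in \<open>w\<close> is at most 1 / (L \<tau>) times its degree in
    \<open>w'\<close>, so the loss is controlled by the sum of all degrees of
    \<open>w'\<close>.\<close>
  have "(\<Sum>S | S \<subseteq> V \<and> \<not> ?ok S. w S) \<le> (\<Sum>S\<in>Pow V. \<Sum>\<sigma>\<in>sat. if \<sigma> \<subseteq> S then w S else 0)"
  proof -
    have "(\<Sum>S | S \<subseteq> V \<and> \<not> ?ok S. w S) \<le> (\<Sum>S | S \<subseteq> V \<and> \<not> ?ok S. \<Sum>\<sigma>\<in>sat. if \<sigma> \<subseteq> S then w S else 0)"
    proof (rule sum_mono)
      fix S assume "S \<in> {S. S \<subseteq> V \<and> \<not> ?ok S}"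
      then obtain \<sigma> where \<sigma>: "\<sigma> \<in> sat" "\<sigma> \<subseteq> S" by blast
      have "(if \<sigma> \<subseteq> S then w S else 0) \<le> (\<Sum>\<sigma>\<in>sat. if \<sigma> \<subseteq> S then w S else 0)"
        by (rule member_le_sum) (use \<sigma> fsat w0 in auto)
      then show "w S \<le> (\<Sum>\<sigma>\<in>sat. if \<sigma> \<subseteq> S then w S else 0)" using \<sigma> by simp
    qed
    also have "\<dots> \<le> (\<Sum>S\<in>Pow V. \<Sum>\<sigma>\<in>sat. if \<sigma> \<subseteq> S then w S else 0)"
      using V w0 by (intro sum_mono2 sum_nonneg) auto
    finally show ?thesis .
  qed
  also have "\<dots> = (\<Sum>\<sigma>\<in>sat. \<Sum>S\<in>Pow V. if \<sigma> \<subseteq> S then w S else 0)" by (rule sum.swap)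
  also have "\<dots> = (\<Sum>\<sigma>\<in>sat. wdeg V w \<sigma>)"
    unfolding wdeg_def by (simp add: sum_subsets_if[OF V(1)])
  also have "\<dots> \<le> (\<Sum>\<sigma>\<in>sat. wdeg V w' \<sigma> / (L * \<tau>))"
  proof (rule sum_mono)
    fix \<sigma> assume s: "\<sigma> \<in> sat"
    then have "wdeg V w \<sigma> \<le> \<beta> * M * \<tau> ^ (card \<sigma> - 1) / ?N" using deg by (auto simp: sat)
    moreover have "L * \<tau> * (\<beta> * M * \<tau> ^ (card \<sigma> - 1) / ?N) < wdeg V w' \<sigma>" using s by (simp add: sat)
    ultimately have "L * \<tau> * wdeg V w \<sigma> \<le> wdeg V w' \<sigma>"
      using Lp \<tau> by (smt (verit, best) mult_left_mono mult_pos_pos)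
    then show "wdeg V w \<sigma> \<le> wdeg V w' \<sigma> / (L * \<tau>)" using Lp \<tau> by (simp add: field_simps)
  qed
  also have "\<dots> = (\<Sum>\<sigma>\<in>sat. wdeg V w' \<sigma>) / (L * \<tau>)" by (simp add: sum_divide_distrib)
  also have "\<dots> \<le> (\<Sum>\<sigma>\<in>Pow V. wdeg V w' \<sigma>) / (L * \<tau>)"
    using Lp \<tau> sats V wdeg_nonneg[OF w'] by (intro divide_right_mono sum_mono2) auto
  also have "\<dots> \<le> (2 ^ i * wdeg V w' {}) / (L * \<tau>)"
    using Lp \<tau> sum_wdeg_le[OF V(1) w'] by (intro divide_right_mono) auto
  also have "\<dots> \<le> (2 ^ i * (2 * \<tau> * \<beta> * M)) / (L * \<tau>)"
    using Lp \<tau> m' by (intro divide_right_mono mult_left_mono) auto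
  \<comment> \<open>The value of \<open>L\<close> is chosen for this equation: 2^i * 2 \<beta> / L =
    1/2.\<close>
  also have "\<dots> = M / 2" using \<tau> \<beta> by (simp add: L field_simps)
  finally have bad: "(\<Sum>S | S \<subseteq> V \<and> \<not> ?ok S. w S) \<le> M / 2" .
  have "M = (\<Sum>S | S \<subseteq> V \<and> \<not> ?ok S. w S) + (\<Sum>S | S \<subseteq> V \<and> ?ok S. w S)"
    unfolding M(1)[symmetric] wdeg_def using V
    by (subst sum.union_disjoint[symmetric]) (auto intro!: sum.cong)
  with bad have "M / 2 \<le> (\<Sum>S | S \<subseteq> V \<and> ?ok S. w S)" by linarith
  also have "\<dots> \<le> (\<Sum>S | S \<subseteq> V \<and> ?ok S. \<Sum>x\<in>V. if x \<in> S then w S else 0)"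
  proof (rule sum_mono)
    fix S assume S: "S \<in> {S. S \<subseteq> V \<and> ?ok S}"
    show "w S \<le> (\<Sum>x\<in>V. if x \<in> S then w S else 0)"
    proof (cases "w S = 0")
      case False
      then have "card S = Suc i" using w by (auto simp: uniform_weight_def)
      then obtain x where x: "x \<in> S" by (metis card.empty nat.distinct(1) ex_in_conv)
      have "(if x \<in> S then w S else 0) \<le> (\<Sum>x\<in>V. if x \<in> S then w S else 0)"
        by (rule member_le_sum) (use x S V w0 in auto)
      then show ?thesis using x by simp
    qed (auto intro: sum_nonneg)
  qed
  also have "\<dots> = (\<Sum>x\<in>V. \<Sum>S | S \<subseteq> V \<and> ?ok S. if x \<in> S then w S else 0)" by (rule sum.swap)
  also have "\<dots> \<le> (\<Sum>x\<in>V. wdeg V (link x) {})"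
  proof (rule sum_mono)
    fix x assume x: "x \<in> V"
    have "(\<Sum>S | S \<subseteq> V \<and> ?ok S. if x \<in> S then w S else 0) = (\<Sum>S | S \<subseteq> V \<and> ?ok S \<and> x \<in> S. w S)"
      using V by (subst sum.inter_filter[symmetric]) (auto intro!: sum.cong)
    also have "\<dots> = (\<Sum>S\<in>(\<lambda>S. S - {x}) ` {S. S \<subseteq> V \<and> ?ok S \<and> x \<in> S}. w (insert x S))"
      by (subst sum.reindex) (auto simp: inj_on_def insert_absorb)
    also have "\<dots> = (\<Sum>S\<in>(\<lambda>S. S - {x}) ` {S. S \<subseteq> V \<and> ?ok S \<and> x \<in> S}. link x S)"
    proof (intro sum.cong refl)
      fix S assume "S \<in> (\<lambda>S. S - {x}) ` {S. S \<subseteq> V \<and> ?ok S \<and> x \<in> S}"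
      then obtain S' where S': "S = S' - {x}" "?ok S'" by blast
      then have "?ok S" by blast
      then show "w (insert x S) = link x S" using S' by (simp add: link)
    qed
    also have "\<dots> \<le> (\<Sum>S | S \<subseteq> V \<and> {} \<subseteq> S. link x S)"
      using V w0 by (intro sum_mono2) (auto simp: link)
    finally show "(\<Sum>S | S \<subseteq> V \<and> ?ok S. if x \<in> S then w S else 0) \<le> wdeg V (link x) {}"
      unfolding wdeg_def .
  qed
  \<comment> \<open>Vertices that are not good contribute at most M / 4 altogether, so half of the
    remaining mass must come from good ones, each of which contributes at most \<beta> M /
    |V|.\<close>
  also have "\<dots> \<le> (\<Sum>x\<in>V. (if x \<in> ?good then \<beta> * M / ?N else 0) + M / (4 * ?N))"
  proof (rule sum_mono)
    fix x assume x: "x \<in> V"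
    have "wdeg V (link x) {} \<le> wdeg V w {x}" unfolding link
      by (rule wdeg_link_le) (use V w0 x in auto)
    also have "\<dots> \<le> \<beta> * M / ?N" using deg[of "{x}"] x by simp
    finally show "wdeg V (link x) {} \<le> (if x \<in> ?good then \<beta> * M / ?N else 0) + M / (4 * ?N)"
      using x M N by (auto intro: add_increasing2)
  qed
  also have "\<dots> = card ?good * (\<beta> * M / ?N) + M / 4"
    using V N by (simp add: sum.distrib sum.If_cases Int_def)
  finally have "M / 2 \<le> card ?good * (\<beta> * M / ?N) + M / 4" .
  moreover have "card ?good * (\<beta> * M / ?N) = M * (card ?good * \<beta> / ?N)" by simp
  ultimately have "M * (1 / 4) \<le> M * (card ?good * \<beta> / ?N)" by linarith
  then have "1 / 4 \<le> card ?good * \<beta> / ?N" using M by (simp only: mult_le_cancel_left_pos)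
  then show ?thesis using N \<beta> by (simp add: field_simps)
qed

text \<open>One run of the container algorithm. \<open>w'\<close> is the sum of the links of the b -
  m vertices chosen so far, and m are still to be chosen. An independent set either misses all good
  vertices and lies in their small complement, or it contains a good y; then it is also independent
  for the link of y, which is added to \<open>w'\<close>. Guessing y costs a factor of at most |V|.
  At m = 0 the mass of \<open>w'\<close> is large enough for the induction hypothesis in uniformity
  i.\<close>

lemma container_step:
  assumes V: "finite V" "V \<noteq> {}" and w: "uniform_weight V (Suc i) w" and M: "wdeg V w {} = M" "M > 0"
    and \<beta>: "\<beta> \<ge> 1" and \<tau>: "\<tau> > 0"
    and deg: "\<And>\<sigma>. \<sigma> \<subseteq> V \<Longrightarrow> \<sigma> \<noteq> {} \<Longrightarrow> wdeg V w \<sigma> \<le> \<beta> * M * \<tau> ^ (card \<sigma> - 1) / card V"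
    and b: "\<tau> * card V \<le> real b" "real b \<le> 2 * (\<tau> * card V)"
    and L: "L = 2 ^ (i + 2) * \<beta>"
    and IH: "\<And>w'. uniform_weight V i w' \<Longrightarrow> wdeg V w' {} > 0 \<Longrightarrow>
        (\<And>\<sigma>. \<sigma> \<subseteq> V \<Longrightarrow> \<sigma> \<noteq> {} \<Longrightarrow>
           wdeg V w' \<sigma> \<le> (4 * (L + 1) * \<beta>) * wdeg V w' {} * \<tau> ^ (card \<sigma> - 1) / card V) \<Longrightarrow>
        has_containers V x Q (weight_free w')"
    and x: "(1 - 1 / (4 * \<beta>)) * card V \<le> x" and Q: "Q \<ge> 0"
  shows "m \<le> b \<Longrightarrow> uniform_weight V i w' \<Longrightarrow> real (b - m) * (M / (4 * real (card V))) \<le> wdeg V w' {} \<Longrightarrow>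
     wdeg V w' {} \<le> real (b - m) * (\<beta> * M / card V) \<Longrightarrow>
     (\<And>\<sigma>. \<sigma> \<subseteq> V \<Longrightarrow> \<sigma> \<noteq> {} \<Longrightarrow> wdeg V w' \<sigma> \<le> (L + 1) * \<tau> * (\<beta> * M * \<tau> ^ (card \<sigma> - 1) / card V)) \<Longrightarrow>
     has_containers V x ((real (card V) + 1) ^ m * (Q + 1)) (\<lambda>I. weight_free w I \<and> weight_free w' I)"
proof (induction m arbitrary: w')
  case 0
  let ?N = "real (card V)"
  have N: "?N > 0" using V by (simp add: card_gt_0_iff)
  have Lp: "L > 0" using \<beta> by (simp add: L)
  \<comment> \<open>Every chosen vertex contributed at least M / (4 |V|). This converts the absolute
    cap on the degrees of \<open>w'\<close> into one relative to its own mass, and is the source of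
    the 4 in \<open>4 * (L + 1) * \<beta>\<close>.\<close>
  have "\<tau> * M / 4 = (\<tau> * ?N) * (M / (4 * ?N))" using N by simp
  also have "\<dots> \<le> b * (M / (4 * ?N))" using b M N by (intro mult_right_mono) auto
  also have "\<dots> \<le> wdeg V w' {}" using "0.prems"(3) by simp
  finally have m: "\<tau> * M / 4 \<le> wdeg V w' {}" .
  have "has_containers V x Q (weight_free w')"
  proof (rule IH)
    show "wdeg V w' {} > 0" using m M \<tau> by (smt (verit) divide_pos_pos mult_pos_pos)
    fix \<sigma> assume s: "\<sigma> \<subseteq> V" "\<sigma> \<noteq> {}"
    let ?P = "\<tau> ^ (card \<sigma> - 1) / ?N"
    have "a * \<tau> * (\<beta> * M * T / ?N) = (4 * a * \<beta> * (T / ?N)) * (\<tau> * M / 4)" for a T by simp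
    from this[of "L + 1" "\<tau> ^ (card \<sigma> - 1)"] have "wdeg V w' \<sigma> \<le> (4 * (L + 1) * \<beta> * ?P) * (\<tau> * M / 4)" using "0.prems"(5)[OF s] by linarith
    also have "\<dots> \<le> (4 * (L + 1) * \<beta> * ?P) * wdeg V w' {}"
      using m Lp \<beta> \<tau> N by (intro mult_left_mono) auto
    finally show "wdeg V w' \<sigma> \<le> (4 * (L + 1) * \<beta>) * wdeg V w' {} * \<tau> ^ (card \<sigma> - 1) / card V"
      by (simp add: mult_ac)
  qed (use 0 in auto)
  then show ?case by (rule has_containers_mono) auto
next
  case (Suc m)
  let ?N = "real (card V)"
  have N: "?N > 0" using V by (simp add: card_gt_0_iff)
  have Lp: "L > 0" using \<beta> by (simp add: L)
  have w0: "0 \<le> w S" for S using w by (simp add: uniform_weight_def)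
  define sat where "sat = {\<sigma>. \<sigma> \<subseteq> V \<and> \<sigma> \<noteq> {} \<and> wdeg V w' \<sigma> > L * \<tau> * (\<beta> * M * \<tau> ^ (card \<sigma> - 1) / card V)}"
  define link where "link x = (\<lambda>S. if x \<notin> S \<and> (\<forall>\<sigma>\<in>sat. \<not> \<sigma> \<subseteq> S) then w (insert x S) else 0)" for x
  define good where "good = {x\<in>V. wdeg V (link x) {} \<ge> M / (4 * real (card V))}"
  have "real (b - Suc m) * (\<beta> * M / ?N) \<le> b * (\<beta> * M / ?N)"
    using \<beta> M N by (intro mult_right_mono) auto
  also have "\<dots> \<le> 2 * (\<tau> * ?N) * (\<beta> * M / ?N)"
    using \<beta> M N b by (intro mult_right_mono) auto
  also have "\<dots> = 2 * \<tau> * \<beta> * M" using N by simp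
  finally have "wdeg V w' {} \<le> 2 * \<tau> * \<beta> * M" using Suc.prems(4) by linarith
  then have "real (card good) \<ge> ?N / (4 * \<beta>)" unfolding good_def
    by (intro many_good_vertices[OF V w M \<beta> \<tau> deg Suc.prems(2) _ L sat_def link_def]) auto
  moreover have "good \<subseteq> V" by (auto simp: good_def)
  moreover have "real (card (V - good)) = ?N - card good"
    using V \<open>good \<subseteq> V\<close> by (simp add: card_Diff_subset card_mono finite_subset of_nat_diff)
  moreover have "(1 - 1 / (4 * \<beta>)) * ?N = ?N - ?N / (4 * \<beta>)" by (simp add: left_diff_distrib)
  ultimately have small: "real (card (V - good)) \<le> (1 - 1 / (4 * \<beta>)) * ?N" by linarith
  let ?R = "(?N + 1) ^ m * (Q + 1)"
  have 1: "has_containers V x 1 (\<lambda>I. I \<inter> good = {})"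
    by (rule has_containers_single[of _ "V - good"]) (use V small x in auto)
  have 2: "has_containers V x (real (card good) * ?R) (\<lambda>I. weight_free w I \<and> weight_free w' I \<and> I \<inter> good \<noteq> {})"
  proof (rule has_containers_Union)
    show "finite good" "0 \<le> ?R" using V Q by (auto simp: good_def)
  next
    fix y assume y: "y \<in> good"
    then have yV: "y \<in> V" by (simp add: good_def)
    have link_le: "wdeg V (link y) \<sigma> \<le> wdeg V w (insert y \<sigma>)" if "\<sigma> \<subseteq> V" for \<sigma>
      unfolding link_def using V(1) w0 yV that by (rule wdeg_link_le)
    show "has_containers V x ?R (\<lambda>I. weight_free w I \<and> weight_free (\<lambda>S. w' S + link y S) I)"
    proof (rule Suc.IH)
      show "m \<le> b" using Suc.prems by simp
      have bm: "real (b - m) = real (b - Suc m) + 1" using Suc.prems(1) by (simp add: of_nat_diff)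
      show "uniform_weight V i (\<lambda>S. w' S + link y S)"
        unfolding uniform_weight_def
      proof (intro conjI allI impI)
        fix S show "0 \<le> w' S + link y S" using Suc.prems(2) w0 by (auto simp: uniform_weight_def link_def)
        assume nz: "w' S + link y S \<noteq> 0"
        then consider "w' S \<noteq> 0" | "link y S \<noteq> 0" by fastforce
        then have "S \<subseteq> V \<and> card S = i"
        proof cases
          case 1 then show ?thesis using Suc.prems(2) by (auto simp: uniform_weight_def)
        next
          case 2
          then have *: "y \<notin> S" "w (insert y S) \<noteq> 0" by (auto simp: link_def split: if_splits)
          then have "insert y S \<subseteq> V" "card (insert y S) = Suc i" using w by (auto simp: uniform_weight_def)
          moreover from this have "finite S" using V(1) finite_subset by auto
          ultimately show ?thesis using * by simp
        qed
        then show "S \<subseteq> V" "card S = i" by auto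
      qed
      have "M / (4 * ?N) \<le> wdeg V (link y) {}" using y by (simp add: good_def)
      then show "real (b - m) * (M / (4 * ?N)) \<le> wdeg V (\<lambda>S. w' S + link y S) {}"
        unfolding wdeg_add bm distrib_right using Suc.prems(3) by simp
      have "wdeg V (link y) {} \<le> \<beta> * M / ?N" using link_le[of "{}"] deg[of "{y}"] yV by simp
      then show "wdeg V (\<lambda>S. w' S + link y S) {} \<le> real (b - m) * (\<beta> * M / ?N)"
        unfolding wdeg_add bm distrib_right using Suc.prems(4) by simp
    next
      fix \<sigma> assume s: "\<sigma> \<subseteq> V" "\<sigma> \<noteq> {}"
      let ?D = "\<beta> * M * \<tau> ^ (card \<sigma> - 1) / ?N"
      have D: "?D \<ge> 0" using \<beta> M \<tau> N by simp
      \<comment> \<open>A saturated \<sigma> gains nothing. Any other \<sigma> is still at most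
        \<open>L * \<tau> * ?D\<close> and gains at most \<open>\<tau> * ?D\<close>, because
        inserting y into \<sigma> adds a factor \<tau> to the degree bound. The threshold is
        therefore overshot by one increment at most.\<close>
      show "wdeg V (\<lambda>S. w' S + link y S) \<sigma> \<le> (L + 1) * \<tau> * ?D"
      proof (cases "\<sigma> \<in> sat")
        case True
        then have "wdeg V (link y) \<sigma> = 0" unfolding wdeg_def by (intro sum.neutral) (auto simp: link_def)
        then show ?thesis unfolding wdeg_add using Suc.prems(5)[OF s] by simp
      next
        case False
        then have 1: "wdeg V w' \<sigma> \<le> L * \<tau> * ?D" using s by (auto simp: sat_def)
        have 2: "wdeg V (link y) \<sigma> \<le> \<tau> * ?D"
        proof (cases "y \<in> \<sigma>")
          case True
          then have "wdeg V (link y) \<sigma> = 0" unfolding wdeg_def by (intro sum.neutral) (auto simp: link_def)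
          then show ?thesis using mult_nonneg_nonneg[OF less_imp_le[OF \<tau>] D] by simp
        next
          case False
          have fs: "finite \<sigma>" using s V finite_subset by blast
          have "wdeg V (link y) \<sigma> \<le> wdeg V w (insert y \<sigma>)" using link_le s by blast
          also have "\<dots> \<le> \<beta> * M * \<tau> ^ (card (insert y \<sigma>) - 1) / ?N" using deg[of "insert y \<sigma>"] s yV by simp
          also have "card (insert y \<sigma>) - 1 = Suc (card \<sigma> - 1)"
            using False fs s by (simp add: card_gt_0_iff)
          finally show ?thesis by (simp add: mult_ac)
        qed
        show ?thesis unfolding wdeg_add using 1 2 unfolding distrib_right mult_1_left by linarith
      qed
    qed
  next
    fix I assume I: "I \<subseteq> V" "weight_free w I \<and> weight_free w' I \<and> I \<inter> good \<noteq> {}"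
    then obtain y where y: "y \<in> I" "y \<in> good" by blast
    have "weight_free (\<lambda>S. w' S + link y S) I"
      using I y by (auto simp: weight_free_def link_def)
    then show "\<exists>a\<in>good. weight_free w I \<and> weight_free (\<lambda>S. w' S + link a S) I" using I y by blast
  qed
  have hc: "has_containers V x (1 + real (card good) * ?R) (\<lambda>I. weight_free w I \<and> weight_free w' I)"
    by (rule has_containers_Un[OF 1 2]) auto
  have le: "1 + real (card good) * ?R \<le> (?N + 1) ^ Suc m * (Q + 1)"
  proof -
    have "1 \<le> (?N + 1) ^ m" by simp
    then have "1 * 1 \<le> ?R" using Q by (intro mult_mono) auto
    moreover have "real (card good) * ?R \<le> ?N * ?R"
      using Q V \<open>good \<subseteq> V\<close> by (intro mult_right_mono) (auto simp: card_mono)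
    ultimately have "1 + real (card good) * ?R \<le> ?R + ?N * ?R" by linarith
    then show ?thesis by (simp add: algebra_simps)
  qed
  show ?case by (rule has_containers_mono[OF hc order_refl le])
qed

text \<open>Induction on the uniformity, with \<beta> growing to
  \<open>4 * (L + 1) * \<beta>\<close> whenever the uniformity drops by one; thus \<delta> depends
  only on k and \<beta>. About \<tau> |V| vertices are guessed for each uniformity, which gives the
  exponent. Containers shrink by a constant factor only, and the theorem is iterated later.\<close>

theorem hypergraph_containers:
  fixes \<beta> :: real and k :: nat
  assumes "k \<ge> 1" "\<beta> \<ge> 1"
  shows "\<exists>\<delta>::real. \<delta> > 0 \<and> (\<forall>(V :: 'a set) w (\<tau>::real). finite V \<longrightarrow> V \<noteq> {} \<longrightarrow> \<tau> > 0 \<longrightarrow> \<tau> * card V \<ge> 1 \<longrightarrow>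
     uniform_weight V k w \<longrightarrow> wdeg V w {} > 0 \<longrightarrow>
     (\<forall>\<sigma>. \<sigma> \<subseteq> V \<longrightarrow> \<sigma> \<noteq> {} \<longrightarrow> wdeg V w \<sigma> \<le> \<beta> * wdeg V w {} * \<tau> ^ (card \<sigma> - 1) / card V) \<longrightarrow>
     has_containers V ((1 - \<delta>) * card V) ((real (card V) + 1) ^ (k * (nat \<lceil>\<tau> * card V\<rceil> + 1))) (weight_free w))"
  using assms
proof (induction k arbitrary: \<beta> rule: nat_induct_at_least)
  case base
  show ?case
  proof (intro exI[of _ "1 / \<beta>"] conjI allI impI)
    show "1 / \<beta> > 0" using base by simp
    fix V :: "'a set" and w and \<tau> :: real
    assume V: "finite V" "V \<noteq> {}" and w: "uniform_weight V 1 w" "wdeg V w {} > 0"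
      "\<forall>\<sigma>. \<sigma> \<subseteq> V \<longrightarrow> \<sigma> \<noteq> {} \<longrightarrow> wdeg V w \<sigma> \<le> \<beta> * wdeg V w {} * \<tau> ^ (card \<sigma> - 1) / card V"
    have "has_containers V ((1 - 1 / \<beta>) * card V) 1 (weight_free w)"
      using V w base by (intro container_base) auto
    then show "has_containers V ((1 - 1 / \<beta>) * card V)
        ((real (card V) + 1) ^ (1 * (nat \<lceil>\<tau> * card V\<rceil> + 1))) (weight_free w)"
      by (rule has_containers_mono[OF _ order_refl one_le_power]) simp_all
  qed
next
  case (Suc i)
  define L where "L = 2 ^ (i + 2) * \<beta>"
  have "1 \<le> 4 * (L + 1) * \<beta>" 
  proof -
    have "L \<ge> 0" using Suc.prems(1) by (simp add: L_def)
    then have "1 * 1 \<le> (4 * (L + 1)) * \<beta>" using Suc.prems(1) by (intro mult_mono) auto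
    then show ?thesis by simp
  qed
  from Suc.IH[OF this] obtain \<delta> :: real where \<delta>: "\<delta> > 0"
    and IH: "\<forall>(V :: 'a set) w (\<tau>::real). finite V \<longrightarrow> V \<noteq> {} \<longrightarrow> \<tau> > 0 \<longrightarrow> \<tau> * card V \<ge> 1 \<longrightarrow>
     uniform_weight V i w \<longrightarrow> wdeg V w {} > 0 \<longrightarrow>
     (\<forall>\<sigma>. \<sigma> \<subseteq> V \<longrightarrow> \<sigma> \<noteq> {} \<longrightarrow> wdeg V w \<sigma> \<le> (4 * (L + 1) * \<beta>) * wdeg V w {} * \<tau> ^ (card \<sigma> - 1) / card V) \<longrightarrow>
     has_containers V ((1 - \<delta>) * card V) ((real (card V) + 1) ^ (i * (nat \<lceil>\<tau> * card V\<rceil> + 1))) (weight_free w)"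
    by (elim exE conjE)
  define \<delta>' where "\<delta>' = min \<delta> (1 / (4 * \<beta>))"
  show ?case
  proof (intro exI[of _ \<delta>'] conjI allI impI)
    show "\<delta>' > 0" using \<delta> Suc.prems by (simp add: \<delta>'_def)
    fix V :: "'a set" and w and \<tau> :: real
    assume V: "finite V" "V \<noteq> {}" and \<tau>: "\<tau> > 0" "\<tau> * card V \<ge> 1"
      and w: "uniform_weight V (Suc i) w" "wdeg V w {} > 0"
      and deg: "\<forall>\<sigma>. \<sigma> \<subseteq> V \<longrightarrow> \<sigma> \<noteq> {} \<longrightarrow> wdeg V w \<sigma> \<le> \<beta> * wdeg V w {} * \<tau> ^ (card \<sigma> - 1) / card V"
    let ?N = "real (card V)" let ?b = "nat \<lceil>\<tau> * ?N\<rceil>" let ?x = "(1 - \<delta>') * ?N"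
    let ?Q = "(?N + 1) ^ (i * (?b + 1))"
    \<comment> \<open>The run starts from the zero weight with all \<open>?b\<close> vertices still
      to be chosen.\<close>
    have hc: "has_containers V ?x ((?N + 1) ^ ?b * (?Q + 1)) (\<lambda>I. weight_free w I \<and> weight_free (\<lambda>S. 0) I)"
    proof (rule container_step[OF V w(1) refl w(2) _ \<tau>(1) _ _ _ L_def])
      fix w' assume "uniform_weight V i w'" "wdeg V w' {} > 0"
        "(\<And>\<sigma>. \<sigma> \<subseteq> V \<Longrightarrow> \<sigma> \<noteq> {} \<Longrightarrow>
           wdeg V w' \<sigma> \<le> (4 * (L + 1) * \<beta>) * wdeg V w' {} * \<tau> ^ (card \<sigma> - 1) / card V)"
      then have "has_containers V ((1 - \<delta>) * ?N) ?Q (weight_free w')" using V \<tau>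
        by (intro IH[rule_format]) simp_all
      then show "has_containers V ?x ?Q (weight_free w')"
        by (rule has_containers_mono) (auto simp: \<delta>'_def intro: mult_right_mono)
    next
      show "(1 - 1 / (4 * \<beta>)) * ?N \<le> ?x" by (intro mult_right_mono) (auto simp: \<delta>'_def)
      show "\<tau> * ?N \<le> real ?b" by linarith
      show "real ?b \<le> 2 * (\<tau> * ?N)" using \<tau> by linarith
      have "L > 0" using Suc.prems by (simp add: L_def)
      then show "wdeg V (\<lambda>S. 0) \<sigma> \<le> (L + 1) * \<tau> * (\<beta> * wdeg V w {} * \<tau> ^ (card \<sigma> - 1) / ?N)" for \<sigma>
        using \<tau> w(2) Suc.prems by (simp add: wdeg_def)
    qed (use Suc.prems deg in \<open>auto simp: uniform_weight_def wdeg_def\<close>)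
    have le: "(?N + 1) ^ ?b * (?Q + 1) \<le> (?N + 1) ^ (Suc i * (?b + 1))"
    proof -
      have "?N \<ge> 1" using V by (simp add: Suc_leI card_gt_0_iff)
      have "1 \<le> ?Q" by simp
      then have "?Q + 1 \<le> 2 * ?Q" by linarith
      also have "\<dots> \<le> (?N + 1) * ?Q" using \<open>?N \<ge> 1\<close> by (intro mult_right_mono) auto
      finally have "(?N + 1) ^ ?b * (?Q + 1) \<le> (?N + 1) ^ ?b * ((?N + 1) * ?Q)"
        by (intro mult_left_mono) auto
      then show ?thesis by (simp add: power_add algebra_simps)
    qed
    show "has_containers V ?x ((?N + 1) ^ (Suc i * (?b + 1))) (weight_free w)"
      by (rule has_containers_mono[OF hc order_refl le]) (auto simp: weight_free_def)
  qed
qed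

section \<open>Coded copies of the target\<close>

definition pair_edges :: "'a set set \<Rightarrow> 'a \<Rightarrow> 'a \<Rightarrow> 'a set set" where
  "pair_edges H u w = {e\<in>H. u \<in> e \<and> w \<in> e}"

abbreviation pdeg :: "'a set set \<Rightarrow> 'a \<Rightarrow> 'a \<Rightarrow> real" where
  "pdeg H u w \<equiv> real (card (pair_edges H u w))"

lemma pair_edges_commute: "pair_edges H u w = pair_edges H w u"
  by (auto simp: pair_edges_def)

text \<open>
  A copy of \<open>K\<^sub>2\<^sub>,\<^sub>t\<^sup>(\<^sup>r\<^sup>)\<close> is coded by its two vertices \<open>u\<close>, \<open>v\<close> on the small side and by
  \<open>f i = (w, X, Y)\<close> for \<open>i < t\<close>, where \<open>w\<close> is the \<open>i\<close>-th vertex on the large side and \<open>X\<close>, \<open>Y\<close> are the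
  edges containing \<open>u, w\<close> and \<open>v, w\<close>. These occupy the positions \<open>(i, True)\<close> and \<open>(i, False)\<close>.
\<close>

definition side :: "'a \<times> 'b \<times> 'b \<Rightarrow> bool \<Rightarrow> 'b" where
  "side x c = (if c then fst (snd x) else snd (snd x))"

definition edge_at :: "(nat \<Rightarrow> 'a \<times> 'b \<times> 'b) \<Rightarrow> nat \<times> bool \<Rightarrow> 'b" where
  "edge_at f z = side (f (fst z)) (snd z)"

definition edge_set :: "nat \<Rightarrow> (nat \<Rightarrow> 'a \<times> 'b \<times> 'b) \<Rightarrow> 'b set" where
  "edge_set t f = edge_at f ` ({..<t} \<times> UNIV)"

text \<open>\<open>Z\<close> consists of the vertices occupied so far. As X also belongs to the set
  that Y must avoid, X and Y meet only in w as soon as u and v are in \<open>Z\<close>.\<close>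

fun fits :: "'a set set \<Rightarrow> 'a \<Rightarrow> 'a \<Rightarrow> 'a set \<Rightarrow> 'a \<times> 'a set \<times> 'a set \<Rightarrow> bool" where
  "fits H u v Z (w, X, Y) \<longleftrightarrow> X \<in> pair_edges H u w \<and> Y \<in> pair_edges H v w \<and> w \<notin> Z \<and>
     (X - {u, w}) \<inter> Z = {} \<and> (Y - {v, w}) \<inter> (Z \<union> X) = {}"

definition used :: "'a \<Rightarrow> 'a \<Rightarrow> (nat \<Rightarrow> 'a \<times> 'a set \<times> 'a set) \<Rightarrow> nat \<Rightarrow> 'a set" where
  "used u v f i = {u, v} \<union> (\<Union>l<i. fst (snd (f l)) \<union> snd (snd (f l)))"

definition valid :: "'a set set \<Rightarrow> nat \<Rightarrow> 'a \<Rightarrow> 'a \<Rightarrow> (nat \<Rightarrow> 'a \<times> 'a set \<times> 'a set) \<Rightarrow> bool" where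
  "valid H t u v f \<longleftrightarrow> u \<noteq> v \<and> (\<forall>i<t. fits H u v (used u v f i) (f i))"

text \<open>It suffices to embed F and to extend the image of each edge e to an r-edge
  \<open>G e\<close> whose remaining vertices avoid the image of F and one another: any bijection
  from the r - 2 new vertices of e to those remaining vertices completes the embedding.\<close>

lemma contains_copy_expansionI:
  assumes F: "r_graph 2 F"
    and f: "inj_on f (verts F)" "f ` verts F \<subseteq> verts K"
    and G: "\<And>e. e \<in> edges F \<Longrightarrow> G e \<in> edges K \<and> finite (G e) \<and> card (G e) = r \<and> f ` e \<subseteq> G e \<and> G e \<subseteq> verts K"
    and core: "\<And>e. e \<in> edges F \<Longrightarrow> (G e - f ` e) \<inter> f ` verts F = {}"
    and disj: "\<And>e e'. e \<in> edges F \<Longrightarrow> e' \<in> edges F \<Longrightarrow> e \<noteq> e' \<Longrightarrow> (G e - f ` e) \<inter> (G e' - f ` e') = {}"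
  shows "contains_copy K (expansion r F)"
proof -
  have "\<exists>h. bij_betw h {..<r - 2} (G e - f ` e)" if e: "e \<in> edges F" for e
  proof -
    have "e \<subseteq> verts F" "card e = 2" using F e by (auto simp: r_graph_def)
    then have "card (f ` e) = 2" using f(1) by (metis card_image inj_on_subset)
    then have "card (G e - f ` e) = r - 2"
      using G[OF e] by (subst card_Diff_subset) (auto intro: finite_subset)
    then show ?thesis using ex_bij_betw_nat_finite[of "G e - f ` e"] G[OF e]
      by (auto simp: lessThan_atLeast0)
  qed
  then obtain h where h: "\<And>e. e \<in> edges F \<Longrightarrow> bij_betw (h e) {..<r - 2} (G e - f ` e)" by metis
  define \<phi> where "\<phi> = case_sum f (\<lambda>(e, m). h e m)"
  have hin: "h e m \<in> G e - f ` e" if "e \<in> edges F" "m < r - 2" for e m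
    using h[OF that(1)] that(2) by (auto simp: bij_betw_def)
  have "inj_on \<phi> (verts (expansion r F))"
  proof (rule inj_onI)
    fix x y assume x: "x \<in> verts (expansion r F)" and y: "y \<in> verts (expansion r F)" and eq: "\<phi> x = \<phi> y"
    show "x = y"
    proof (cases x; cases y)
      fix a b assume "x = Inl a" "y = Inl b"
      then show ?thesis using x y eq f(1) by (auto simp: expansion_def \<phi>_def dest: inj_onD)
    next
      fix a b assume a: "x = Inl a" "y = Inr b"
      obtain e m where b: "b = (e, m)" by (cases b)
      have "e \<in> edges F" "m < r - 2" "a \<in> verts F" using x y a b by (auto simp: expansion_def)
      moreover from this have "f a \<in> f ` verts F" by blast
      moreover have "f a = h e m" using eq a b by (simp add: \<phi>_def)
      ultimately show ?thesis using hin[of e m] core[of e] by auto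
    next
      fix a b assume a: "x = Inr b" "y = Inl a"
      obtain e m where b: "b = (e, m)" by (cases b)
      have "e \<in> edges F" "m < r - 2" "a \<in> verts F" using x y a b by (auto simp: expansion_def)
      moreover from this have "f a \<in> f ` verts F" by blast
      moreover have "f a = h e m" using eq a b by (simp add: \<phi>_def)
      ultimately show ?thesis using hin[of e m] core[of e] by auto
    next
      fix b b' assume a: "x = Inr b" "y = Inr b'"
      obtain e m e' m' where b: "b = (e, m)" "b' = (e', m')" by (cases b; cases b')
      have e: "e \<in> edges F" "m < r - 2" "e' \<in> edges F" "m' < r - 2" using x y a b by (auto simp: expansion_def)
      have eq': "h e m = h e' m'" using eq a b by (simp add: \<phi>_def)
      then have "e = e'" using hin[OF e(1,2)] hin[OF e(3,4)] disj[OF e(1,3)] by (metis disjoint_iff)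
      then show ?thesis using eq' h[OF e(1)] e a b by (auto simp: bij_betw_def dest: inj_onD)
    qed
  qed
  moreover have "\<phi> ` verts (expansion r F) \<subseteq> verts K"
  proof
    fix y assume "y \<in> \<phi> ` verts (expansion r F)"
    then obtain x where x: "x \<in> verts (expansion r F)" "y = \<phi> x" by blast
    show "y \<in> verts K"
    proof (cases x)
      case (Inl a)
      then show ?thesis using x f(2) by (auto simp: expansion_def \<phi>_def)
    next
      case (Inr b)
      obtain e m where b: "b = (e, m)" by (cases b)
      then have "e \<in> edges F" "m < r - 2" using x Inr by (auto simp: expansion_def)
      then show ?thesis using hin[of e m] G[of e] x Inr b by (auto simp: \<phi>_def)
    qed
  qed
  moreover have "\<phi> ` x \<in> edges K" if x: "x \<in> edges (expansion r F)" for x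
  proof -
    obtain e where e: "e \<in> edges F" "x = e <+> {e} \<times> {..<r - 2}" using x unfolding expansion_def hypergraph.sel by blast
    have "\<phi> ` x = f ` e \<union> h e ` {..<r - 2}"
      unfolding e(2) Plus_def \<phi>_def by (auto simp: image_Un image_image)
    also have "\<dots> = G e" using h[OF e(1)] G[OF e(1)] by (auto simp: bij_betw_def)
    finally show ?thesis using G[OF e(1)] by simp
  qed
  ultimately show ?thesis unfolding contains_copy_def by blast
qed

lemma used_mono: "i \<le> j \<Longrightarrow> used u v f i \<subseteq> used u v f j"
  unfolding used_def by fastforce

lemma side_subset_used: "i < j \<Longrightarrow> side (f i) c \<subseteq> used u v f j"
  by (auto simp: used_def side_def split: if_splits)

lemma validD:
  assumes "valid H t u v f" "i < t"
  shows "side (f i) c \<in> H" "(if c then u else v) \<in> side (f i) c" "fst (f i) \<in> side (f i) c"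
    "fst (f i) \<notin> used u v f i" 
    "(side (f i) c - {if c then u else v, fst (f i)}) \<inter> used u v f i = {}"
    "(side (f i) False - {v, fst (f i)}) \<inter> side (f i) True = {}" "u \<noteq> v"
proof -
  obtain w X Y where f: "f i = (w, X, Y)" by (cases "f i")
  have ne: "u \<noteq> v" and "fits H u v (used u v f i) (f i)" using assms by (simp_all add: valid_def)
  then have fits: "X \<in> pair_edges H u w" "Y \<in> pair_edges H v w" "w \<notin> used u v f i"
     "(X - {u, w}) \<inter> used u v f i = {}" "(Y - {v, w}) \<inter> (used u v f i \<union> X) = {}" unfolding f by simp_all
  then show "side (f i) c \<in> H" "(if c then u else v) \<in> side (f i) c" "fst (f i) \<in> side (f i) c"
    "fst (f i) \<notin> used u v f i"
    "(side (f i) c - {if c then u else v, fst (f i)}) \<inter> used u v f i = {}"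
    "(side (f i) False - {v, fst (f i)}) \<inter> side (f i) True = {}" "u \<noteq> v"
    unfolding f using ne by (simp_all add: side_def pair_edges_def Int_Un_distrib)
qed

text \<open>A later edge contains its own w, which lies outside all earlier edges, and within a
  triple X contains u while Y does not. So a copy has exactly 2t edges, which makes the law on
  copies a uniform weight.\<close>

lemma edge_at_inj:
  assumes "valid H t u v f"
  shows "inj_on (edge_at f) ({..<t} \<times> UNIV)"
proof -
  have *: "side (f i) c \<noteq> side (f j) d" if "i < j" "j < t" for i j c d
    using validD(3,4)[OF assms that(2)] side_subset_used[OF that(1), of f c u v] by blast
  have **: "side (f i) True \<noteq> side (f i) False" if "i < t" for i
  proof -
    have "u \<in> side (f i) True" using validD(2)[OF assms that, of True] by simp
    moreover have "u \<notin> side (f i) False"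
      using validD(4,5,7)[OF assms that] validD(5)[OF assms that, of False] by (auto simp: used_def)
    ultimately show ?thesis by blast
  qed
  show ?thesis
  proof (rule inj_onI)
    fix x y assume xy: "x \<in> {..<t} \<times> (UNIV :: bool set)" "y \<in> {..<t} \<times> UNIV" "edge_at f x = edge_at f y"
    obtain i c j d where e: "x = (i, c)" "y = (j, d)" by (cases x; cases y)
    have "i = j" using xy e *[of i j c d] *[of j i d c] by (auto simp: edge_at_def) (metis nat_neq_iff)
    then show "x = y" using xy e **[of i] by (cases c; cases d) (auto simp: edge_at_def)
  qed
qed

lemma card_edge_set: "valid H t u v f \<Longrightarrow> card (edge_set t f) = 2 * t"
  unfolding edge_set_def by (subst card_image[OF edge_at_inj]) (auto simp: card_cartesian_product UNIV_bool)

text \<open>The host \<open>K\<close> is separate from \<open>H\<close>: copies are sampled in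
  \<open>H\<close>, but they must be recognised in every hypergraph that contains their
  edges.\<close>

lemma valid_contains_copy:
  assumes val: "valid H t u v f" and t: "t \<ge> 1"
    and H: "\<And>e. e \<in> H \<Longrightarrow> finite e \<and> card e = r"
    and K: "edge_set t f \<subseteq> edges K" "\<And>e. e \<in> edge_set t f \<Longrightarrow> e \<subseteq> verts K"
  shows "contains_copy K (expansion r (complete_bipartite 2 t))"
proof -
  define w where "w j = fst (f j)" for j
  define a where "a c = (if c then u else v)" for c
  define m where "m = case_sum (\<lambda>i::nat. a (i = 0)) w"
  \<comment> \<open>The edge {Inl i, Inr j} is a set, so its two ends have to be recovered by a
    description.\<close>
  define G where "G e = (THE x. \<exists>i j. e = {Inl i, Inr j} \<and> x = side (f j) (i = 0))" for e :: "(nat + nat) set"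
  have G: "G {Inl i, Inr j} = side (f j) (i = 0)" for i j
    unfolding G_def by (rule the_equality) (auto simp: doubleton_eq_iff)
  have wu: "w j \<notin> used u v f i" if "i \<le> j" "j < t" for i j
    using validD(4)[OF val that(2)] used_mono[OF that(1), of u v f] by (auto simp: w_def)
  have ain: "a c \<in> used u v f i" for c i by (auto simp: a_def used_def)
  have wused: "w j \<in> used u v f i" if "j < i" "i \<le> t" for i j
    using validD(3)[OF val, of j True] side_subset_used[OF that(1), of f True u v] that by (auto simp: w_def)
  have wne: "w i \<noteq> w j" if "i < j" "j < t" for i j using wu[of j j] wused[of i j] that by auto
  have ne: "u \<noteq> v" using val by (simp add: valid_def)
  have aw: "a c \<noteq> w j" if "j < t" for c j using wu[of j j] ain[of c j] that by auto
  define B where "B j c = side (f j) c - {a c, w j}" for j c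
  have Bdis: "B j c \<inter> used u v f j = {}" if "j < t" for j c
    using validD(5)[OF val that, of c] by (simp add: B_def a_def w_def)
  have Bw: "w l \<notin> B j c" if "j < t" "l < t" for j l c
  proof (cases "l < j")
    case True then show ?thesis using wused[of l j] Bdis[of j c] that by auto
  next
    case False
    show ?thesis
    proof (cases "l = j")
      case True then show ?thesis by (simp add: B_def)
    next
      case False
      then have "j < l" using \<open>\<not> l < j\<close> by simp
      then show ?thesis using wu[of l l] side_subset_used[of j l f c u v] that by (auto simp: B_def)
    qed
  qed
  have Ba: "a d \<notin> B j c" if "j < t" for j c d using Bdis[OF that, of c] ain[of d j] by auto
  have BB: "B i c \<inter> B j d = {}" if "i < j" "j < t" for i j c d
    using Bdis[of j d] side_subset_used[OF that(1), of f c u v] that by (auto simp: B_def)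
  have BB': "B j True \<inter> B j False = {}" if "j < t" for j
    using validD(6)[OF val that] by (auto simp: B_def a_def w_def)
  have mim: "m ` {Inl i, Inr j} = {a (i = 0), w j}" for i j by (auto simp: m_def)
  have Gm: "G {Inl i, Inr j} - m ` {Inl i, Inr j} = B j (i = 0)" for i j
    unfolding mim G by (simp add: B_def)
  have sub: "side (f j) c \<in> edge_set t f" if "j < t" for j c
    using that by (force simp: edge_set_def edge_at_def)
  have mv: "m ` verts (complete_bipartite 2 t) = {u, v} \<union> w ` {..<t}"
  proof -
    have "{..<2::nat} = {0, 1}" by auto
    then show ?thesis by (auto simp: complete_bipartite_def m_def a_def image_Un Plus_def image_image)
  qed
  show ?thesis
  proof (rule contains_copy_expansionI[where f = m and G = G])
    show "r_graph 2 (complete_bipartite 2 t)" by (rule r_graph_complete_bipartite)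
    show "inj_on m (verts (complete_bipartite 2 t))"
    proof (rule inj_onI)
      fix x y assume xy: "x \<in> verts (complete_bipartite 2 t)" "y \<in> verts (complete_bipartite 2 t)" "m x = m y"
      show "x = y"
      proof (cases x; cases y)
        fix p q assume "x = Inl p" "y = Inl q"
        then show ?thesis using xy ne by (auto simp: complete_bipartite_def m_def a_def split: if_splits)
      next
        fix p q assume "x = Inl p" "y = Inr q"
        then show ?thesis using xy aw by (auto simp: complete_bipartite_def m_def)
      next
        fix p q assume "x = Inr p" "y = Inl q"
        then show ?thesis using xy aw by (force simp: complete_bipartite_def m_def)
      next
        fix p q assume "x = Inr p" "y = Inr q"
        then show ?thesis using xy wne[of p q] wne[of q p]
          by (auto simp: complete_bipartite_def m_def) (metis nat_neq_iff)
      qed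
    qed
    show "m ` verts (complete_bipartite 2 t) \<subseteq> verts K"
    proof -
      have "a c \<in> verts K" for c
      proof -
        have "a c \<in> side (f 0) c" using validD(2)[OF val, of 0 c] t by (simp add: a_def)
        then show ?thesis using K(2)[OF sub[of 0 c]] t by auto
      qed
      from this[of True] this[of False] have "u \<in> verts K" "v \<in> verts K" by (auto simp: a_def)
      moreover have "w j \<in> verts K" if "j < t" for j
        using validD(3)[OF val that, of True] K(2)[OF sub[OF that, of True]] by (auto simp: w_def)
      ultimately show ?thesis unfolding mv by auto
    qed
  next
    fix e assume "e \<in> edges (complete_bipartite 2 t)"
    then obtain i j where e: "e = {Inl i, Inr j}" "i < 2" "j < t" by (auto simp: complete_bipartite_def)
    let ?c = "i = 0"
    have "side (f j) ?c \<in> H" "a ?c \<in> side (f j) ?c" "w j \<in> side (f j) ?c"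
      using validD(1,2,3)[OF val e(3), of ?c] by (simp_all add: a_def w_def)
    moreover from this have "finite (side (f j) ?c)" "card (side (f j) ?c) = r" using H by auto
    moreover have "side (f j) ?c \<in> edges K" "side (f j) ?c \<subseteq> verts K" using K sub[OF e(3)] by auto
    ultimately show "G e \<in> edges K \<and> finite (G e) \<and> card (G e) = r \<and> m ` e \<subseteq> G e \<and> G e \<subseteq> verts K"
      unfolding e(1) mim G by simp
    show "(G e - m ` e) \<inter> m ` verts (complete_bipartite 2 t) = {}"
    proof -
      have "u \<notin> B j ?c" "v \<notin> B j ?c" using Ba[OF e(3), of True] Ba[OF e(3), of False] by (simp_all add: a_def)
      then show ?thesis unfolding e(1) Gm mv using Bw[OF e(3)] by auto
    qed
    fix e' assume "e' \<in> edges (complete_bipartite 2 t)" and ne: "e \<noteq> e'"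
    then obtain i' j' where e': "e' = {Inl i', Inr j'}" "i' < 2" "j' < t" by (auto simp: complete_bipartite_def)
    have "j \<noteq> j' \<or> (i = 0) \<noteq> (i' = 0)" using e e' ne by auto
    then show "(G e - m ` e) \<inter> (G e' - m ` e') = {}"
      unfolding e(1) e'(1) Gm
    proof (cases "j = j'")
      case True
      assume "j \<noteq> j' \<or> (i = 0) \<noteq> (i' = 0)"
      then consider "(i = 0) = True \<and> (i' = 0) = False" | "(i = 0) = False \<and> (i' = 0) = True" using True by auto
      then show "B j (i = 0) \<inter> B j' (i' = 0) = {}"
        using BB'[OF e(3)] True by cases (simp_all only: Int_commute)
    next
      case False
      then consider "j < j'" | "j' < j" by linarith
      then show "B j (i = 0) \<inter> B j' (i' = 0) = {}"
        using BB[of j j' "i = 0" "i' = 0"] BB[of j' j "i' = 0" "i = 0"] e(3) e'(3) by cases auto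
    qed
  qed
qed

section \<open>Spread distributions on copies\<close>

lemma divide_le_if: "x \<le> y * d \<Longrightarrow> 0 \<le> d \<Longrightarrow> 0 \<le> y \<Longrightarrow> x / d \<le> y" for x y d :: real
  by (cases "d = 0") (auto simp: divide_simps)

text \<open>
  The random copy: \<open>(u, v)\<close> has distribution \<open>\<pi>\<close>, and given \<open>(u, v)\<close> the \<open>t\<close> triples \<open>(w, X, Y)\<close> are
  independent, \<open>w\<close> having distribution \<open>k u v\<close> and \<open>X\<close>, \<open>Y\<close> being uniform edges through \<open>u, w\<close> and
  \<open>v, w\<close>.
\<close>

locale spread =
  fixes V :: "'a set" and H :: "'a set set" and r t :: nat
    and \<pi> :: "'a \<Rightarrow> 'a \<Rightarrow> real" and k :: "'a \<Rightarrow> 'a \<Rightarrow> 'a \<Rightarrow> real"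
    and B \<tau> h \<rho> \<kappa> \<rho>2 \<kappa>2 :: real
  assumes finV: "finite V" and H: "\<And>e. e \<in> H \<Longrightarrow> e \<subseteq> V \<and> card e = r" and t1: "t \<ge> 1"
    and pi0: "\<And>u v. 0 \<le> \<pi> u v" and k0: "\<And>u v w. 0 \<le> k u v w"
    and kpos: "\<And>u v w. k u v w \<noteq> 0 \<Longrightarrow> u \<noteq> v \<and> pair_edges H u w \<noteq> {} \<and> pair_edges H v w \<noteq> {}"
    and pi_sum: "(\<Sum>u\<in>V. \<Sum>v\<in>V. \<pi> u v) = 1"
    and k_le: "\<And>u v. u \<in> V \<Longrightarrow> v \<in> V \<Longrightarrow> (\<Sum>w\<in>V. k u v w) \<le> 1"
    and k_eq: "\<And>u v. u \<in> V \<Longrightarrow> v \<in> V \<Longrightarrow> \<pi> u v \<noteq> 0 \<Longrightarrow> (\<Sum>w\<in>V. k u v w) = 1"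
    and marg1: "\<And>u w. u \<in> V \<Longrightarrow> w \<in> V \<Longrightarrow> (\<Sum>v\<in>V. \<pi> u v * k u v w) \<le> B * pdeg H u w / h"
    and marg2: "\<And>v w. v \<in> V \<Longrightarrow> w \<in> V \<Longrightarrow> (\<Sum>u\<in>V. \<pi> u v * k u v w) \<le> B * pdeg H v w / h"
    and pik: "\<And>u v w. \<pi> u v * k u v w \<le> \<kappa>2 * (pdeg H u w * pdeg H v w)"
    and k1: "\<And>u v w. k u v w \<le> \<rho> * pdeg H u w" "\<And>u v w. k u v w \<le> \<rho> * pdeg H v w"
    and k2: "\<And>u v w. k u v w \<le> \<rho>2 * (pdeg H u w * pdeg H v w)"
    and ksmall: "\<And>u v w. k u v w \<le> \<kappa>" and kap: "\<kappa> * real (2 + 2 * r * t) \<le> 1 / 4"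
    and tdeg: "\<And>u v w z. k u v w \<noteq> 0 \<Longrightarrow> z \<noteq> u \<Longrightarrow> z \<noteq> w \<Longrightarrow>
       8 * real (2 + 2 * r * t + r) * card {e \<in> pair_edges H u w. z \<in> e} \<le> pdeg H u w"
      "\<And>u v w z. k u v w \<noteq> 0 \<Longrightarrow> z \<noteq> v \<Longrightarrow> z \<noteq> w \<Longrightarrow>
       8 * real (2 + 2 * r * t + r) * card {e \<in> pair_edges H v w. z \<in> e} \<le> pdeg H v w"
    and B1: "B \<ge> 1" and h0: "h > 0" and \<tau>0: "\<tau> > 0" and rho0: "\<rho> \<ge> 0" "\<rho>2 \<ge> 0" "\<kappa>2 \<ge> 0"
    and r1: "r \<ge> 1"
    and num1: "\<rho> \<le> B * \<tau>"
    and num2: "\<And>b. 1 \<le> b \<Longrightarrow> b \<le> t \<Longrightarrow> \<kappa>2 * \<rho>2 ^ (b - 1) \<le> B * \<tau> ^ (2 * b - 1) / h"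
begin

section \<open>The law of a single triple given u and v\<close>

definition Tr where "Tr = V \<times> H \<times> H"

text \<open>The conditional probability of the triple (w, X, Y) given u and v.\<close>

fun g :: "'a \<Rightarrow> 'a \<Rightarrow> 'a \<times> 'a set \<times> 'a set \<Rightarrow> real" where
  "g u v (w, X, Y) = (if X \<in> pair_edges H u w \<and> Y \<in> pair_edges H v w
     then k u v w / (pdeg H u w * pdeg H v w) else 0)"

lemma finH: "finite H"
  by (rule finite_subset[of _ "Pow V"]) (use H finV in auto)

lemma fin_pair [simp]: "finite (pair_edges H u w)"
  using finH by (simp add: pair_edges_def)

lemma finTr [simp]: "finite Tr"
  using finV finH by (simp add: Tr_def)

lemma fin_edge: "e \<in> H \<Longrightarrow> finite e"
  using H finV finite_subset by blast

lemma g0: "0 \<le> g u v x"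
  using k0 by (cases x) auto

lemma g_sum:
  "(\<Sum>x\<in>Tr. if R x then g u v x else 0) =
   (\<Sum>w\<in>V. k u v w / (pdeg H u w * pdeg H v w) *
      (\<Sum>X\<in>pair_edges H u w. real (card {Y\<in>pair_edges H v w. R (w, X, Y)})))"
proof -
  have "(\<Sum>x\<in>Tr. if R x then g u v x else 0) =
     (\<Sum>w\<in>V. \<Sum>X\<in>H. \<Sum>Y\<in>H. if R (w, X, Y) then g u v (w, X, Y) else 0)"
    unfolding Tr_def by (simp add: sum.cartesian_product' del: g.simps)
  also have "\<dots> = (\<Sum>w\<in>V. k u v w / (pdeg H u w * pdeg H v w) *
      (\<Sum>X\<in>pair_edges H u w. real (card {Y\<in>pair_edges H v w. R (w, X, Y)})))"
  proof (rule sum.cong[OF refl])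
    fix w
    let ?c = "k u v w / (pdeg H u w * pdeg H v w)"
    have "(\<Sum>X\<in>H. \<Sum>Y\<in>H. if R (w, X, Y) then g u v (w, X, Y) else 0)
      = (\<Sum>X\<in>H. if X \<in> pair_edges H u w then ?c * real (card {Y\<in>pair_edges H v w. R (w, X, Y)}) else 0)"
    proof (rule sum.cong[OF refl])
      fix X
      have "(\<Sum>Y\<in>H. if R (w, X, Y) then g u v (w, X, Y) else 0)
         = (\<Sum>Y\<in>{Y\<in>pair_edges H v w. R (w, X, Y)}. if X \<in> pair_edges H u w then ?c else 0)"
        using finH by (intro sum.mono_neutral_cong_right) (auto simp: pair_edges_def)
      then show "(\<Sum>Y\<in>H. if R (w, X, Y) then g u v (w, X, Y) else 0)
         = (if X \<in> pair_edges H u w then ?c * real (card {Y\<in>pair_edges H v w. R (w, X, Y)}) else 0)"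
        by simp
    qed
    also have "\<dots> = (\<Sum>X\<in>pair_edges H u w. ?c * real (card {Y\<in>pair_edges H v w. R (w, X, Y)}))"
      using finH by (intro sum.mono_neutral_cong_right) (auto simp: pair_edges_def)
    finally show "(\<Sum>X\<in>H. \<Sum>Y\<in>H. if R (w, X, Y) then g u v (w, X, Y) else 0) =
      ?c * (\<Sum>X\<in>pair_edges H u w. real (card {Y\<in>pair_edges H v w. R (w, X, Y)}))"
      by (simp only: sum_distrib_left)
  qed
  finally show ?thesis .
qed

lemma scaled_weight_mono:
  assumes "0 \<le> x" "x \<le> a * b"
  shows "k u v w / (pdeg H u w * pdeg H v w) * x \<le> k u v w / (pdeg H u w * pdeg H v w) * (a * b)"
  using assms k0 by (intro mult_left_mono) auto

lemma g_none:
  assumes "u \<in> V" "v \<in> V"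
  shows "(\<Sum>x\<in>Tr. if R x then g u v x else 0) \<le> 1"
proof -
  have "(\<Sum>x\<in>Tr. if R x then g u v x else 0) \<le> (\<Sum>w\<in>V. k u v w)"
    unfolding g_sum
  proof (rule sum_mono)
    fix w
    let ?c = "k u v w / (pdeg H u w * pdeg H v w)"
    have "(\<Sum>X\<in>pair_edges H u w. real (card {Y\<in>pair_edges H v w. R (w, X, Y)})) \<le> (\<Sum>X\<in>pair_edges H u w. pdeg H v w)"
      by (intro sum_mono) (simp add: card_mono)
    then have "?c * (\<Sum>X\<in>pair_edges H u w. real (card {Y\<in>pair_edges H v w. R (w, X, Y)})) \<le> ?c * (pdeg H u w * pdeg H v w)"
      by (intro scaled_weight_mono sum_nonneg) auto
    also have "\<dots> \<le> k u v w" using k0[of u v w] by (cases "pdeg H u w * pdeg H v w = 0") auto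
    finally show "?c * (\<Sum>X\<in>pair_edges H u w. real (card {Y\<in>pair_edges H v w. R (w, X, Y)})) \<le> k u v w" .
  qed
  then show ?thesis using k_le[OF assms] by linarith
qed

definition one_side :: "bool \<Rightarrow> 'a set \<Rightarrow> 'a \<Rightarrow> 'a \<Rightarrow> real" where
  "one_side c e u v = (\<Sum>x\<in>Tr. if side x c = e then g u v x else 0)"

definition both_sides :: "'a set \<Rightarrow> 'a set \<Rightarrow> 'a \<Rightarrow> 'a \<Rightarrow> real" where
  "both_sides e e' u v = (\<Sum>x\<in>Tr. if side x True = e \<and> side x False = e' then g u v x else 0)"

lemma one_side_le:
  "one_side c e u v \<le> (\<Sum>w\<in>V. if e \<in> pair_edges H (if c then u else v) w then k u v w / pdeg H (if c then u else v) w else 0)"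
  unfolding one_side_def g_sum
proof (rule sum_mono)
  fix w
  let ?c = "k u v w / (pdeg H u w * pdeg H v w)"
  let ?S = "\<Sum>X\<in>pair_edges H u w. real (card {Y\<in>pair_edges H v w. side (w, X, Y) c = e})"
  have "?S \<le> (if e \<in> pair_edges H (if c then u else v) w then pdeg H (if c then v else u) w else 0)"
  proof (cases c)
    case True
    have "?S = (\<Sum>X\<in>pair_edges H u w. if X = e then pdeg H v w else 0)"
      using True by (intro sum.cong) (auto simp: side_def)
    then show ?thesis using True by (simp add: sum.delta)
  next
    case False
    have "?S = (\<Sum>X\<in>pair_edges H u w. if e \<in> pair_edges H v w then 1 else 0)"
    proof (intro sum.cong refl)
      fix X
      have "{Y\<in>pair_edges H v w. side (w, X, Y) c = e} = (if e \<in> pair_edges H v w then {e} else {})"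
        using False by (auto simp: side_def)
      then show "real (card {Y\<in>pair_edges H v w. side (w, X, Y) c = e}) = (if e \<in> pair_edges H v w then 1 else 0)" by simp
    qed
    then show ?thesis using False by simp
  qed
  then have "?c * ?S \<le> ?c * (if e \<in> pair_edges H (if c then u else v) w then pdeg H (if c then v else u) w else 0)"
    using k0 by (intro mult_left_mono) auto
  also have "\<dots> \<le> (if e \<in> pair_edges H (if c then u else v) w then k u v w / pdeg H (if c then u else v) w else 0)"
    using k0[of u v w] by (auto simp: divide_simps)
  finally show "?c * ?S \<le> (if e \<in> pair_edges H (if c then u else v) w then k u v w / pdeg H (if c then u else v) w else 0)" .
qed

lemma both_sides_le:
  "both_sides e e' u v \<le> (\<Sum>w\<in>V. if e \<in> pair_edges H u w \<and> e' \<in> pair_edges H v w then k u v w / (pdeg H u w * pdeg H v w) else 0)"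
  unfolding both_sides_def g_sum
proof (rule sum_mono)
  fix w
  let ?c = "k u v w / (pdeg H u w * pdeg H v w)"
  let ?S = "\<Sum>X\<in>pair_edges H u w. real (card {Y\<in>pair_edges H v w. side (w, X, Y) True = e \<and> side (w, X, Y) False = e'})"
  have "?S = (\<Sum>X\<in>pair_edges H u w. if X = e then (if e' \<in> pair_edges H v w then 1 else 0) else 0)"
  proof (intro sum.cong refl)
    fix X
    have "{Y\<in>pair_edges H v w. side (w, X, Y) True = e \<and> side (w, X, Y) False = e'}
       = (if X = e \<and> e' \<in> pair_edges H v w then {e'} else {})"
      by (auto simp: side_def)
    then show "real (card {Y\<in>pair_edges H v w. side (w, X, Y) True = e \<and> side (w, X, Y) False = e'})
      = (if X = e then (if e' \<in> pair_edges H v w then 1 else 0) else 0)" by simp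
  qed
  then have "?S = (if e \<in> pair_edges H u w \<and> e' \<in> pair_edges H v w then 1 else 0)" by (simp add: sum.delta)
  then show "?c * ?S \<le> (if e \<in> pair_edges H u w \<and> e' \<in> pair_edges H v w then ?c else 0)" by simp
qed

text \<open>A vertex that is forced into a prescribed edge has only r possible values. This is the
  origin of the powers of r in \<open>spread_const\<close>.\<close>

lemma sum_edge_le:
  fixes x :: "'a \<Rightarrow> real"
  assumes "\<And>w. w \<in> V \<Longrightarrow> w \<in> e \<Longrightarrow> e \<in> H \<Longrightarrow> x w \<le> y" "\<And>w. w \<notin> e \<or> e \<notin> H \<Longrightarrow> x w = 0" "y \<ge> 0"
  shows "(\<Sum>w\<in>V. x w) \<le> real r * y"
proof (cases "e \<in> H")
  case True
  have "(\<Sum>w\<in>V. x w) = (\<Sum>w\<in>e. x w)"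
    using True H[OF True] assms(2) finV by (intro sum.mono_neutral_right) auto
  also have "\<dots> \<le> (\<Sum>w\<in>e. y)" using assms(1) True H[OF True] by (intro sum_mono) auto
  finally show ?thesis using H[OF True] by simp
qed (use assms in \<open>simp add: sum_nonneg\<close>)

lemma one_side_bound: "one_side c e u v \<le> r * \<rho>"
proof -
  have "one_side c e u v \<le> (\<Sum>w\<in>V. if e \<in> pair_edges H (if c then u else v) w then k u v w / pdeg H (if c then u else v) w else 0)"
    by (rule one_side_le)
  also have "\<dots> \<le> r * \<rho>"
  proof (rule sum_edge_le[where e = e])
    fix w
    show "(if e \<in> pair_edges H (if c then u else v) w then k u v w / pdeg H (if c then u else v) w else 0) \<le> \<rho>"
      using k1[of u v w] rho0 by (cases c) (auto simp: divide_simps)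
  qed (use rho0 in \<open>auto simp: pair_edges_def\<close>)
  finally show ?thesis .
qed

lemma both_sides_bound: "both_sides e e' u v \<le> r * \<rho>2"
proof -
  have "both_sides e e' u v \<le> (\<Sum>w\<in>V. if e \<in> pair_edges H u w \<and> e' \<in> pair_edges H v w then k u v w / (pdeg H u w * pdeg H v w) else 0)"
    by (rule both_sides_le)
  also have "\<dots> \<le> r * \<rho>2"
  proof (rule sum_edge_le[where e = e])
    fix w
    show "(if e \<in> pair_edges H u w \<and> e' \<in> pair_edges H v w then k u v w / (pdeg H u w * pdeg H v w) else 0) \<le> \<rho>2"
      using divide_le_if[OF k2[of u v w]] rho0 by simp
  qed (use rho0 in \<open>auto simp: pair_edges_def\<close>)
  finally show ?thesis .
qed

text \<open>In contrast to \<open>both_sides_bound\<close>, the pair u, v is averaged as well. Since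
  the triples share u, v, this can be done for only one of them; the others need bounds that are
  uniform in u, v.\<close>

lemma sum_pi_both_sides: "(\<Sum>u\<in>V. \<Sum>v\<in>V. \<pi> u v * both_sides e e' u v) \<le> r ^ 3 * \<kappa>2"
proof -
  let ?x = "\<lambda>u v w. if e \<in> pair_edges H u w \<and> e' \<in> pair_edges H v w then \<pi> u v * k u v w / (pdeg H u w * pdeg H v w) else 0"
  have "(\<Sum>u\<in>V. \<Sum>v\<in>V. \<pi> u v * both_sides e e' u v) \<le> (\<Sum>u\<in>V. \<Sum>v\<in>V. \<Sum>w\<in>V. ?x u v w)"
  proof (intro sum_mono)
    fix u v
    have "\<pi> u v * both_sides e e' u v \<le> \<pi> u v * (\<Sum>w\<in>V. if e \<in> pair_edges H u w \<and> e' \<in> pair_edges H v w then k u v w / (pdeg H u w * pdeg H v w) else 0)"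
      using pi0 both_sides_le by (intro mult_left_mono)
    also have "\<dots> = (\<Sum>w\<in>V. ?x u v w)" by (auto simp: sum_distrib_left intro!: sum.cong)
    finally show "\<pi> u v * both_sides e e' u v \<le> (\<Sum>w\<in>V. ?x u v w)" .
  qed
  also have "\<dots> \<le> r * (r * (r * \<kappa>2))"
  proof (rule sum_edge_le[where e = e])
    fix u
    show "(\<Sum>v\<in>V. \<Sum>w\<in>V. ?x u v w) \<le> r * (r * \<kappa>2)"
    proof (rule sum_edge_le[where e = e'])
      fix v
      show "(\<Sum>w\<in>V. ?x u v w) \<le> r * \<kappa>2"
      proof (rule sum_edge_le[where e = e])
        fix w
        show "?x u v w \<le> \<kappa>2" using divide_le_if[OF pik[of u v w]] rho0 by simp
      qed (use rho0 in \<open>auto simp: pair_edges_def\<close>)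
    qed (use rho0 in \<open>auto simp: pair_edges_def\<close>)
  qed (use rho0 in \<open>auto simp: pair_edges_def\<close>)
  finally show ?thesis by (simp add: power3_eq_cube mult_ac)
qed

text \<open>Here the marginal assumptions enter. A pair u, w that is drawn with probability O(pdeg /
  h), followed by a uniform edge through it, gives each edge probability O(1 / h).\<close>

lemma sum_pi_one_side: "(\<Sum>u\<in>V. \<Sum>v\<in>V. \<pi> u v * one_side c e u v) \<le> r ^ 2 * (B / h)"
proof -
  have Bh: "B / h \<ge> 0" using B1 h0 by simp
  let ?x = "\<lambda>u v w. if e \<in> pair_edges H (if c then u else v) w then \<pi> u v * k u v w / pdeg H (if c then u else v) w else 0"
  have "(\<Sum>u\<in>V. \<Sum>v\<in>V. \<pi> u v * one_side c e u v) \<le> (\<Sum>u\<in>V. \<Sum>v\<in>V. \<Sum>w\<in>V. ?x u v w)"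
  proof (intro sum_mono)
    fix u v
    have "\<pi> u v * one_side c e u v \<le> \<pi> u v * (\<Sum>w\<in>V. if e \<in> pair_edges H (if c then u else v) w then k u v w / pdeg H (if c then u else v) w else 0)"
      using pi0 one_side_le by (intro mult_left_mono)
    also have "\<dots> = (\<Sum>w\<in>V. ?x u v w)" by (auto simp: sum_distrib_left intro!: sum.cong)
    finally show "\<pi> u v * one_side c e u v \<le> (\<Sum>w\<in>V. ?x u v w)" .
  qed
  also have "\<dots> \<le> r * (r * (B / h))"
  proof (cases c)
    case True
    have "(\<Sum>u\<in>V. \<Sum>v\<in>V. \<Sum>w\<in>V. ?x u v w) = (\<Sum>u\<in>V. \<Sum>w\<in>V. \<Sum>v\<in>V. ?x u v w)"
      by (rule sum.cong[OF refl], rule sum.swap)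
    also have "\<dots> \<le> r * (r * (B / h))"
    proof (rule sum_edge_le[where e = e])
      fix u assume u: "u \<in> V"
      show "(\<Sum>w\<in>V. \<Sum>v\<in>V. ?x u v w) \<le> r * (B / h)"
      proof (rule sum_edge_le[where e = e])
        fix w assume w: "w \<in> V"
        have "(\<Sum>v\<in>V. ?x u v w) = (if e \<in> pair_edges H u w then (\<Sum>v\<in>V. \<pi> u v * k u v w) / pdeg H u w else 0)"
          using True by (simp add: sum_divide_distrib)
        also have "\<dots> \<le> B / h"
          using marg1[OF u w] Bh by (auto simp: divide_simps)
        finally show "(\<Sum>v\<in>V. ?x u v w) \<le> B / h" .
      qed (use B1 h0 True in \<open>auto simp: pair_edges_def\<close>)
    qed (use B1 h0 True in \<open>auto simp: pair_edges_def\<close>)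
    finally show ?thesis .
  next
    case False
    have "(\<Sum>u\<in>V. \<Sum>v\<in>V. \<Sum>w\<in>V. ?x u v w) = (\<Sum>v\<in>V. \<Sum>u\<in>V. \<Sum>w\<in>V. ?x u v w)"
      by (rule sum.swap)
    also have "\<dots> = (\<Sum>v\<in>V. \<Sum>w\<in>V. \<Sum>u\<in>V. ?x u v w)"
      by (rule sum.cong[OF refl], rule sum.swap)
    also have "\<dots> \<le> r * (r * (B / h))"
    proof (rule sum_edge_le[where e = e])
      fix v assume v: "v \<in> V"
      show "(\<Sum>w\<in>V. \<Sum>u\<in>V. ?x u v w) \<le> r * (B / h)"
      proof (rule sum_edge_le[where e = e])
        fix w assume w: "w \<in> V"
        have "(\<Sum>u\<in>V. ?x u v w) = (if e \<in> pair_edges H v w then (\<Sum>u\<in>V. \<pi> u v * k u v w) / pdeg H v w else 0)"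
          using False by (simp add: sum_divide_distrib)
        also have "\<dots> \<le> B / h"
          using marg2[OF v w] Bh by (auto simp: divide_simps)
        finally show "(\<Sum>u\<in>V. ?x u v w) \<le> B / h" .
      qed (use B1 h0 False in \<open>auto simp: pair_edges_def\<close>)
    qed (use B1 h0 False in \<open>auto simp: pair_edges_def\<close>)
    finally show ?thesis .
  qed
  finally show ?thesis by (simp add: power2_eq_square mult_ac)
qed

section \<open>Probability that prescribed edges occur\<close>

definition Fs :: "nat \<Rightarrow> (nat \<Rightarrow> 'a \<times> 'a set \<times> 'a set) set" where
  "Fs m = PiE {..<m} (\<lambda>_. Tr)"

lemma finFs [simp]: "finite (Fs m)"
  by (simp add: Fs_def finite_PiE)

definition spread_const :: real where
  "spread_const = r ^ (t + 3) * B ^ (t + 1)"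

text \<open>Given u, v the triples are independent, so the probability is a product.
  \<open>Db\<close> collects the triples with both sides prescribed and \<open>Sg\<close> those with
  one. One triple is averaged over u, v, taken from \<open>Db\<close> if possible, and the others
  are bounded uniformly. \<open>\<rho>2\<close> alone may be far larger than \<tau>^2; its excess is
  absorbed by \<open>\<kappa>2\<close>, which is why \<open>num2\<close> bounds their product for
  each number b of triples in \<open>Db\<close>.\<close>

lemma positions_bound:
  assumes P: "P \<subseteq> {..<t} \<times> UNIV" "P \<noteq> {}"
  shows "(\<Sum>u\<in>V. \<Sum>v\<in>V. \<pi> u v * (\<Sum>f\<in>Fs t. if \<forall>z\<in>P. edge_at f z = p z then \<Prod>i<t. g u v (f i) else 0))
    \<le> spread_const * \<tau> ^ (card P - 1) / h"
proof -
  define con where "con i x \<longleftrightarrow> (\<forall>c. (i, c) \<in> P \<longrightarrow> side x c = p (i, c))" for i and x :: "'a \<times> 'a set \<times> 'a set"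
  define G where "G i u v = (\<Sum>x\<in>Tr. if con i x then g u v x else 0)" for i u v
  define Db where "Db = {i\<in>{..<t}. (i, True) \<in> P \<and> (i, False) \<in> P}"
  define Sg where "Sg = {i\<in>{..<t}. ((i, True) \<in> P) \<noteq> ((i, False) \<in> P)}"
  define Bd where "Bd i = (if i \<in> Db then r * \<rho>2 else 1) * (if i \<in> Sg then r * \<rho> else 1)" for i
  have fin: "finite Db" "finite Sg" by (auto simp: Db_def Sg_def)
  have G0: "0 \<le> G i u v" for i u v unfolding G_def using g0 by (intro sum_nonneg) auto
  have Bd0: "0 \<le> Bd i" for i using rho0 by (simp add: Bd_def)
  have prodG: "(\<Sum>f\<in>Fs t. if \<forall>z\<in>P. edge_at f z = p z then \<Prod>i<t. g u v (f i) else 0) = (\<Prod>i<t. G i u v)" for u v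
  proof -
    have "(\<Prod>i<t. G i u v) = (\<Sum>f\<in>Fs t. \<Prod>i<t. if con i (f i) then g u v (f i) else 0)"
      unfolding G_def Fs_def by (rule prod_sum_PiE) auto
    also have "\<dots> = (\<Sum>f\<in>Fs t. if \<forall>z\<in>P. edge_at f z = p z then \<Prod>i<t. g u v (f i) else 0)"
    proof (rule sum.cong[OF refl])
      fix f
      have "(\<forall>z\<in>P. edge_at f z = p z) \<longleftrightarrow> (\<forall>i<t. con i (f i))"
        using P(1) by (auto simp: con_def edge_at_def subset_iff)
      then show "(\<Prod>i<t. if con i (f i) then g u v (f i) else 0) = (if \<forall>z\<in>P. edge_at f z = p z then \<Prod>i<t. g u v (f i) else 0)"
        by (auto intro!: prod.cong prod_zero)
    qed
    finally show ?thesis by simp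
  qed
  have GD: "G i u v = both_sides (p (i, True)) (p (i, False)) u v" if "i \<in> Db" for i u v
    unfolding G_def both_sides_def
  proof (rule sum.cong[OF refl])
    fix x
    have "con i x \<longleftrightarrow> side x True = p (i, True) \<and> side x False = p (i, False)"
      unfolding con_def all_bool_eq using that by (auto simp: Db_def)
    then show "(if con i x then g u v x else 0) = (if side x True = p (i, True) \<and> side x False = p (i, False) then g u v x else 0)"
      by simp
  qed
  have GS: "\<exists>c. \<forall>u v. G i u v = one_side c (p (i, c)) u v" if "i \<in> Sg" for i
  proof -
    define c where "c = ((i, True) \<in> P)"
    have "con i x \<longleftrightarrow> side x c = p (i, c)" for x
      unfolding con_def c_def all_bool_eq using that by (cases "(i, True) \<in> P") (auto simp: Sg_def)
    then show ?thesis unfolding G_def one_side_def by auto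
  qed
  have GBd: "G i u v \<le> Bd i" if "i < t" "u \<in> V" "v \<in> V" for i u v
  proof -
    consider "i \<in> Db" | "i \<in> Sg" | "i \<notin> Db \<union> Sg" by blast
    then show ?thesis
    proof cases
      case 1
      then have "i \<notin> Sg" by (auto simp: Db_def Sg_def)
      then show ?thesis using 1 GD[OF 1] both_sides_bound by (simp add: Bd_def)
    next
      case 2
      then have "i \<notin> Db" by (auto simp: Db_def Sg_def)
      obtain c where "G i u v = one_side c (p (i, c)) u v" using GS[OF 2] by blast
      then show ?thesis using 2 \<open>i \<notin> Db\<close> one_side_bound by (simp add: Bd_def)
    next
      case 3
      then show ?thesis using g_none[OF that(2,3)] by (simp add: Bd_def G_def)
    qed
  qed
  have prodBd: "(\<Prod>i\<in>{..<t} - {i0}. Bd i) = (r * \<rho>2) ^ card (Db - {i0}) * (r * \<rho>) ^ card (Sg - {i0})" for i0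
  proof -
    have "{..<t} \<inter> {i. i \<noteq> i0 \<and> i \<in> Db} = Db - {i0}" "{..<t} \<inter> {i. i \<noteq> i0 \<and> i \<in> Sg} = Sg - {i0}"
      by (auto simp: Db_def Sg_def)
    moreover have "({..<t} - {i0}) \<inter> Db = Db - {i0}" "({..<t} - {i0}) \<inter> Sg = Sg - {i0}"
      by (auto simp: Db_def Sg_def)
    ultimately show ?thesis unfolding Bd_def prod.distrib by (simp add: prod.If_cases)
  qed
  have main: "(\<Sum>u\<in>V. \<Sum>v\<in>V. \<pi> u v * (\<Prod>i<t. G i u v)) \<le> y * ((r * \<rho>2) ^ card (Db - {i0}) * (r * \<rho>) ^ card (Sg - {i0}))"
    if i0: "i0 < t" and y: "(\<Sum>u\<in>V. \<Sum>v\<in>V. \<pi> u v * G i0 u v) \<le> y" for i0 y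
  proof -
    let ?Q = "\<Prod>i\<in>{..<t} - {i0}. Bd i"
    have "(\<Sum>u\<in>V. \<Sum>v\<in>V. \<pi> u v * (\<Prod>i<t. G i u v)) \<le> (\<Sum>u\<in>V. \<Sum>v\<in>V. (\<pi> u v * G i0 u v) * ?Q)"
    proof (intro sum_mono)
      fix u v assume uv: "u \<in> V" "v \<in> V"
      have "(\<Prod>i<t. G i u v) = G i0 u v * (\<Prod>i\<in>{..<t} - {i0}. G i u v)"
        using i0 by (intro prod.remove) auto
      also have "\<dots> \<le> G i0 u v * ?Q"
        using G0 GBd uv by (intro mult_left_mono prod_mono) auto
      finally show "\<pi> u v * (\<Prod>i<t. G i u v) \<le> (\<pi> u v * G i0 u v) * ?Q"
        using pi0 by (simp add: mult.assoc mult_left_mono)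
    qed
    also have "\<dots> = (\<Sum>u\<in>V. \<Sum>v\<in>V. \<pi> u v * G i0 u v) * ?Q"
      by (simp only: sum_distrib_right)
    also have "\<dots> \<le> y * ?Q" using y Bd0 by (intro mult_right_mono prod_nonneg) auto
    finally show ?thesis unfolding prodBd .
  qed
  have cP: "card P = 2 * card Db + card Sg"
  proof -
    have "P = Db \<times> UNIV \<union> (\<lambda>i. (i, (i, True) \<in> P)) ` Sg"
    proof (intro set_eqI iffI)
      fix z assume z: "z \<in> P"
      obtain i c where zc: "z = (i, c)" by (cases z)
      then have "i < t" using P z by auto
      then show "z \<in> Db \<times> UNIV \<union> (\<lambda>i. (i, (i, True) \<in> P)) ` Sg"
        using z zc by (cases c) (auto simp: Db_def Sg_def image_iff)
    next
      fix z assume "z \<in> Db \<times> UNIV \<union> (\<lambda>i. (i, (i, True) \<in> P)) ` Sg"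
      then show "z \<in> P"
      proof
        assume "z \<in> Db \<times> UNIV"
        then obtain i c where "z = (i, c)" "i \<in> Db" by (cases z) auto
        then show ?thesis by (cases c) (auto simp: Db_def)
      next
        assume "z \<in> (\<lambda>i. (i, (i, True) \<in> P)) ` Sg"
        then obtain i where "z = (i, (i, True) \<in> P)" "i \<in> Sg" by blast
        then show ?thesis by (cases "(i, True) \<in> P") (auto simp: Sg_def)
      qed
    qed
    then have "card P = card (Db \<times> (UNIV :: bool set) \<union> (\<lambda>i. (i, (i, True) \<in> P)) ` Sg)" by simp
    also have "\<dots> = card (Db \<times> (UNIV :: bool set)) + card ((\<lambda>i. (i, (i, True) \<in> P)) ` Sg)"
      using fin by (intro card_Un_disjoint) (auto simp: Db_def Sg_def)
    also have "card ((\<lambda>i. (i, (i, True) \<in> P)) ` Sg) = card Sg" by (intro card_image) (auto simp: inj_on_def)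
    finally show ?thesis by (simp add: card_cartesian_product)
  qed
  have ct: "card Db + card Sg \<le> t"
  proof -
    have "card Db + card Sg = card (Db \<union> Sg)" using fin by (intro card_Un_disjoint[symmetric]) (auto simp: Db_def Sg_def)
    also have "\<dots> \<le> card {..<t}" by (intro card_mono) (auto simp: Db_def Sg_def)
    finally show ?thesis by simp
  qed
  let ?r = "real r"
  have r1': "1 \<le> ?r" using r1 by simp
  have const: "?r ^ m * B ^ n \<le> spread_const" if "m \<le> t + 3" "n \<le> t + 1" for m n
    unfolding spread_const_def
    using mult_mono[OF power_increasing[OF that(1) r1'] power_increasing[OF that(2) B1]] B1 by simp
  have rB: "?r * \<rho> \<le> ?r * B * \<tau>" using num1 by (simp add: mult.assoc mult_left_mono)
  have "(\<Sum>u\<in>V. \<Sum>v\<in>V. \<pi> u v * (\<Prod>i<t. G i u v)) \<le> spread_const * \<tau> ^ (card P - 1) / h"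
  proof (cases "Db = {}")
    case False
    then obtain i0 where i0: "i0 \<in> Db" by blast
    then have i0': "i0 < t" "i0 \<notin> Sg" by (auto simp: Db_def Sg_def)
    let ?b = "card Db" and ?a = "card Sg"
    have b1: "1 \<le> ?b" using False fin by (simp add: Suc_leI card_gt_0_iff)
    have "(\<Sum>u\<in>V. \<Sum>v\<in>V. \<pi> u v * (\<Prod>i<t. G i u v)) \<le> (?r ^ 3 * \<kappa>2) * ((?r * \<rho>2) ^ card (Db - {i0}) * (?r * \<rho>) ^ card (Sg - {i0}))"
      by (rule main[OF i0'(1)]) (use sum_pi_both_sides in \<open>simp add: GD[OF i0]\<close>)
    also have "\<dots> = (?r ^ 3 * \<kappa>2) * ((?r * \<rho>2) ^ (?b - 1) * (?r * \<rho>) ^ ?a)"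
      using i0 i0' fin by simp
    also have "\<dots> \<le> (?r ^ 3 * \<kappa>2) * ((?r * \<rho>2) ^ (?b - 1) * (?r * B * \<tau>) ^ ?a)"
      using rB rho0 by (intro mult_left_mono power_mono) auto
    also have "\<dots> = (\<kappa>2 * \<rho>2 ^ (?b - 1)) * (?r ^ (3 + (?b - 1) + ?a) * B ^ ?a * \<tau> ^ ?a)"
      by (simp add: power_mult_distrib power_add mult_ac)
    also have "\<dots> \<le> (B * \<tau> ^ (2 * ?b - 1) / h) * (?r ^ (3 + (?b - 1) + ?a) * B ^ ?a * \<tau> ^ ?a)"
      using num2[of ?b] b1 ct B1 \<tau>0 by (intro mult_right_mono) auto
    also have "\<dots> = (?r ^ (3 + (?b - 1) + ?a) * B ^ (?a + 1)) * (\<tau> ^ (2 * ?b - 1 + ?a) / h)"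
      by (simp add: power_add mult_ac)
    also have "\<dots> \<le> spread_const * (\<tau> ^ (2 * ?b - 1 + ?a) / h)"
      using ct b1 \<tau>0 h0 by (intro mult_right_mono const) auto
    also have "2 * ?b - 1 + ?a = card P - 1" using cP b1 by simp
    finally show ?thesis by simp
  next
    case True
    then have "Sg \<noteq> {}" using cP P finite_subset[OF P(1)] by (auto simp: card_eq_0_iff)
    then obtain i0 where i0: "i0 \<in> Sg" by blast
    then have i0': "i0 < t" by (auto simp: Sg_def)
    let ?a = "card Sg"
    have a1: "1 \<le> ?a" using \<open>Sg \<noteq> {}\<close> fin by (simp add: Suc_leI card_gt_0_iff)
    obtain c where c: "\<And>u v. G i0 u v = one_side c (p (i0, c)) u v" using GS[OF i0] by blast
    have "(\<Sum>u\<in>V. \<Sum>v\<in>V. \<pi> u v * (\<Prod>i<t. G i u v)) \<le> (?r ^ 2 * (B / h)) * ((?r * \<rho>2) ^ card (Db - {i0}) * (?r * \<rho>) ^ card (Sg - {i0}))"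
      by (rule main[OF i0']) (use sum_pi_one_side in \<open>simp add: c\<close>)
    also have "\<dots> = (?r ^ 2 * (B / h)) * (?r * \<rho>) ^ (?a - 1)"
      using i0 True fin by simp
    also have "\<dots> \<le> (?r ^ 2 * (B / h)) * (?r * B * \<tau>) ^ (?a - 1)"
      using rB rho0 B1 h0 by (intro mult_left_mono power_mono) auto
    also have "\<dots> = (?r ^ (2 + (?a - 1)) * B ^ (?a - 1 + 1)) * (\<tau> ^ (?a - 1) / h)"
      by (simp add: power_mult_distrib power_add power2_eq_square mult_ac)
    also have "\<dots> \<le> spread_const * (\<tau> ^ (?a - 1) / h)"
      using ct a1 \<tau>0 h0 by (intro mult_right_mono const) auto
    also have "?a - 1 = card P - 1" using cP True by simp
    finally show ?thesis by simp
  qed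
  then show ?thesis unfolding prodG .
qed

text \<open>Each z spoils a fraction of at most 1 / (8 q) of the edges, and there are at most q of
  them.\<close>

lemma card_avoid_ge:
  assumes E: "finite E" and Z: "finite Z" "real (card Z) \<le> q" "q > 0"
    and *: "\<And>z. z \<in> Z \<Longrightarrow> 8 * q * card {e\<in>E. z \<in> e} \<le> real (card E)"
  shows "real (card {e\<in>E. e \<inter> Z = {}}) \<ge> 7 / 8 * card E"
proof -
  have "card E \<le> card ({e\<in>E. e \<inter> Z = {}} \<union> (\<Union>z\<in>Z. {e\<in>E. z \<in> e}))"
    using E Z by (intro card_mono) auto
  also have "\<dots> \<le> card {e\<in>E. e \<inter> Z = {}} + (\<Sum>z\<in>Z. card {e\<in>E. z \<in> e})"
    by (rule order_trans[OF card_Un_le add_left_mono[OF card_UN_le[OF Z(1)]]])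
  finally have "real (card E) \<le> real (card {e\<in>E. e \<inter> Z = {}} + (\<Sum>z\<in>Z. card {e\<in>E. z \<in> e}))"
    by (rule of_nat_mono)
  also have "\<dots> = card {e\<in>E. e \<inter> Z = {}} + (\<Sum>z\<in>Z. real (card {e\<in>E. z \<in> e}))" by simp
  also have "(\<Sum>z\<in>Z. real (card {e\<in>E. z \<in> e})) \<le> (\<Sum>z\<in>Z. card E / (8 * q))"
    using * Z(3) by (intro sum_mono) (simp add: field_simps)
  also have "\<dots> = card Z * (card E / (8 * q))" by simp
  also have "\<dots> \<le> q * (card E / (8 * q))" using Z by (intro mult_right_mono) auto
  also have "\<dots> = card E / 8" using Z by simp
  finally show ?thesis by simp
qed

text \<open>w falls into \<open>Z\<close> with probability at most 1/4, X hits \<open>Z\<close>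
  elsewhere with probability at most 1/8, and given X so does Y with \<open>Z \<union> X\<close>.
  What remains is at least 3/4 * 49/64 > 1/2.\<close>

lemma fits_mass:
  assumes uv: "u \<in> V" "v \<in> V" "\<pi> u v \<noteq> 0" and Z: "finite Z" "card Z \<le> 2 + 2 * r * t"
  shows "1 / 2 \<le> (\<Sum>x\<in>Tr. if fits H u v Z x then g u v x else 0)"
proof -
  let ?q = "real (2 + 2 * r * t + r)"
  have "(\<Sum>w\<in>V. if w \<in> Z then k u v w else 0) = (\<Sum>w\<in>V \<inter> Z. k u v w)"
    using finV by (simp add: sum.inter_restrict)
  also have "\<dots> \<le> (\<Sum>w\<in>V \<inter> Z. \<kappa>)" using ksmall by (intro sum_mono)
  also have "\<dots> = card (V \<inter> Z) * \<kappa>" by simp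
  also have "\<dots> \<le> real (2 + 2 * r * t) * \<kappa>"
  proof (rule mult_right_mono)
    show "real (card (V \<inter> Z)) \<le> real (2 + 2 * r * t)"
      using Z card_mono[of Z "V \<inter> Z"] by (metis Int_lower2 of_nat_le_iff order_trans)
    show "0 \<le> \<kappa>" using ksmall k0 order_trans by blast
  qed
  also have "\<dots> \<le> 1 / 4" using kap by (simp add: mult.commute)
  finally have Zs: "(\<Sum>w\<in>V. if w \<in> Z then k u v w else 0) \<le> 1 / 4" .
  have "(\<Sum>w\<in>V. k u v w) = (\<Sum>w\<in>V. if w \<in> Z then k u v w else 0) + (\<Sum>w\<in>V. if w \<in> Z then 0 else k u v w)"
    unfolding sum.distrib[symmetric] by (intro sum.cong) auto
  then have "3 / 4 \<le> (\<Sum>w\<in>V. if w \<in> Z then 0 else k u v w)" using Zs k_eq[OF uv] by linarith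
  then have "49 / 64 * (3 / 4) \<le> 49 / 64 * (\<Sum>w\<in>V. if w \<in> Z then 0 else k u v w)" by simp
  also have "\<dots> = (\<Sum>w\<in>V. 49 / 64 * (if w \<in> Z then 0 else k u v w))" by (rule sum_distrib_left)
  also have "\<dots> \<le> (\<Sum>x\<in>Tr. if fits H u v Z x then g u v x else 0)"
    unfolding g_sum
  proof (rule sum_mono)
    fix w
    let ?c = "k u v w / (pdeg H u w * pdeg H v w)"
    let ?S = "\<Sum>X\<in>pair_edges H u w. real (card {Y\<in>pair_edges H v w. fits H u v Z (w, X, Y)})"
    have S0: "0 \<le> ?c * ?S" using k0 by (intro mult_nonneg_nonneg sum_nonneg) auto
    show "49 / 64 * (if w \<in> Z then 0 else k u v w) \<le> ?c * ?S"
    proof (cases "w \<in> Z \<or> k u v w = 0")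
      case False
      then have wZ: "w \<notin> Z" and kn: "k u v w \<noteq> 0" by auto
      let ?X = "{X\<in>pair_edges H u w. X \<inter> (Z - {u, w}) = {}}"
      have 1: "7 / 8 * pdeg H u w \<le> card ?X"
      proof (rule card_avoid_ge)
        have "card (Z - {u, w}) \<le> card Z" using Z by (intro card_mono) auto
        then show "real (card (Z - {u, w})) \<le> ?q" using Z(2) by linarith
      qed (use Z r1 tdeg(1)[OF kn] in auto)
      have 2: "7 / 8 * pdeg H v w \<le> card {Y\<in>pair_edges H v w. fits H u v Z (w, X, Y)}" if X: "X \<in> ?X" for X
      proof -
        have "X \<in> H" using X by (auto simp: pair_edges_def)
        have "7 / 8 * pdeg H v w \<le> card {Y\<in>pair_edges H v w. Y \<inter> (Z \<union> X - {v, w}) = {}}"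
        proof (rule card_avoid_ge)
          have "card (Z \<union> X - {v, w}) \<le> card (Z \<union> X)" using Z fin_edge[OF \<open>X \<in> H\<close>] by (intro card_mono) auto
          also have "\<dots> \<le> card Z + card X" by (rule card_Un_le)
          finally show "real (card (Z \<union> X - {v, w})) \<le> ?q" using Z(2) H[OF \<open>X \<in> H\<close>] by linarith
        qed (use Z r1 tdeg(2)[OF kn] fin_edge[OF \<open>X \<in> H\<close>] in auto)
        also have "\<dots> \<le> card {Y\<in>pair_edges H v w. fits H u v Z (w, X, Y)}"
          using X wZ by (intro of_nat_mono card_mono) auto
        finally show ?thesis .
      qed
      have "7 / 8 * pdeg H u w * (7 / 8 * pdeg H v w) \<le> card ?X * (7 / 8 * pdeg H v w)"
        using 1 by (intro mult_right_mono) auto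
      also have "\<dots> = (\<Sum>X\<in>?X. 7 / 8 * pdeg H v w)" by simp
      also have "\<dots> \<le> (\<Sum>X\<in>?X. real (card {Y\<in>pair_edges H v w. fits H u v Z (w, X, Y)}))"
        using 2 by (intro sum_mono)
      also have "\<dots> \<le> ?S" by (intro sum_mono2) auto
      finally have "?c * (7 / 8 * pdeg H u w * (7 / 8 * pdeg H v w)) \<le> ?c * ?S"
        using k0 by (intro mult_left_mono) auto
      moreover have "?c * (7 / 8 * pdeg H u w * (7 / 8 * pdeg H v w)) = 49 / 64 * k u v w"
        using kpos[OF kn] by simp
      ultimately show ?thesis using wZ by simp
    qed (use S0 in auto)
  qed
  finally show ?thesis by simp
qed

lemma card_used_le:
  assumes "f \<in> Fs m" "m \<le> t"
  shows "finite (used u v f m) \<and> card (used u v f m) \<le> 2 + 2 * r * t"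
proof -
  have XY: "fst (snd (f l)) \<in> H" "snd (snd (f l)) \<in> H" if "l < m" for l
  proof -
    have "f l \<in> Tr" using assms(1) that by (auto simp: Fs_def)
    then show "fst (snd (f l)) \<in> H" "snd (snd (f l)) \<in> H" by (auto simp: Tr_def)
  qed
  let ?U = "\<lambda>l. fst (snd (f l)) \<union> snd (snd (f l))"
  have "card (?U l) \<le> 2 * r" if "l < m" for l
    using card_Un_le[of "fst (snd (f l))" "snd (snd (f l))"] H[OF XY(1)[OF that]] H[OF XY(2)[OF that]] by linarith
  then have "(\<Sum>l<m. card (?U l)) \<le> (\<Sum>l<m. 2 * r)" by (intro sum_mono) auto
  then have 1: "card (\<Union>l<m. ?U l) \<le> m * (2 * r)"
    using card_UN_le[of "{..<m}" ?U] by simp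
  have 2: "card {u, v} \<le> 2" by (cases "u = v") auto
  have "card (used u v f m) \<le> card {u, v} + card (\<Union>l<m. ?U l)" unfolding used_def by (rule card_Un_le)
  moreover have "m * (2 * r) \<le> 2 * r * t" using assms(2) by simp
  ultimately have "card (used u v f m) \<le> 2 + 2 * r * t" using 1 2 by linarith
  moreover have "finite (used u v f m)" using XY fin_edge by (auto simp: used_def)
  ultimately show ?thesis by simp
qed

text \<open>The set to be avoided by a triple depends only on u, v and the earlier triples, so
  \<open>fits_mass\<close> applies to each triple in turn, conditionally on the earlier ones, and
  costs a factor 1/2 each time.\<close>

lemma valid_mass:
  assumes uv: "u \<in> V" "v \<in> V" "\<pi> u v \<noteq> 0"
  shows "m \<le> t \<Longrightarrow> (1 / 2) ^ m \<le> (\<Sum>f\<in>Fs m. if \<forall>i<m. fits H u v (used u v f i) (f i) then \<Prod>i<m. g u v (f i) else 0)"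
proof (induction m)
  case 0
  then show ?case by (simp add: Fs_def)
next
  case (Suc m)
  let ?A = "\<lambda>m f. if \<forall>i<m. fits H u v (used u v f i) (f i) then \<Prod>i<m. g u v (f i) else 0"
  have A0: "0 \<le> ?A m f" for f by (auto intro!: prod_nonneg g0 simp del: g.simps)
  have Fs_Suc: "Fs (Suc m) = (\<lambda>(y, f). f(m := y)) ` (Tr \<times> Fs m)"
    unfolding Fs_def lessThan_Suc by (rule PiE_insert_eq)
  have inj: "inj_on (\<lambda>(y, f). f(m := y)) (Tr \<times> Fs m)"
    unfolding Fs_def by (rule inj_combinator) simp
  have eq: "?A (Suc m) (f(m := y)) = ?A m f * (if fits H u v (used u v f m) y then g u v y else 0)" for f y
  proof -
    have us: "used u v (f(m := y)) i = used u v f i" if "i \<le> m" for i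
      using that by (auto simp: used_def)
    have 1: "(\<forall>i<Suc m. fits H u v (used u v (f(m := y)) i) ((f(m := y)) i)) \<longleftrightarrow>
       (\<forall>i<m. fits H u v (used u v f i) (f i)) \<and> fits H u v (used u v f m) y"
      unfolding less_Suc_eq using us by auto
    have "(\<Prod>i<m. g u v ((f(m := y)) i)) = (\<Prod>i<m. g u v (f i))" by (intro prod.cong) auto
    then have 2: "(\<Prod>i<Suc m. g u v ((f(m := y)) i)) = (\<Prod>i<m. g u v (f i)) * g u v y" by simp
    show ?thesis by (simp only: 1 2, simp, blast)
  qed
  have "(1 / 2) ^ Suc m \<le> (\<Sum>f\<in>Fs m. ?A m f) * (1 / 2)" using Suc by simp
  also have "\<dots> = (\<Sum>f\<in>Fs m. ?A m f * (1 / 2))" by (simp only: sum_distrib_right)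
  also have "\<dots> \<le> (\<Sum>f\<in>Fs m. ?A m f * (\<Sum>y\<in>Tr. if fits H u v (used u v f m) y then g u v y else 0))"
  proof (rule sum_mono)
    fix f assume f: "f \<in> Fs m"
    have "1 / 2 \<le> (\<Sum>y\<in>Tr. if fits H u v (used u v f m) y then g u v y else 0)"
      using card_used_le[OF f] Suc.prems by (intro fits_mass uv) auto
    then show "?A m f * (1 / 2) \<le> ?A m f * (\<Sum>y\<in>Tr. if fits H u v (used u v f m) y then g u v y else 0)"
      using A0[of f] by (rule mult_left_mono)
  qed
  also have "\<dots> = (\<Sum>f\<in>Fs m. \<Sum>y\<in>Tr. ?A (Suc m) (f(m := y)))"
    unfolding eq by (simp only: sum_distrib_left)
  also have "\<dots> = (\<Sum>y\<in>Tr. \<Sum>f\<in>Fs m. ?A (Suc m) (f(m := y)))" by (rule sum.swap)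
  also have "\<dots> = (\<Sum>f\<in>Fs (Suc m). ?A (Suc m) f)"
    unfolding Fs_Suc by (subst sum.reindex[OF inj]) (simp only: sum.cartesian_product' o_def case_prod_conv)
  finally show ?case .
qed

section \<open>The law of the edge set of the random copy\<close>

definition copies :: "('a \<times> 'a \<times> (nat \<Rightarrow> 'a \<times> 'a set \<times> 'a set)) set" where
  "copies = V \<times> V \<times> Fs t"

text \<open>Invalid samples are discarded without renormalising; the total is then at least 2^-t,
  which is enough because t is fixed.\<close>

definition mass :: "'a \<times> 'a \<times> (nat \<Rightarrow> 'a \<times> 'a set \<times> 'a set) \<Rightarrow> real" where
  "mass x = (case x of (u, v, f) \<Rightarrow> \<pi> u v * (if valid H t u v f then \<Prod>i<t. g u v (f i) else 0))"

definition copy_edges :: "'a \<times> 'a \<times> (nat \<Rightarrow> 'a \<times> 'a set \<times> 'a set) \<Rightarrow> 'a set set" where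
  "copy_edges x = edge_set t (snd (snd x))"

definition copy_weight :: "'a set set \<Rightarrow> real" where
  "copy_weight S = (\<Sum>x\<in>copies. if copy_edges x = S then mass x else 0)"

lemma mass0: "0 \<le> mass x"
  using pi0 by (auto simp: mass_def intro!: mult_nonneg_nonneg prod_nonneg g0 split: prod.split simp del: g.simps)

lemma mass_valid: "mass (u, v, f) \<noteq> 0 \<Longrightarrow> valid H t u v f"
  by (auto simp: mass_def split: if_splits)

lemma valid_edge_set_subset: "valid H t u v f \<Longrightarrow> edge_set t f \<subseteq> H"
  using validD(1)[of H t u v f] by (auto simp: edge_set_def edge_at_def)

lemma copy_weight_nz:
  assumes "copy_weight S \<noteq> 0"
  obtains u v f where "valid H t u v f" "S = edge_set t f"
proof -
  obtain x where "(if copy_edges x = S then mass x else 0) \<noteq> 0"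
    using assms sum.not_neutral_contains_not_neutral unfolding copy_weight_def by blast
  moreover obtain u v f where "x = (u, v, f)" by (cases x)
  ultimately show ?thesis using mass_valid[of u v f] that[of u v f] by (auto simp: copy_edges_def split: if_splits)
qed

text \<open>A code of nonzero mass has all its edges in \<open>H\<close>, hence in
  \<open>H0\<close>, so restricting S to subsets of \<open>H0\<close> loses nothing.\<close>

lemma wdeg_copy_weight:
  assumes "finite H0" "H \<subseteq> H0"
  shows "wdeg H0 copy_weight \<sigma> = (\<Sum>x\<in>copies. if \<sigma> \<subseteq> copy_edges x then mass x else 0)"
proof -
  have "wdeg H0 copy_weight \<sigma> = (\<Sum>x\<in>copies. \<Sum>S | S \<subseteq> H0 \<and> \<sigma> \<subseteq> S. if copy_edges x = S then mass x else 0)"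
    unfolding wdeg_def copy_weight_def by (rule sum.swap)
  also have "\<dots> = (\<Sum>x\<in>copies. if \<sigma> \<subseteq> copy_edges x then mass x else 0)"
  proof (rule sum.cong[OF refl])
    fix x assume "x \<in> copies"
    have fin: "finite {S. S \<subseteq> H0 \<and> \<sigma> \<subseteq> S}" using assms by simp
    obtain u v f where x: "x = (u, v, f)" by (cases x)
    have "mass x = 0" if "\<not> copy_edges x \<subseteq> H0"
    proof (rule ccontr)
      assume "mass x \<noteq> 0"
      then have "edge_set t f \<subseteq> H" using mass_valid valid_edge_set_subset x by blast
      then show False using that assms x by (auto simp: copy_edges_def)
    qed
    then show "(\<Sum>S | S \<subseteq> H0 \<and> \<sigma> \<subseteq> S. if copy_edges x = S then mass x else 0) = (if \<sigma> \<subseteq> copy_edges x then mass x else 0)"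
      using fin by (subst sum.delta') auto
  qed
  finally show ?thesis .
qed

lemma sum_copies: "(\<Sum>x\<in>copies. F x) = (\<Sum>u\<in>V. \<Sum>v\<in>V. \<Sum>f\<in>Fs t. F (u, v, f))"
  for F :: "_ \<Rightarrow> real"
  unfolding copies_def by (simp add: sum.cartesian_product')

lemma total_mass: "(1 / 2) ^ t \<le> (\<Sum>x\<in>copies. mass x)"
proof -
  have "(1 / 2) ^ t = (\<Sum>u\<in>V. \<Sum>v\<in>V. \<pi> u v) * (1 / 2) ^ t" using pi_sum by simp
  also have "\<dots> = (\<Sum>u\<in>V. \<Sum>v\<in>V. \<pi> u v * (1 / 2) ^ t)" by (simp only: sum_distrib_right)
  also have "\<dots> \<le> (\<Sum>u\<in>V. \<Sum>v\<in>V. \<Sum>f\<in>Fs t. mass (u, v, f))"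
  proof (intro sum_mono)
    fix u v assume uv: "u \<in> V" "v \<in> V"
    show "\<pi> u v * (1 / 2) ^ t \<le> (\<Sum>f\<in>Fs t. mass (u, v, f))"
    proof (cases "\<pi> u v = 0")
      case False
      have "(\<Sum>w\<in>V. k u v w) \<noteq> 0" using k_eq[OF uv False] by simp
      then obtain w where "k u v w \<noteq> 0" using sum.not_neutral_contains_not_neutral by blast
      then have ne: "u \<noteq> v" using kpos by blast
      have "\<pi> u v * (1 / 2) ^ t \<le> \<pi> u v * (\<Sum>f\<in>Fs t. if \<forall>i<t. fits H u v (used u v f i) (f i) then \<Prod>i<t. g u v (f i) else 0)"
        using pi0 by (intro mult_left_mono valid_mass uv False) auto
      also have "\<dots> = (\<Sum>f\<in>Fs t. mass (u, v, f))"
        unfolding sum_distrib_left mass_def valid_def using ne by (intro sum.cong) auto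
      finally show ?thesis .
    qed (simp add: mass_def)
  qed
  finally show ?thesis unfolding sum_copies .
qed

lemma match_positions:
  assumes "\<sigma> \<subseteq> edge_set t f"
  obtains P p where "P \<subseteq> {..<t} \<times> UNIV" "card P = card \<sigma>" "p \<in> PiE P (\<lambda>_. \<sigma>)" "\<forall>z\<in>P. edge_at f z = p z"
proof -
  have "\<forall>e\<in>\<sigma>. \<exists>z. z \<in> {..<t} \<times> UNIV \<and> edge_at f z = e" using assms unfolding edge_set_def by blast
  then obtain z where z: "\<And>e. e \<in> \<sigma> \<Longrightarrow> z e \<in> {..<t} \<times> UNIV \<and> edge_at f (z e) = e" by metis
  have "inj_on z \<sigma>" using z by (metis inj_onI)
  show ?thesis
  proof (rule that[of "z ` \<sigma>" "restrict (edge_at f) (z ` \<sigma>)"])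
    show "z ` \<sigma> \<subseteq> {..<t} \<times> UNIV" using z by blast
    show "card (z ` \<sigma>) = card \<sigma>" using \<open>inj_on z \<sigma>\<close> by (rule card_image)
  qed (use z in auto)
qed

text \<open>A union bound over the positions P at which the edges of \<sigma> may occur and over
  their arrangement p on P. As |P| = |\<sigma>| is at most 2t, the number of choices depends on t
  only.\<close>

lemma wdeg_bound:
  assumes \<sigma>: "finite \<sigma>" "\<sigma> \<noteq> {}"
  shows "(\<Sum>x\<in>copies. if \<sigma> \<subseteq> copy_edges x then mass x else 0)
    \<le> 2 ^ (2 * t) * real (2 * t) ^ (2 * t) * spread_const * \<tau> ^ (card \<sigma> - 1) / h"
proof -
  let ?pos = "{..<t} \<times> (UNIV :: bool set)"
  define K where "K = (SIGMA P:{P. P \<subseteq> ?pos \<and> card P = card \<sigma>}. PiE P (\<lambda>_. \<sigma>))"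
  let ?D = "spread_const * \<tau> ^ (card \<sigma> - 1) / h"
  have sc: "0 \<le> spread_const" unfolding spread_const_def using B1 by simp
  have finK: "finite K" unfolding K_def using \<sigma>
    by (intro finite_SigmaI) (auto intro!: finite_PiE intro: finite_subset)
  have cpos: "card ?pos = 2 * t" by (simp add: card_cartesian_product)
  have cK: "real (card K) \<le> 2 ^ (2 * t) * real (2 * t) ^ (2 * t)"
  proof -
    have "card K = (\<Sum>P | P \<subseteq> ?pos \<and> card P = card \<sigma>. card (PiE P (\<lambda>_. \<sigma>)))"
      unfolding K_def using \<sigma> by (intro card_SigmaI) (auto intro!: finite_PiE intro: finite_subset)
    also have "\<dots> \<le> (\<Sum>P | P \<subseteq> ?pos \<and> card P = card \<sigma>. (2 * t) ^ (2 * t))"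
    proof (rule sum_mono)
      fix P assume "P \<in> {P. P \<subseteq> ?pos \<and> card P = card \<sigma>}"
      then have P: "P \<subseteq> ?pos" "card P = card \<sigma>" by auto
      have le: "card P \<le> 2 * t" using card_mono[OF _ P(1)] cpos by simp
      have "card (PiE P (\<lambda>_. \<sigma>)) = card P ^ card P"
        using P finite_subset[OF P(1)] by (simp add: card_PiE)
      also have "\<dots> \<le> (2 * t) ^ card P" using le by (rule power_mono) simp
      also have "\<dots> \<le> (2 * t) ^ (2 * t)" using le t1 by (intro power_increasing) auto
      finally show "card (PiE P (\<lambda>_. \<sigma>)) \<le> (2 * t) ^ (2 * t)" .
    qed
    also have "\<dots> = card {P. P \<subseteq> ?pos \<and> card P = card \<sigma>} * (2 * t) ^ (2 * t)" by simp
    also have "\<dots> \<le> card (Pow ?pos) * (2 * t) ^ (2 * t)" by (intro mult_right_mono card_mono) auto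
    also have "\<dots> = 2 ^ (2 * t) * (2 * t) ^ (2 * t)" by (simp only: card_Pow[of ?pos] cpos finite_cartesian_product finite_lessThan finite_UNIV finite_code)
    finally have "real (card K) \<le> real (2 ^ (2 * t) * (2 * t) ^ (2 * t))" by (rule of_nat_mono)
    then show ?thesis by simp
  qed
  \<comment> \<open>\<open>F\<close> forgets validity, so that the factorisation behind
    \<open>positions_bound\<close> is available.\<close>
  define F where "F P p x = (case x of (u, v, f) \<Rightarrow> \<pi> u v * (if \<forall>z\<in>P. edge_at f z = p z then \<Prod>i<t. g u v (f i) else 0))" for P p x
  have F0: "0 \<le> F P p x" for P p x
    unfolding F_def using pi0 by (auto intro!: mult_nonneg_nonneg prod_nonneg g0 split: prod.split simp del: g.simps)
  have "(\<Sum>x\<in>copies. if \<sigma> \<subseteq> copy_edges x then mass x else 0) \<le> (\<Sum>x\<in>copies. \<Sum>(P, p)\<in>K. F P p x)"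
  proof (rule sum_mono)
    fix x assume "x \<in> copies"
    have S0: "0 \<le> (\<Sum>(P, p)\<in>K. F P p x)" by (intro sum_nonneg) (simp add: F0 split: prod.split)
    obtain u v f where x: "x = (u, v, f)" by (cases x)
    show "(if \<sigma> \<subseteq> copy_edges x then mass x else 0) \<le> (\<Sum>(P, p)\<in>K. F P p x)"
    proof (cases "\<sigma> \<subseteq> copy_edges x \<and> mass x \<noteq> 0")
      case True
      then have "\<sigma> \<subseteq> edge_set t f" by (simp add: copy_edges_def x)
      then obtain P p where Pp: "P \<subseteq> ?pos" "card P = card \<sigma>" "p \<in> PiE P (\<lambda>_. \<sigma>)" "\<forall>z\<in>P. edge_at f z = p z"
        by (rule match_positions)
      have val: "valid H t u v f" using True x mass_valid by blast
      have "mass x = F P p x" unfolding x mass_def F_def prod.case if_P[OF val] if_P[OF Pp(4)] ..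
      also have "\<dots> \<le> (\<Sum>(P, p)\<in>K. F P p x)"
      proof -
        have "(P, p) \<in> K" using Pp by (simp add: K_def)
        moreover have "0 \<le> (case z of (P, p) \<Rightarrow> F P p x)" for z by (cases z) (simp only: F0 prod.case)
        ultimately show ?thesis using member_le_sum[of "(P, p)" K "\<lambda>(P, p). F P p x"] finK by simp
      qed
      finally show ?thesis using True by simp
    qed (use S0 in auto)
  qed
  also have "\<dots> = (\<Sum>(P, p)\<in>K. \<Sum>x\<in>copies. F P p x)"
    by (subst sum.swap) (simp add: case_prod_unfold)
  also have "\<dots> \<le> (\<Sum>(P, p)\<in>K. ?D)"
  proof (rule sum_mono, clarify)
    fix P p assume "(P, p) \<in> K"
    then have P: "P \<subseteq> ?pos" "card P = card \<sigma>" by (auto simp: K_def)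
    have "P \<noteq> {}" using P(2) \<sigma> by auto
    have "(\<Sum>x\<in>copies. F P p x) \<le> spread_const * \<tau> ^ (card P - 1) / h"
      unfolding sum_copies using positions_bound[OF P(1) \<open>P \<noteq> {}\<close>, of p] by (simp add: F_def sum_distrib_left)
    then show "(\<Sum>x\<in>copies. F P p x) \<le> ?D" unfolding P(2) .
  qed
  also have "\<dots> = card K * ?D" by simp
  also have "\<dots> \<le> (2 ^ (2 * t) * real (2 * t) ^ (2 * t)) * ?D"
    using cK sc \<tau>0 h0 by (intro mult_right_mono) auto
  finally show ?thesis by simp
qed

text \<open>\<open>H0\<close> is the family for which containers are wanted; \<open>H\<close> is a
  cleaned subfamily in which the copies are sampled. The law is regarded as a weight on
  \<open>H0\<close>.\<close>

theorem spread_weight: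
  assumes H0: "finite H0" "H \<subseteq> H0"
  shows "uniform_weight H0 (2 * t) copy_weight" "(1 / 2) ^ t \<le> wdeg H0 copy_weight {}"
    "\<And>\<sigma>. \<sigma> \<subseteq> H0 \<Longrightarrow> \<sigma> \<noteq> {} \<Longrightarrow>
       wdeg H0 copy_weight \<sigma> \<le> 2 ^ (2 * t) * real (2 * t) ^ (2 * t) * spread_const * \<tau> ^ (card \<sigma> - 1) / h"
    "\<And>S K. copy_weight S \<noteq> 0 \<Longrightarrow> S \<subseteq> edges K \<Longrightarrow> (\<And>e. e \<in> S \<Longrightarrow> e \<subseteq> verts K) \<Longrightarrow>
       contains_copy K (expansion r (complete_bipartite 2 t))"
proof -
  show "uniform_weight H0 (2 * t) copy_weight"
    unfolding uniform_weight_def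
  proof (intro conjI allI impI)
    show "0 \<le> copy_weight S" for S unfolding copy_weight_def using mass0 by (intro sum_nonneg) auto
    fix S assume "copy_weight S \<noteq> 0"
    then obtain u v f where "valid H t u v f" "S = edge_set t f" by (rule copy_weight_nz)
    then show "S \<subseteq> H0" "card S = 2 * t"
      using valid_edge_set_subset[of u v f] card_edge_set[of H t u v f] H0 by auto
  qed
  show "(1 / 2) ^ t \<le> wdeg H0 copy_weight {}" using total_mass unfolding wdeg_copy_weight[OF H0] by simp
  show "wdeg H0 copy_weight \<sigma> \<le> 2 ^ (2 * t) * real (2 * t) ^ (2 * t) * spread_const * \<tau> ^ (card \<sigma> - 1) / h"
    if "\<sigma> \<subseteq> H0" "\<sigma> \<noteq> {}" for \<sigma>
    unfolding wdeg_copy_weight[OF H0] using that H0 finite_subset by (intro wdeg_bound) auto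
  fix S and K assume S: "copy_weight S \<noteq> 0" "S \<subseteq> edges K" "\<And>e. e \<in> S \<Longrightarrow> e \<subseteq> verts K"
  obtain u v f where f: "valid H t u v f" "S = edge_set t f" using S(1) by (rule copy_weight_nz)
  show "contains_copy K (expansion r (complete_bipartite 2 t))"
  proof (rule valid_contains_copy[OF f(1) t1])
    show "finite e \<and> card e = r" if "e \<in> H" for e using H[OF that] fin_edge[OF that] by simp
    show "edge_set t f \<subseteq> edges K" using S(2) f(2) by simp
    show "e \<subseteq> verts K" if "e \<in> edge_set t f" for e using S(3) f(2) that by blast
  qed
qed

end

section \<open>Balanced supersaturation\<close>

text \<open>The interface between supersaturation and containers: a law on copies, up to a constant
  mass, whose codegrees have the form required by the container theorem with \<tau> = s /
  |H|.\<close>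

definition spread_copies :: "'a set set \<Rightarrow> nat \<Rightarrow> nat \<Rightarrow> real \<Rightarrow> real \<Rightarrow> bool" where
  "spread_copies H r t C s \<longleftrightarrow> (\<exists>W. uniform_weight H (2 * t) W \<and> (1 / 2) ^ t \<le> wdeg H W {} \<and>
     (\<forall>\<sigma>. \<sigma> \<subseteq> H \<longrightarrow> \<sigma> \<noteq> {} \<longrightarrow> wdeg H W \<sigma> \<le> C * (s / card H) ^ (card \<sigma> - 1) / card H) \<and>
     (\<forall>S K. W S \<noteq> 0 \<longrightarrow> S \<subseteq> edges K \<longrightarrow> (\<forall>e\<in>S. e \<subseteq> verts K) \<longrightarrow>
       contains_copy K (expansion r (complete_bipartite 2 t))))"

lemma (in spread) spread_copiesI:
  assumes "finite H0" "H \<subseteq> H0" "h = card H0" "\<tau> = s / card H0"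
  shows "spread_copies H0 r t (2 ^ (2 * t) * real (2 * t) ^ (2 * t) * (r ^ (t + 3) * B ^ (t + 1))) s"
  unfolding spread_copies_def using spread_weight[OF assms(1,2)] assms(3,4)
  by (intro exI[of _ copy_weight]) (simp add: spread_const_def)

text \<open>As long as some A lies in the shadow of at most K members, delete those members. This
  costs at most K and removes A from the union of the shadows for good. It is applied both to
  (r-1)-subsets and to pairs.\<close>

lemma full_subfamily:
  fixes K :: real
  assumes "finite H" "\<And>e. e \<in> H \<Longrightarrow> finite (sh e)" "K \<ge> 0"
  shows "\<exists>H'\<subseteq>H. real (card H') \<ge> card H - K * card (\<Union>e\<in>H. sh e) \<and>
    (\<forall>e\<in>H'. \<forall>A\<in>sh e. K < card {e'\<in>H'. A \<in> sh e'})"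
  using assms
proof (induction "card H" arbitrary: H rule: less_induct)
  case less
  show ?case
  proof (cases "\<forall>e\<in>H. \<forall>A\<in>sh e. K < card {e'\<in>H. A \<in> sh e'}")
    case True
    then show ?thesis using less.prems by (intro exI[of _ H]) auto
  next
    case False
    then obtain e A where e: "e \<in> H" "A \<in> sh e" "card {e'\<in>H. A \<in> sh e'} \<le> K" by force
    define H1 where "H1 = {e'\<in>H. A \<notin> sh e'}"
    have fin: "finite H1" using less.prems by (simp add: H1_def)
    have "card H1 < card H" using e less.prems by (intro psubset_card_mono) (auto simp: H1_def)
    from less.hyps[OF this fin] less.prems obtain H' where H': "H' \<subseteq> H1"
      "real (card H') \<ge> card H1 - K * card (\<Union>e\<in>H1. sh e)"
      "\<forall>e\<in>H'. \<forall>A\<in>sh e. K < card {e'\<in>H'. A \<in> sh e'}" by (auto simp: H1_def)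
    have finU: "finite (\<Union>e\<in>H. sh e)" using less.prems by auto
    have "A \<in> (\<Union>e\<in>H. sh e)" using e by blast
    moreover have "(\<Union>e\<in>H1. sh e) \<subseteq> (\<Union>e\<in>H. sh e) - {A}" by (auto simp: H1_def)
    ultimately have "card (\<Union>e\<in>H1. sh e) < card (\<Union>e\<in>H. sh e)"
      by (intro psubset_card_mono[OF finU]) blast
    then have "real (card (\<Union>e\<in>H1. sh e)) \<le> real (card (\<Union>e\<in>H. sh e)) - 1" by linarith
    then have "K * card (\<Union>e\<in>H1. sh e) \<le> K * (real (card (\<Union>e\<in>H. sh e)) - 1)"
      using less.prems(3) by (rule mult_left_mono)
    moreover have "card H = card H1 + card {e'\<in>H. A \<in> sh e'}"
      using less.prems(1) by (subst card_Un_disjoint[symmetric]) (auto simp: H1_def intro!: arg_cong[where f = card])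
    ultimately have "real (card H') \<ge> card H - K * card (\<Union>e\<in>H. sh e)"
      using H'(2) e(3) by (simp add: right_diff_distrib)
    moreover have "H' \<subseteq> H" using H'(1) by (auto simp: H1_def)
    ultimately show ?thesis using H'(3) by blast
  qed
qed

text \<open>
  Double counting the exchanges of \<open>z\<close> for another vertex. This makes the edges of a random copy disjoint
  outside \<open>K\<^sub>2\<^sub>,\<^sub>t\<close> with positive probability, even when the degrees are bounded.
\<close>

lemma full_triple_degree:
  fixes K :: real
  assumes fin: "finite H" and r: "\<And>e. e \<in> H \<Longrightarrow> finite e \<and> card e = r"
    and full: "\<And>e A. e \<in> H \<Longrightarrow> A \<subseteq> e \<Longrightarrow> card A = r - 1 \<Longrightarrow> K < card {e'\<in>H. A \<subseteq> e'}"
    and z: "z \<noteq> u" "z \<noteq> w"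
  shows "(K - 1) * card {e\<in>pair_edges H u w. z \<in> e} \<le> r * pdeg H u w"
proof -
  let ?L = "{e\<in>pair_edges H u w. z \<in> e}" and ?N = "{e\<in>pair_edges H u w. z \<notin> e}"
  have finP: "finite (pair_edges H u w)" using fin by (simp add: pair_edges_def)
  have "(K - 1) * card ?L = (\<Sum>e\<in>?L. K - 1)" by simp
  also have "\<dots> \<le> (\<Sum>e\<in>?L. real (card {e'\<in>?N. e - {z} \<subseteq> e'}))"
  proof (rule sum_mono)
    fix e assume "e \<in> ?L"
    then have e: "e \<in> H" "u \<in> e" "w \<in> e" "z \<in> e" by (auto simp: pair_edges_def)
    have cA: "card (e - {z}) = r - 1" using r[OF e(1)] e by simp
    have "K < card {e'\<in>H. e - {z} \<subseteq> e'}" by (rule full[OF e(1) _ cA]) auto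
    also have "{e'\<in>H. e - {z} \<subseteq> e'} \<subseteq> insert e {e'\<in>?N. e - {z} \<subseteq> e'}"
    proof
      fix e' assume e': "e' \<in> {e'\<in>H. e - {z} \<subseteq> e'}"
      show "e' \<in> insert e {e'\<in>?N. e - {z} \<subseteq> e'}"
      proof (cases "z \<in> e'")
        case True
        then have "e \<subseteq> e'" using e' by blast
        moreover have "card e' = card e" "finite e'" using r e' e by auto
        ultimately have "e = e'" by (intro card_subset_eq) auto
        then show ?thesis by simp
      next
        case False
        then show ?thesis using e' e z by (auto simp: pair_edges_def)
      qed
    qed
    then have "card {e'\<in>H. e - {z} \<subseteq> e'} \<le> card (insert e {e'\<in>?N. e - {z} \<subseteq> e'})"
      using finP by (intro card_mono) auto
    also have "\<dots> \<le> Suc (card {e'\<in>?N. e - {z} \<subseteq> e'})" by (rule card_insert_le_m1) auto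
    finally show "K - 1 \<le> card {e'\<in>?N. e - {z} \<subseteq> e'}" by linarith
  qed
  also have "\<dots> = real (\<Sum>e\<in>?L. card {e'\<in>?N. e - {z} \<subseteq> e'})" by simp
  also have "(\<Sum>e\<in>?L. card {e'\<in>?N. e - {z} \<subseteq> e'}) = (\<Sum>e'\<in>?N. card {e\<in>?L. e - {z} \<subseteq> e'})"
    using finP by (intro sum_multicount_gen) auto
  also have "real \<dots> \<le> real (\<Sum>e'\<in>?N. r)"
  proof (intro of_nat_mono sum_mono)
    fix e' assume "e' \<in> ?N"
    then have e': "e' \<in> H" "z \<notin> e'" by (auto simp: pair_edges_def)
    have "{e\<in>?L. e - {z} \<subseteq> e'} \<subseteq> (\<lambda>y. insert z (e' - {y})) ` e'"
    proof
      fix e assume e: "e \<in> {e\<in>?L. e - {z} \<subseteq> e'}"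
      then have eH: "e \<in> H" "z \<in> e" "e - {z} \<subseteq> e'" by (auto simp: pair_edges_def)
      have "card (e' - (e - {z})) = card e' - card (e - {z})"
        using eH r[OF eH(1)] by (intro card_Diff_subset) auto
      also have "\<dots> = 1"
        using eH r[OF eH(1)] r[OF e'(1)] card_gt_0_iff[of e] by (auto simp: Suc_diff_Suc)
      finally obtain y where y: "e' - (e - {z}) = {y}" by (auto simp: card_1_singleton_iff)
      then have "e = insert z (e' - {y})" using eH by blast
      then show "e \<in> (\<lambda>y. insert z (e' - {y})) ` e'" using y by blast
    qed
    then have "card {e\<in>?L. e - {z} \<subseteq> e'} \<le> card ((\<lambda>y. insert z (e' - {y})) ` e')"
      using r[OF e'(1)] by (intro card_mono) auto
    also have "\<dots> \<le> card e'" using r[OF e'(1)] by (intro card_image_le) auto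
    finally show "card {e\<in>?L. e - {z} \<subseteq> e'} \<le> r" using r[OF e'(1)] by simp
  qed
  also have "real (\<Sum>e'\<in>?N. r) = r * real (card ?N)" by simp
  also have "\<dots> \<le> r * pdeg H u w"
    using finP by (intro mult_left_mono of_nat_mono card_mono) auto
  finally show ?thesis by simp
qed

lemma sum_pair_edges:
  assumes "finite V" "finite H"
  shows "(\<Sum>v\<in>V. real (card {e\<in>pair_edges H u w. v \<in> e})) = (\<Sum>e\<in>pair_edges H u w. real (card (e \<inter> V)))"
proof -
  have fin: "finite (pair_edges H u w)" using assms by (simp add: pair_edges_def)
  have "(\<Sum>v\<in>V. card {e\<in>pair_edges H u w. v \<in> e}) = (\<Sum>e\<in>pair_edges H u w. card {v\<in>V. v \<in> e})"
    using assms fin by (intro sum_multicount_gen) auto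
  also have "\<dots> = (\<Sum>e\<in>pair_edges H u w. card (e \<inter> V))" by (intro sum.cong arg_cong[where f = card]) auto
  finally have "real (\<Sum>v\<in>V. card {e\<in>pair_edges H u w. v \<in> e}) = real (\<Sum>e\<in>pair_edges H u w. card (e \<inter> V))"
    by (rule arg_cong)
  then show ?thesis by simp
qed

lemma triple_degree_commute: "{e \<in> pair_edges H u v. w \<in> e} = {e \<in> pair_edges H u w. v \<in> e}"
  by (auto simp: pair_edges_def)

text \<open>
  Dense case: all pairs inside edges have degree at least \<open>d\<close>. The pair \<open>(u, v)\<close> and the vertices \<open>w\<close> are
  chosen inside edges, with weight the number of edges containing \<open>u, v, w\<close>.
\<close>

lemma spread_copies_dense_pairs:
  fixes r t :: nat and d m s B :: real
  defines "q \<equiv> real (2 + 2 * r * t + r)"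
  assumes V: "finite V" and H0: "finite H0" and G: "G \<subseteq> H0" "\<And>e. e \<in> G \<Longrightarrow> e \<subseteq> V \<and> card e = r"
    and rt: "r \<ge> 3" "t \<ge> 1"
    and big: "8 * card G \<ge> card H0" "card H0 > 0"
    and d: "\<And>e u w. e \<in> G \<Longrightarrow> u \<in> e \<Longrightarrow> w \<in> e \<Longrightarrow> u \<noteq> w \<Longrightarrow> d \<le> pdeg G u w"
    and m: "\<And>u v w. u \<noteq> v \<Longrightarrow> u \<noteq> w \<Longrightarrow> v \<noteq> w \<Longrightarrow> real (card {e\<in>pair_edges G u v. w \<in> e}) \<le> m"
    and md: "8 * q * m \<le> d" "d > 0" "m > 0" and s: "s > 0"
    and B: "B \<ge> 8 * r"
    and num1: "m * card H0 \<le> B * s * d ^ 2"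
    and num2: "\<And>b. 1 \<le> b \<Longrightarrow> b \<le> t \<Longrightarrow> 8 * m ^ b * card H0 ^ (2 * b - 1) \<le> B * s ^ (2 * b - 1) * d ^ (3 * b - 1)"
  shows "spread_copies H0 r t (2 ^ (2 * t) * real (2 * t) ^ (2 * t) * (r ^ (t + 3) * B ^ (t + 1))) s"
proof -
  let ?h = "real (card H0)"
  define td where "td u v w = real (card {e\<in>pair_edges G u v. w \<in> e})" for u v w
  define k' where "k' u v w = (if u \<noteq> v \<and> w \<noteq> u \<and> w \<noteq> v then td u v w else 0)" for u v w
  define T where "T u v = (\<Sum>w\<in>V. k' u v w)" for u v
  define p' where "p' u v = (if u \<noteq> v then pdeg G u v else 0)" for u v
  define N where "N = (\<Sum>u\<in>V. \<Sum>v\<in>V. p' u v)"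
  define \<pi> where "\<pi> u v = p' u v / N" for u v
  \<comment> \<open>For distinct u, v, \<open>T u v\<close> is r - 2 times
    \<open>pdeg G u v\<close>. The probability of u, v, w is therefore proportional to their triple
    degree; it is symmetric, and summing it over v gives the order of \<open>pdeg G u w / N\<close>,
    as the marginal assumptions demand.\<close>
  define k where "k u v w = k' u v w / T u v" for u v w
  have finG: "finite G" using G(1) H0 finite_subset by blast
  have h0: "?h > 0" using big by simp
  have k'0: "0 \<le> k' u v w" for u v w by (simp add: k'_def td_def)
  have T0: "0 \<le> T u v" for u v unfolding T_def using k'0 by (intro sum_nonneg)
  have p'0: "0 \<le> p' u v" for u v by (simp add: p'_def)
  have "real (card G) \<le> N"
  proof -
    have "real (card G) = (\<Sum>e\<in>G. 1)" by simp
    also have "\<dots> \<le> (\<Sum>e\<in>G. \<Sum>u\<in>V. \<Sum>v\<in>V. if u \<noteq> v \<and> u \<in> e \<and> v \<in> e then 1 else 0)"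
    proof (rule sum_mono)
      fix e assume e: "e \<in> G"
      then have "card e = r" "e \<subseteq> V" using G by auto
      then obtain u v where uv: "u \<in> e" "v \<in> e" "u \<noteq> v"
        using rt by (metis One_nat_def card_le_Suc0_iff_eq V finite_subset not_less_eq_eq numeral_3_eq_3 le_trans le_SucI order_refl)
      let ?f = "\<lambda>u v. if u \<noteq> v \<and> u \<in> e \<and> v \<in> e then 1 else 0 :: real"
      have "1 = ?f u v" using uv by simp
      also have "\<dots> \<le> (\<Sum>v\<in>V. ?f u v)" using V uv \<open>e \<subseteq> V\<close> by (intro member_le_sum) auto
      also have "\<dots> \<le> (\<Sum>u\<in>V. \<Sum>v\<in>V. ?f u v)" using V uv \<open>e \<subseteq> V\<close>
        by (intro member_le_sum[where f = "\<lambda>u. \<Sum>v\<in>V. ?f u v"] sum_nonneg) auto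
      finally show "1 \<le> (\<Sum>u\<in>V. \<Sum>v\<in>V. ?f u v)" .
    qed
    also have "\<dots> = (\<Sum>u\<in>V. \<Sum>v\<in>V. \<Sum>e\<in>G. if u \<noteq> v \<and> u \<in> e \<and> v \<in> e then 1 else 0)"
      by (subst sum.swap, rule sum.cong[OF refl], rule sum.swap)
    also have "\<dots> = N" unfolding N_def
    proof (intro sum.cong refl)
      fix u v
      have "(\<Sum>e\<in>G. if u \<noteq> v \<and> u \<in> e \<and> v \<in> e then 1 else 0 :: real) = (\<Sum>e\<in>{e\<in>G. u \<noteq> v \<and> u \<in> e \<and> v \<in> e}. 1)"
        using finG by (subst sum.inter_filter) auto
      then show "(\<Sum>e\<in>G. if u \<noteq> v \<and> u \<in> e \<and> v \<in> e then 1 else 0 :: real) = p' u v"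
        by (simp add: p'_def pair_edges_def)
    qed
    finally show ?thesis .
  qed
  then have N: "?h / 8 \<le> N" "N > 0" using big by auto
  \<comment> \<open>As r \<ge> 3, each edge through u and v has a third vertex.\<close>
  have dT: "pdeg G u v \<le> T u v" if "u \<noteq> v" for u v
  proof -
    have "pdeg G u v = (\<Sum>e\<in>pair_edges G u v. 1)" by simp
    also have "\<dots> \<le> (\<Sum>e\<in>pair_edges G u v. real (card (e \<inter> (V - {u, v}))))"
    proof (rule sum_mono)
      fix e assume "e \<in> pair_edges G u v"
      then have e: "e \<subseteq> V" "card e = r" using G(2) by (auto simp: pair_edges_def)
      have "e \<inter> (V - {u, v}) = e - {u, v}" using e by auto
      moreover have "card (e - {u, v}) \<ge> card e - card {u, v}" by (rule diff_card_le_card_Diff) simp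
      moreover have "card {u, v} = 2" using that by simp
      ultimately show "1 \<le> real (card (e \<inter> (V - {u, v})))" using e rt by simp
    qed
    also have "\<dots> = (\<Sum>w\<in>V - {u, v}. td u v w)"
      unfolding td_def using V finG by (intro sum_pair_edges[symmetric]) auto
    also have "\<dots> = T u v" unfolding T_def k'_def using V that by (intro sum.mono_neutral_cong_left) auto
    finally show ?thesis .
  qed
  have knz: "k' u v w \<noteq> 0 \<Longrightarrow> u \<noteq> v \<and> w \<noteq> u \<and> w \<noteq> v \<and> pair_edges G u w \<noteq> {} \<and> pair_edges G v w \<noteq> {} \<and>
      d \<le> pdeg G u w \<and> d \<le> pdeg G v w \<and> d \<le> pdeg G u v \<and> d \<le> T u v \<and> k' u v w \<le> m" for u v w
  proof -
    assume nz: "k' u v w \<noteq> 0"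
    then have ne: "u \<noteq> v" "w \<noteq> u" "w \<noteq> v" "td u v w \<noteq> 0" by (auto simp: k'_def split: if_splits)
    have "{e\<in>pair_edges G u v. w \<in> e} \<noteq> {}"
    proof
      assume "{e\<in>pair_edges G u v. w \<in> e} = {}"
      then have "td u v w = 0" unfolding td_def by (simp only: card.empty of_nat_0)
      then show False using ne by simp
    qed
    then obtain e where e: "e \<in> G" "u \<in> e" "v \<in> e" "w \<in> e" by (auto simp: pair_edges_def)
    have "d \<le> pdeg G u v" using d e ne by blast
    moreover from this have "d \<le> T u v" using dT[OF ne(1)] by linarith
    moreover have "d \<le> pdeg G u w" "d \<le> pdeg G v w" using d e ne by blast+
    moreover have "k' u v w \<le> m" using ne m[of u v w] by (simp add: k'_def td_def)
    moreover have "e \<in> pair_edges G u w" "e \<in> pair_edges G v w" using e by (simp_all add: pair_edges_def)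
    ultimately show ?thesis using ne \<open>d \<le> pdeg G u v\<close> by blast
  qed
  have td_sum: "(\<Sum>v\<in>V. td u v w) \<le> r * pdeg G u w" for u w
  proof -
    have "(\<Sum>v\<in>V. td u v w) = (\<Sum>v\<in>V. real (card {e\<in>pair_edges G u w. v \<in> e}))"
    proof (rule sum.cong[OF refl])
      fix v
      have "{e \<in> pair_edges G u v. w \<in> e} = {e \<in> pair_edges G u w. v \<in> e}" by (rule triple_degree_commute)
      then show "td u v w = real (card {e\<in>pair_edges G u w. v \<in> e})" by (simp only: td_def)
    qed
    also have "\<dots> = (\<Sum>e\<in>pair_edges G u w. real (card (e \<inter> V)))" by (rule sum_pair_edges[OF V finG])
    also have "\<dots> \<le> (\<Sum>e\<in>pair_edges G u w. real r)"
    proof (rule sum_mono)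
      fix e assume "e \<in> pair_edges G u w"
      then have "e \<in> G" by (simp add: pair_edges_def)
      then have "e \<inter> V = e" "card e = r" using G(2) by blast+
      then show "real (card (e \<inter> V)) \<le> real r" by simp
    qed
    finally show ?thesis by (simp add: mult.commute)
  qed
  have pk: "\<pi> u v * k u v w \<le> k' u v w / N" for u v w
  proof (cases "k' u v w = 0")
    case False
    then have "p' u v \<le> T u v" "T u v > 0" using knz[OF False] dT md by (auto simp: p'_def)
    then have "p' u v / T u v \<le> 1" by simp
    moreover have "0 \<le> k' u v w / N" using k'0 N by simp
    ultimately have "k' u v w / N * (p' u v / T u v) \<le> k' u v w / N * 1" by (rule mult_left_mono)
    moreover have "\<pi> u v * k u v w = k' u v w / N * (p' u v / T u v)" by (simp add: \<pi>_def k_def)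
    ultimately show ?thesis by simp
  qed (simp add: k_def)
  have pksym: "\<pi> u v * k u v w = \<pi> v u * k v u w" for u v w
  proof -
    have "td u v w = td v u w" for w unfolding td_def by (subst pair_edges_commute) (rule refl)
    then have "k' u v w = k' v u w" for w by (auto simp: k'_def)
    moreover from this have "T u v = T v u" by (simp add: T_def)
    moreover have "pdeg G u v = pdeg G v u" by (subst pair_edges_commute) (rule refl)
    then have "p' u v = p' v u" by (auto simp: p'_def)
    ultimately show ?thesis by (simp add: \<pi>_def k_def)
  qed
  have marg: "(\<Sum>v\<in>V. \<pi> u v * k u v w) \<le> B * pdeg G u w / ?h" for u w
  proof -
    have "(\<Sum>v\<in>V. \<pi> u v * k u v w) \<le> (\<Sum>v\<in>V. td u v w / N)"
      using pk N by (intro sum_mono order_trans[OF pk] divide_right_mono) (auto simp: k'_def td_def)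
    also have "\<dots> \<le> r * pdeg G u w / N" using td_sum N by (simp add: sum_divide_distrib[symmetric] divide_right_mono)
    also have "\<dots> \<le> r * pdeg G u w / (?h / 8)" using N h0 by (intro divide_left_mono) auto
    also have "\<dots> = (8 * r) * pdeg G u w / ?h" by simp
    also have "\<dots> \<le> B * pdeg G u w / ?h" using B h0 by (intro divide_right_mono mult_right_mono) auto
    finally show ?thesis .
  qed
  have k1: "k u v w \<le> m / d" for u v w
  proof (cases "k' u v w = 0")
    case False
    then show ?thesis unfolding k_def using knz[OF False] md k'0 by (intro frac_le) auto
  qed (use md in \<open>simp add: k_def\<close>)
  have q1: "q \<ge> 1" using rt by (simp add: q_def)
  \<comment> \<open>The parameters follow from k \<le> m / d and from \<pi> k \<le> 8 m / h: every
    prescribed edge contributes one more division by its pair degree, which is at least d.\<close>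
  have "spread V G r t \<pi> k B (s / ?h) ?h (m / d ^ 2) (m / d) (m / d ^ 3) (8 * m / (?h * d ^ 2))"
  proof unfold_locales
    show "(\<Sum>u\<in>V. \<Sum>v\<in>V. \<pi> u v) = 1"
      using N unfolding \<pi>_def by (simp add: sum_divide_distrib[symmetric] N_def[symmetric])
    show "(\<Sum>w\<in>V. k u v w) \<le> 1" for u v
      unfolding k_def sum_divide_distrib[symmetric] T_def[symmetric] by simp
    show "(\<Sum>w\<in>V. k u v w) = 1" if "u \<in> V" "v \<in> V" "\<pi> u v \<noteq> 0" for u v
    proof -
      have "p' u v > 0" using that(3) p'0[of u v] by (auto simp: \<pi>_def)
      then have "T u v > 0" using dT[of u v] by (auto simp: p'_def split: if_splits)
      then show ?thesis unfolding k_def sum_divide_distrib[symmetric] T_def[symmetric] by simp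
    qed
    show "u \<noteq> v \<and> pair_edges G u w \<noteq> {} \<and> pair_edges G v w \<noteq> {}" if "k u v w \<noteq> 0" for u v w
      using that knz[of u v w] by (auto simp: k_def)
    show "(\<Sum>u\<in>V. \<pi> u v * k u v w) \<le> B * pdeg G v w / ?h" for v w
      using marg[of v w] by (subst pksym)
    show "\<pi> u v * k u v w \<le> 8 * m / (?h * d ^ 2) * (pdeg G u w * pdeg G v w)" for u v w
    proof (cases "k' u v w = 0")
      case False
      have "\<pi> u v * k u v w \<le> m / N" using pk[of u v w] knz[OF False] N by (smt (verit) divide_right_mono)
      also have "\<dots> \<le> m / (?h / 8)" using N h0 md by (intro divide_left_mono) auto
      also have "\<dots> = 8 * m / (?h * d ^ 2) * (d * d)" using md by (simp add: power2_eq_square)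
      also have "\<dots> \<le> 8 * m / (?h * d ^ 2) * (pdeg G u w * pdeg G v w)"
        using knz[OF False] md h0 by (intro mult_left_mono mult_mono) auto
      finally show ?thesis .
    qed (use md h0 in \<open>simp add: k_def\<close>)
    have "k u v w \<le> m / d ^ 2 * pdeg G u w \<and> k u v w \<le> m / d ^ 2 * pdeg G v w \<and> k u v w \<le> m / d ^ 3 * (pdeg G u w * pdeg G v w)" for u v w
    proof (cases "k' u v w = 0")
      case False
      have "k u v w \<le> m / d" by (rule k1)
      moreover have "m / d = m / d ^ 2 * d" "m / d = m / d ^ 3 * (d * d)"
        using md by (simp_all add: power2_eq_square power3_eq_cube)
      moreover have "m / d ^ 2 * d \<le> m / d ^ 2 * pdeg G u w" "m / d ^ 2 * d \<le> m / d ^ 2 * pdeg G v w"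
        using knz[OF False] md by (intro mult_left_mono; simp)+
      moreover have "m / d ^ 3 * (d * d) \<le> m / d ^ 3 * (pdeg G u w * pdeg G v w)"
        using knz[OF False] md by (intro mult_left_mono mult_mono) auto
      ultimately show ?thesis by linarith
    qed (use md in \<open>simp add: k_def\<close>)
    then show "k u v w \<le> m / d ^ 2 * pdeg G u w" "k u v w \<le> m / d ^ 2 * pdeg G v w"
      "k u v w \<le> m / d ^ 3 * (pdeg G u w * pdeg G v w)" for u v w by blast+
    have "m / d * real (2 + 2 * r * t) \<le> m / d * q" using md by (intro mult_left_mono) (auto simp: q_def)
    also have "\<dots> \<le> 1 / 4" using md by (simp add: field_simps)
    finally show "m / d * real (2 + 2 * r * t) \<le> 1 / 4" .
    have "8 * q * card {e\<in>pair_edges G u w. z \<in> e} \<le> pdeg G u w"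
      if "d \<le> pdeg G u w" "u \<noteq> w" "z \<noteq> u" "z \<noteq> w" for u w z
    proof -
      have "8 * q * card {e\<in>pair_edges G u w. z \<in> e} \<le> 8 * q * m"
        using m[of u w z] that q1 by (intro mult_left_mono) auto
      then show ?thesis using md that by linarith
    qed
    then show "8 * real (2 + 2 * r * t + r) * card {e\<in>pair_edges G u w. z \<in> e} \<le> pdeg G u w"
        if "k u v w \<noteq> 0" "z \<noteq> u" "z \<noteq> w" for u v w z
      using that knz[of u v w] unfolding q_def[symmetric] by (auto simp: k_def)
    show "8 * real (2 + 2 * r * t + r) * card {e\<in>pair_edges G v w. z \<in> e} \<le> pdeg G v w"
        if "k u v w \<noteq> 0" "z \<noteq> v" "z \<noteq> w" for u v w z
      using that knz[of u v w] \<open>\<And>z w u. d \<le> pdeg G u w \<Longrightarrow> u \<noteq> w \<Longrightarrow> z \<noteq> u \<Longrightarrow> z \<noteq> w \<Longrightarrow> 8 * q * card {e\<in>pair_edges G u w. z \<in> e} \<le> pdeg G u w\<close>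
      unfolding q_def[symmetric] by (auto simp: k_def)
    show "m / d ^ 2 \<le> B * (s / ?h)" using num1 md h0 by (simp add: field_simps)
    show "8 * m / (?h * d ^ 2) * (m / d ^ 3) ^ (b - 1) \<le> B * (s / ?h) ^ (2 * b - 1) / ?h" if b: "1 \<le> b" "b \<le> t" for b
    proof -
      obtain c where c: "b = Suc c" using b by (cases b) auto
      have "8 * m ^ b * ?h ^ (2 * b - 1) / (d ^ (3 * b - 1) * ?h ^ (2 * b - 1)) \<le>
         B * s ^ (2 * b - 1) * d ^ (3 * b - 1) / (d ^ (3 * b - 1) * ?h ^ (2 * b - 1))"
        using num2[OF b] md h0 by (intro divide_right_mono) auto
      then have "8 * m ^ b / d ^ (3 * b - 1) \<le> B * (s / ?h) ^ (2 * b - 1)"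
        using md h0 by (simp add: power_divide)
      then have "8 * m ^ b / d ^ (3 * b - 1) / ?h \<le> B * (s / ?h) ^ (2 * b - 1) / ?h"
        using h0 by (intro divide_right_mono) auto
      moreover have "8 * m / (?h * d ^ 2) * (m / d ^ 3) ^ (b - 1) = 8 * m ^ b / d ^ (3 * b - 1) / ?h"
      proof -
        have "d ^ (3 * b - 1) = d ^ 2 * (d ^ 3) ^ c" by (simp add: c power_mult[symmetric] power_add[symmetric])
        then show ?thesis by (simp add: c power_divide mult_ac)
      qed
      ultimately show ?thesis by simp
    qed
  qed (use V G rt p'0 N T0 k'0 marg k1 md h0 s B in \<open>auto simp: \<pi>_def k_def\<close>)
  then show ?thesis by (rule spread.spread_copiesI) (use H0 G in auto)
qed

text \<open>
  Sparse case: many edges contain a pair of degree below \<open>d0\<close>. The pairs of small degree form a weighted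
  graph \<open>D\<close>, in which a cherry \<open>u w v\<close> is chosen with weight \<open>D u w * D v w / dg w\<close> after discarding the
  centres \<open>w\<close> and the pairs \<open>(u, v)\<close> whose total weight is far below average.
\<close>

lemma spread_copies_sparse_pairs:
  fixes r t :: nat and d0 s B n q :: real
  defines "q \<equiv> real (2 + 2 * r * t + r)"
  assumes V: "finite V" "real (card V) = n" and H0: "finite H0" and G: "G \<subseteq> H0" "\<And>e. e \<in> G \<Longrightarrow> e \<subseteq> V \<and> card e = r"
    and rt: "r \<ge> 3" "t \<ge> 1"
    and big: "card H0 > 0"
    and low: "4 * card {e\<in>G. \<exists>u\<in>e. \<exists>w\<in>e. u \<noteq> w \<and> pdeg G u w < d0} \<ge> card H0"
    and tdeg: "\<And>u w z. z \<noteq> u \<Longrightarrow> z \<noteq> w \<Longrightarrow> 8 * q * card {e \<in> pair_edges G u w. z \<in> e} \<le> pdeg G u w"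
    and d0: "d0 = card H0 * s / n ^ 3" "s > 0" "32 * s \<le> n ^ 2" "2048 * q * s ^ 2 \<le> n ^ 3"
    and B: "B \<ge> 512 ^ t"
    and num2: "\<And>b. 1 \<le> b \<Longrightarrow> b \<le> t \<Longrightarrow> n ^ (3 * b - 2) \<le> s ^ (2 * b - 1)"
  shows "spread_copies H0 r t (2 ^ (2 * t) * real (2 * t) ^ (2 * t) * (r ^ (t + 3) * B ^ (t + 1))) s"
proof -
  let ?h = "real (card H0)"
  define D where "D u w = (if u \<noteq> w \<and> pdeg G u w < d0 then pdeg G u w else 0)" for u w
  define dg where "dg w = (\<Sum>u\<in>V. D u w)" for w
  define E where "E = (\<Sum>w\<in>V. dg w)"
  \<comment> \<open>Weight dg w for the centre, then two independent ends with probabilities D / dg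
    w. The sum over v is at most \<open>D u w\<close>, so the pair u, w is drawn with probability at
    most proportional to its degree.\<close>
  define ch where "ch u v w = (if E / (4 * n) \<le> dg w \<and> u \<noteq> v then D u w * D v w / dg w else 0)" for u v w
  define \<psi> where "\<psi> u v = (\<Sum>w\<in>V. ch u v w)" for u v
  define Q where "Q u v \<longleftrightarrow> E / (8 * n ^ 2) \<le> \<psi> u v" for u v
  define p' where "p' u v = (if Q u v then \<psi> u v else 0)" for u v
  define T where "T = (\<Sum>u\<in>V. \<Sum>v\<in>V. p' u v)"
  define \<pi> where "\<pi> u v = p' u v / T" for u v
  define k where "k u v w = (if Q u v then ch u v w / \<psi> u v else 0)" for u v w
  have finG: "finite G" using G(1) H0 finite_subset by blast
  have h0: "?h > 0" using big by simp
  have n0: "n > 0"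
  proof -
    have "n \<ge> 0" using V by auto
    moreover have "n \<noteq> 0" using d0(2,3) by auto
    ultimately show ?thesis by simp
  qed
  have D0: "0 \<le> D u w" and Dd: "D u w \<le> d0" and Dp: "D u w \<le> pdeg G u w" for u w
    using d0 h0 n0 by (auto simp: D_def)
  have dg0: "0 \<le> dg w" for w unfolding dg_def using D0 by (intro sum_nonneg)
  have chi0: "0 \<le> ch u v w" for u v w using D0 dg0 by (auto simp: ch_def)
  have psi0: "0 \<le> \<psi> u v" for u v unfolding \<psi>_def using chi0 by (intro sum_nonneg)
  have p'0: "0 \<le> p' u v" for u v using psi0 by (simp add: p'_def)
  have E: "?h / 4 \<le> E"
  proof -
    let ?f = "\<lambda>e u w. if u \<noteq> w \<and> pdeg G u w < d0 \<and> u \<in> e \<and> w \<in> e then 1 else 0 :: real"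
    let ?L = "{e\<in>G. \<exists>u\<in>e. \<exists>w\<in>e. u \<noteq> w \<and> pdeg G u w < d0}"
    have "real (card ?L) = (\<Sum>e\<in>?L. 1)" by simp
    also have "\<dots> \<le> (\<Sum>e\<in>?L. \<Sum>w\<in>V. \<Sum>u\<in>V. ?f e u w)"
    proof (rule sum_mono)
      fix e assume "e \<in> ?L"
      then obtain u w where uw: "u \<in> e" "w \<in> e" "u \<noteq> w" "pdeg G u w < d0" "u \<in> V" "w \<in> V" using G(2) by blast
      have "1 = ?f e u w" using uw by simp
      also have "\<dots> \<le> (\<Sum>u\<in>V. ?f e u w)" using V uw by (intro member_le_sum) auto
      also have "\<dots> \<le> (\<Sum>w\<in>V. \<Sum>u\<in>V. ?f e u w)" using V uw
        by (intro member_le_sum[where f = "\<lambda>w. \<Sum>u\<in>V. ?f e u w"] sum_nonneg) auto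
      finally show "1 \<le> (\<Sum>w\<in>V. \<Sum>u\<in>V. ?f e u w)" .
    qed
    also have "\<dots> \<le> (\<Sum>e\<in>G. \<Sum>w\<in>V. \<Sum>u\<in>V. ?f e u w)"
      using finG by (intro sum_mono2 sum_nonneg) auto
    also have "\<dots> = (\<Sum>w\<in>V. \<Sum>u\<in>V. \<Sum>e\<in>G. ?f e u w)"
      by (subst sum.swap, rule sum.cong[OF refl], rule sum.swap)
    also have "\<dots> = E" unfolding E_def dg_def
    proof (intro sum.cong refl)
      fix u w
      have "(\<Sum>e\<in>G. ?f e u w) = (\<Sum>e\<in>{e\<in>G. u \<noteq> w \<and> pdeg G u w < d0 \<and> u \<in> e \<and> w \<in> e}. 1)"
        using finG by (subst sum.inter_filter) auto
      then show "(\<Sum>e\<in>G. ?f e u w) = D u w"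
        by (auto simp: D_def pair_edges_def)
    qed
    finally show ?thesis using low by linarith
  qed
  then have E0: "E > 0" using h0 by linarith
  \<comment> \<open>At a centre of weight at least E / (4n), this makes a single end at most half of
    the weight, so the degenerate cherries with u = v account for at most half.\<close>
  have d0E: "d0 \<le> E / (8 * n)"
  proof -
    have "d0 = ?h / (32 * n) * (32 * s / n ^ 2)" using n0 by (simp add: d0 power2_eq_square power3_eq_cube)
    also have "\<dots> \<le> ?h / (32 * n) * 1" using d0(3) n0 h0 by (intro mult_left_mono) auto
    also have "\<dots> = (?h / 4) / (8 * n)" by simp
    also have "\<dots> \<le> E / (8 * n)" using E n0 by (intro divide_right_mono) auto
    finally show ?thesis .
  qed
  \<comment> \<open>Budget: light centres lose at most E / 4, cherries with u = v at most half of
    the rest, and the pairs violating \<open>Q\<close> at most n^2 * E / (8 n^2). This leaves 3/8 E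
    - 1/8 E.\<close>
  have T: "E / 4 \<le> T"
  proof -
    define Ws where "Ws = {w\<in>V. E / (4 * n) \<le> dg w}"
    have "E \<le> (\<Sum>w\<in>V. (if w \<in> Ws then dg w else 0) + E / (4 * n))"
      unfolding E_def[of] by (rule sum_mono) (use dg0 E0 n0 in \<open>auto simp: Ws_def E_def[symmetric]\<close>)
    also have "\<dots> = (\<Sum>w\<in>Ws. dg w) + n * (E / (4 * n))"
      using V by (simp add: sum.distrib sum.If_cases Ws_def Int_def)
    finally have 1: "3 / 4 * E \<le> (\<Sum>w\<in>Ws. dg w)" using n0 by simp
    have "3 / 8 * E \<le> (\<Sum>w\<in>Ws. dg w / 2)" using 1 by (simp add: sum_divide_distrib[symmetric])
    also have "\<dots> \<le> (\<Sum>w\<in>Ws. \<Sum>u\<in>V. \<Sum>v\<in>V. ch u v w)"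
    proof (rule sum_mono)
      fix w assume w: "w \<in> Ws"
      then have dgw: "E / (4 * n) \<le> dg w" by (simp add: Ws_def)
      have "E / (4 * n) > 0" using E0 n0 by simp
      then have dgp: "dg w > 0" using dgw by linarith
      have "d0 \<le> dg w / 2" using d0E dgw by simp
      then have "dg w / 2 \<le> dg w - d0" by linarith
      also have "\<dots> = (\<Sum>u\<in>V. D u w) * ((dg w - d0) / dg w)" using dgp by (simp add: dg_def[symmetric])
      also have "\<dots> = (\<Sum>u\<in>V. D u w * ((dg w - d0) / dg w))" by (rule sum_distrib_right)
      also have "\<dots> \<le> (\<Sum>u\<in>V. \<Sum>v\<in>V. ch u v w)"
      proof (rule sum_mono)
        fix u assume u: "u \<in> V"
        have "dg w = D u w + (\<Sum>v\<in>V - {u}. D v w)" unfolding dg_def using V u by (intro sum.remove) auto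
        then have "dg w - d0 \<le> (\<Sum>v\<in>V - {u}. D v w)" using Dd[of u w] by linarith
        then have "D u w * ((dg w - d0) / dg w) \<le> D u w * ((\<Sum>v\<in>V - {u}. D v w) / dg w)"
          using D0 dgp by (intro mult_left_mono divide_right_mono) auto
        also have "\<dots> = (\<Sum>v\<in>V - {u}. D u w * D v w / dg w)" by (simp add: sum_distrib_left sum_divide_distrib)
        also have "\<dots> = (\<Sum>v\<in>V. ch u v w)"
          using V u dgw by (intro sum.mono_neutral_cong_left) (auto simp: ch_def)
        finally show "D u w * ((dg w - d0) / dg w) \<le> (\<Sum>v\<in>V. ch u v w)" .
      qed
      finally show "dg w / 2 \<le> (\<Sum>u\<in>V. \<Sum>v\<in>V. ch u v w)" .
    qed
    also have "\<dots> \<le> (\<Sum>w\<in>V. \<Sum>u\<in>V. \<Sum>v\<in>V. ch u v w)"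
      using V chi0 by (intro sum_mono2 sum_nonneg) (auto simp: Ws_def)
    also have "\<dots> = (\<Sum>u\<in>V. \<Sum>v\<in>V. \<psi> u v)"
      unfolding \<psi>_def by (subst sum.swap, rule sum.cong[OF refl], rule sum.swap)
    also have "\<dots> \<le> (\<Sum>u\<in>V. \<Sum>v\<in>V. p' u v + E / (8 * n ^ 2))"
    proof (intro sum_mono)
      fix u v
      have "E / (8 * n ^ 2) \<ge> 0" using E0 by simp
      then show "\<psi> u v \<le> p' u v + E / (8 * n ^ 2)" by (auto simp: p'_def Q_def)
    qed
    also have "\<dots> = T + n * (n * (E / (8 * n ^ 2)))" unfolding T_def by (simp add: sum.distrib V(2))
    also have "\<dots> = T + E / 8" using n0 by (simp add: power2_eq_square)
    finally show ?thesis by simp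
  qed
  then have T0: "T > 0" using E0 by linarith
  have TE: "?h / 16 \<le> T" using T E by linarith
  have psip: "\<psi> u v > 0" if "Q u v" for u v
  proof -
    have "E / (8 * n ^ 2) > 0" using E0 n0 by simp
    then show ?thesis using that unfolding Q_def by linarith
  qed
  have pk: "\<pi> u v * k u v w \<le> ch u v w / T" for u v w
    using psip[of u v] chi0 T0 by (auto simp: \<pi>_def k_def p'_def)
  have chisym: "ch u v w = ch v u w" for u v w by (auto simp: ch_def)
  then have psisym: "\<psi> u v = \<psi> v u" for u v by (simp add: \<psi>_def)
  have pksym: "\<pi> u v * k u v w = \<pi> v u * k v u w" for u v w
    using chisym[of u v w] psisym[of u v] by (simp add: \<pi>_def k_def p'_def Q_def)
  have chile: "ch u v w \<le> D u w * D v w * (16 * n / ?h)" for u v w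
  proof (cases "E / (4 * n) \<le> dg w \<and> u \<noteq> v")
    case True
    have p: "?h / (16 * n) > 0" using h0 n0 by simp
    have "(?h / 4) / (4 * n) \<le> E / (4 * n)" using E n0 by (intro divide_right_mono) auto
    then have "?h / (16 * n) \<le> dg w" using True by simp
    then have "D u w * D v w / dg w \<le> D u w * D v w / (?h / (16 * n))"
      using p D0 by (intro divide_left_mono mult_pos_pos mult_nonneg_nonneg) auto
    then show ?thesis using True by (simp add: ch_def)
  next
    case False
    then show ?thesis using D0 h0 n0 by (auto simp: ch_def)
  qed
  \<comment> \<open>The constant is 16 * 32: the centre has weight at least h / (16 n) and a pair
    satisfying \<open>Q\<close> has weight at least h / (32 n^2), both by E \<ge> h / 4.\<close>
  have kle: "k u v w \<le> D u w * D v w * (512 * n ^ 3 / ?h ^ 2)" for u v w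
  proof (cases "Q u v")
    case True
    have p: "?h / (32 * n ^ 2) > 0" using h0 n0 by simp
    have "(?h / 4) / (8 * n ^ 2) \<le> E / (8 * n ^ 2)" using E n0 by (intro divide_right_mono) auto
    then have le: "?h / (32 * n ^ 2) \<le> \<psi> u v" using True by (simp add: Q_def)
    have "k u v w = ch u v w / \<psi> u v" using True by (simp add: k_def)
    also have "\<dots> \<le> (D u w * D v w * (16 * n / ?h)) / (?h / (32 * n ^ 2))"
      using chile chi0 p le D0 h0 n0 by (intro frac_le mult_nonneg_nonneg) auto
    also have "\<dots> = D u w * D v w * (512 * n ^ 3 / ?h ^ 2)"
      by (simp add: power2_eq_square power3_eq_cube)
    finally show ?thesis .
  next
    case False
    then show ?thesis using D0 h0 n0 by (auto simp: k_def)
  qed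
  have c0: "0 \<le> 512 * n ^ 3 / ?h ^ 2" using n0 by simp
  have marg: "(\<Sum>v\<in>V. \<pi> u v * k u v w) \<le> B * pdeg G u w / ?h" for u w
  proof -
    have "(\<Sum>v\<in>V. \<pi> u v * k u v w) \<le> (\<Sum>v\<in>V. D u w * (D v w / dg w) / T)"
    proof (rule sum_mono)
      fix v
      have "ch u v w \<le> D u w * (D v w / dg w)" using D0 dg0 by (auto simp: ch_def)
      then show "\<pi> u v * k u v w \<le> D u w * (D v w / dg w) / T"
        using pk[of u v w] T0 by (meson divide_right_mono less_imp_le order_trans)
    qed
    also have "\<dots> = D u w * ((\<Sum>v\<in>V. D v w) / dg w) / T"
      by (simp add: sum_divide_distrib sum_distrib_left)
    also have "\<dots> \<le> D u w * 1 / T" unfolding dg_def[symmetric]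
      using D0 T0 by (intro divide_right_mono mult_left_mono) auto
    also have "\<dots> \<le> pdeg G u w / (?h / 16)"
      using Dp D0 T0 TE h0 by (simp del: divide_divide_eq_right) (intro frac_le, auto)
    also have "\<dots> = 16 * pdeg G u w / ?h" by simp
    also have "\<dots> \<le> B * pdeg G u w / ?h"
    proof -
      have "(16 :: real) \<le> 512 ^ 1" by simp
      also have "\<dots> \<le> 512 ^ t" using rt by (intro power_increasing) auto
      finally show ?thesis using B h0 by (intro divide_right_mono mult_right_mono) auto
    qed
    finally show ?thesis .
  qed
  have B512: "512 \<le> B"
  proof -
    have "(512 :: real) ^ 1 \<le> 512 ^ t" using rt by (intro power_increasing) auto
    then show ?thesis using B by simp
  qed
  have ds: "d0 * (512 * n ^ 3 / ?h ^ 2) = 512 * s / ?h"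
    using n0 h0 by (simp add: d0(1) power2_eq_square)
  \<comment> \<open>The three bounds on k come from \<open>kle\<close> by keeping both degrees, one
    of them or neither, and replacing the rest by d0 = h s / n^3. With one degree kept, the factor
    becomes 512 s / h, which is where the choice of d0 originates.\<close>
  have "spread V G r t \<pi> k B (s / ?h) ?h (512 * s / ?h) (d0 * d0 * (512 * n ^ 3 / ?h ^ 2)) (512 * n ^ 3 / ?h ^ 2) (256 * n / ?h ^ 2)"
  proof unfold_locales
    show "(\<Sum>u\<in>V. \<Sum>v\<in>V. \<pi> u v) = 1"
      using T0 unfolding \<pi>_def by (simp add: sum_divide_distrib[symmetric] T_def[symmetric])
    have ksum: "(\<Sum>w\<in>V. k u v w) = (if Q u v then 1 else 0)" for u v
      using psip[of u v] by (cases "Q u v") (simp_all add: k_def sum_divide_distrib[symmetric] \<psi>_def[symmetric])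
    then show "(\<Sum>w\<in>V. k u v w) \<le> 1" for u v by simp
    show "(\<Sum>w\<in>V. k u v w) = 1" if "u \<in> V" "v \<in> V" "\<pi> u v \<noteq> 0" for u v
      using ksum[of u v] that by (auto simp: \<pi>_def p'_def split: if_splits)
    show "u \<noteq> v \<and> pair_edges G u w \<noteq> {} \<and> pair_edges G v w \<noteq> {}" if "k u v w \<noteq> 0" for u v w
    proof -
      have "ch u v w \<noteq> 0" using that by (auto simp: k_def split: if_splits)
      then have "u \<noteq> v" "D u w \<noteq> 0" "D v w \<noteq> 0" by (auto simp: ch_def split: if_splits)
      then show ?thesis by (auto simp: D_def split: if_splits)
    qed
    show "(\<Sum>u\<in>V. \<pi> u v * k u v w) \<le> B * pdeg G v w / ?h" for v w
      using marg[of v w] by (subst pksym)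
    have DD: "D u w * D v w \<le> pdeg G u w * pdeg G v w" for u v w using D0 Dp by (intro mult_mono) auto
    show "\<pi> u v * k u v w \<le> 256 * n / ?h ^ 2 * (pdeg G u w * pdeg G v w)" for u v w
    proof -
      have "\<pi> u v * k u v w \<le> ch u v w / T" by (rule pk)
      also have "\<dots> \<le> (D u w * D v w * (16 * n / ?h)) / (?h / 16)"
        using chile chi0 TE h0 n0 D0 by (intro frac_le mult_nonneg_nonneg) auto
      also have "\<dots> = 256 * n / ?h ^ 2 * (D u w * D v w)" by (simp add: power2_eq_square)
      also have "\<dots> \<le> 256 * n / ?h ^ 2 * (pdeg G u w * pdeg G v w)"
        using DD n0 by (intro mult_left_mono) auto
      finally show ?thesis .
    qed
    show "k u v w \<le> 512 * n ^ 3 / ?h ^ 2 * (pdeg G u w * pdeg G v w)" for u v w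
    proof -
      have "k u v w \<le> 512 * n ^ 3 / ?h ^ 2 * (D u w * D v w)" using kle[of u v w] by (simp only: mult.commute)
      also have "\<dots> \<le> 512 * n ^ 3 / ?h ^ 2 * (pdeg G u w * pdeg G v w)" using DD c0 by (rule mult_left_mono)
      finally show ?thesis .
    qed
    show "k u v w \<le> 512 * s / ?h * pdeg G u w" for u v w
    proof -
      have "D u w * D v w * (512 * n ^ 3 / ?h ^ 2) \<le> pdeg G u w * d0 * (512 * n ^ 3 / ?h ^ 2)"
        using c0 D0 Dp Dd d0 by (intro mult_right_mono mult_mono) auto
      also have "\<dots> = (d0 * (512 * n ^ 3 / ?h ^ 2)) * pdeg G u w" by (simp only: mult_ac)
      finally show ?thesis using kle[of u v w] unfolding ds by linarith
    qed
    show "k u v w \<le> 512 * s / ?h * pdeg G v w" for u v w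
    proof -
      have "D u w * D v w * (512 * n ^ 3 / ?h ^ 2) \<le> d0 * pdeg G v w * (512 * n ^ 3 / ?h ^ 2)"
        using c0 D0 Dp Dd order_trans[OF D0 Dd] by (intro mult_right_mono mult_mono) auto
      also have "\<dots> = (d0 * (512 * n ^ 3 / ?h ^ 2)) * pdeg G v w" by (simp only: mult_ac)
      finally show ?thesis using kle[of u v w] unfolding ds by linarith
    qed
    show "k u v w \<le> d0 * d0 * (512 * n ^ 3 / ?h ^ 2)" for u v w
    proof -
      have "D u w * D v w * (512 * n ^ 3 / ?h ^ 2) \<le> d0 * d0 * (512 * n ^ 3 / ?h ^ 2)"
        using c0 D0 Dd order_trans[OF D0 Dd] by (intro mult_right_mono mult_mono) auto
      then show ?thesis using kle[of u v w] by linarith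
    qed
    \<comment> \<open>Here s^2 must be small compared with n^3, that is \<alpha> < 3/2: no single w
      may be likely, since otherwise t different ones could not be drawn.\<close>
    have "d0 * d0 * (512 * n ^ 3 / ?h ^ 2) = 512 * s ^ 2 / n ^ 3"
      using n0 h0 by (simp add: d0(1) power2_eq_square power3_eq_cube mult_ac)
    moreover have "512 * s ^ 2 / n ^ 3 * real (2 + 2 * r * t) \<le> 512 * s ^ 2 / n ^ 3 * q"
      using n0 by (intro mult_left_mono) (auto simp: q_def)
    moreover have "512 * s ^ 2 / n ^ 3 * q \<le> 1 / 4" using d0(4) n0 by (simp add: field_simps)
    ultimately show "d0 * d0 * (512 * n ^ 3 / ?h ^ 2) * real (2 + 2 * r * t) \<le> 1 / 4" by simp
    show "512 * s / ?h \<le> B * (s / ?h)" using B512 d0 h0 by (simp add: divide_right_mono mult_right_mono)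
    show "256 * n / ?h ^ 2 * (512 * n ^ 3 / ?h ^ 2) ^ (b - 1) \<le> B * (s / ?h) ^ (2 * b - 1) / ?h" if b: "1 \<le> b" "b \<le> t" for b
    proof -
      obtain c where c: "b = Suc c" using b by (cases b) auto
      have "256 * n / ?h ^ 2 * (512 * n ^ 3 / ?h ^ 2) ^ (b - 1) = 256 * 512 ^ c * n ^ (3 * b - 2) / ?h ^ (2 * b)"
      proof -
        have p: "n ^ (3 * b - 2) = n * (n ^ 3) ^ c" "?h ^ (2 * b) = ?h ^ 2 * (?h ^ 2) ^ c" "b - 1 = c"
          by (simp_all add: c power_mult[symmetric] power_add[symmetric])
        show ?thesis unfolding p by (simp add: power_divide power_mult_distrib)
      qed
      also have "\<dots> \<le> B * s ^ (2 * b - 1) / ?h ^ (2 * b)"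
      proof (intro divide_right_mono mult_mono)
        have "256 * 512 ^ c \<le> (512 :: real) ^ b" by (simp add: c)
        also have "\<dots> \<le> 512 ^ t" using b by (intro power_increasing) auto
        finally show "256 * 512 ^ c \<le> B" using B by simp
      qed (use num2[OF b] n0 B512 in auto)
      also have "\<dots> = B * (s / ?h) ^ (2 * b - 1) / ?h"
      proof -
        have "?h ^ (2 * b) = ?h ^ (2 * b - 1) * ?h" by (simp add: c)
        then show ?thesis by (simp add: power_divide)
      qed
      finally show ?thesis .
    qed
  qed (use V G rt p'0 T0 chi0 psi0 marg d0 h0 n0 B512 tdeg[unfolded q_def] in \<open>auto simp: \<pi>_def k_def\<close>)
  then show ?thesis by (rule spread.spread_copiesI) (use H0 G in auto)
qed

section \<open>Elementary counting and the arithmetic of the exponent\<close>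

lemma choose_le_power: "n choose k \<le> n ^ k"
  by (cases "k \<le> n") (auto simp: binomial_le_pow binomial_eq_0 not_le)

lemma finite_r_sets [simp]: "finite (r_sets r n)"
  by (rule finite_subset[of _ "Pow {..<n}"]) (auto simp: r_sets_def)

lemma card_r_sets: "card (r_sets r n) = n choose r"
  unfolding r_sets_def using n_subsets[of "{..<n}" r] by simp

lemma card_triple_edges_le:
  assumes H: "H \<subseteq> r_sets r n" and r: "r \<ge> 3" and ne: "u \<noteq> v" "u \<noteq> w" "v \<noteq> w"
  shows "card {e\<in>pair_edges H u v. w \<in> e} \<le> n ^ (r - 3)"
proof -
  let ?L = "{e\<in>pair_edges H u v. w \<in> e}"
  have L: "e \<subseteq> {..<n}" "card e = r" "{u, v, w} \<subseteq> e" if "e \<in> ?L" for e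
    using that H by (auto simp: pair_edges_def r_sets_def)
  have "card ?L = card ((\<lambda>e. e - {u, v, w}) ` ?L)"
  proof (rule card_image[symmetric], rule inj_onI)
    fix e e' assume e: "e \<in> ?L" "e' \<in> ?L" "e - {u, v, w} = e' - {u, v, w}"
    have "e = (e - {u, v, w}) \<union> {u, v, w}" using L(3)[OF e(1)] by auto
    also have "\<dots> = e'" unfolding e(3) using L(3)[OF e(2)] by auto
    finally show "e = e'" .
  qed
  also have "\<dots> \<le> card {A. A \<subseteq> {..<n} \<and> card A = r - 3}"
  proof (rule card_mono)
    show "(\<lambda>e. e - {u, v, w}) ` ?L \<subseteq> {A. A \<subseteq> {..<n} \<and> card A = r - 3}"
    proof
      fix A assume "A \<in> (\<lambda>e. e - {u, v, w}) ` ?L"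
      then obtain e where e: "e \<in> ?L" "A = e - {u, v, w}" by blast
      have "card {u, v, w} = 3" using ne by simp
      then have "card A = r - 3" using L[OF e(1)] e(2) by (simp add: card_Diff_subset)
      then show "A \<in> {A. A \<subseteq> {..<n} \<and> card A = r - 3}" using L[OF e(1)] e(2) by blast
    qed
  qed simp
  also have "\<dots> = n choose (r - 3)" using n_subsets[of "{..<n}" "r - 3"] by simp
  also have "\<dots> \<le> n ^ (r - 3)" by (rule choose_le_power)
  finally show ?thesis .
qed

lemma eventually_le_powr: "e > 0 \<Longrightarrow> eventually (\<lambda>n. c \<le> real n powr e) sequentially"
  by real_asymp

definition plateau :: "nat \<Rightarrow> real" where
  "plateau t = (3 * real t - 2) / (2 * real t - 1)"

lemma plateau_bounds:
  assumes "t \<ge> 3"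
  shows "4 / 3 \<le> plateau t" "plateau t < 3 / 2" "1 < plateau t"
  using assms by (simp_all add: plateau_def field_simps)

text \<open>(3b - 2) / (2b - 1) increases with b and equals \<open>plateau t\<close> at b = t. This
  is the constraint that determines the exponent.\<close>

lemma plateau_power1:
  assumes t: "t \<ge> 3" and b: "1 \<le> b" "b \<le> t" and n: "n \<ge> 1"
  shows "real n ^ (3 * b - 2) \<le> (real n powr plateau t) ^ (2 * b - 1)"
proof -
  have "(3 * real b - 2) * (2 * real t - 1) \<le> (3 * real t - 2) * (2 * real b - 1)"
    using b by (simp add: algebra_simps)
  then have "3 * real b - 2 \<le> plateau t * (2 * real b - 1)"
    using t by (simp add: plateau_def field_simps)
  then have "real n powr (3 * real b - 2) \<le> real n powr (plateau t * (2 * real b - 1))"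
    using n by (intro powr_mono) auto
  moreover have "real n powr (3 * real b - 2) = real n ^ (3 * b - 2)"
    using n b by (simp add: powr_realpow[symmetric] of_nat_diff)
  moreover have "real n powr (plateau t * (2 * real b - 1)) = (real n powr plateau t) ^ (2 * b - 1)"
    using n b by (simp add: powr_power of_nat_diff mult.commute)
  ultimately show ?thesis by simp
qed

text \<open>The exponents are compared by \<open>(t - 3) * b + 1 \<ge> 0\<close>, which is where \<open>t \<ge> 3\<close> is needed.\<close>

lemma plateau_power2:
  assumes t: "t \<ge> 3" and b: "1 \<le> b" and n: "n \<ge> 1"
  shows "real n ^ (7 * b - 3) \<le> (real n powr plateau t) ^ (5 * b - 2)"
proof -
  have "3 * real b \<le> real t * real b" using t by (intro mult_right_mono) auto
  then have "(7 * real b - 3) * (2 * real t - 1) \<le> (3 * real t - 2) * (5 * real b - 2)"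
    by (simp add: algebra_simps)
  then have "7 * real b - 3 \<le> plateau t * (5 * real b - 2)"
    using t by (simp add: plateau_def field_simps)
  then have "real n powr (7 * real b - 3) \<le> real n powr (plateau t * (5 * real b - 2))"
    using n by (intro powr_mono) auto
  moreover have "real n powr (7 * real b - 3) = real n ^ (7 * b - 3)"
    using n b by (simp add: powr_realpow[symmetric] of_nat_diff)
  moreover have "real n powr (plateau t * (5 * real b - 2)) = (real n powr plateau t) ^ (5 * b - 2)"
    using n b by (simp add: powr_power of_nat_diff mult.commute)
  ultimately show ?thesis by simp
qed

text \<open>After substituting d and cancelling powers of h, the estimate h \<ge> n^(r-1) for the b
  remaining factors h removes r, and n^(7b-3) \<le> s^(5b-2) is left.\<close>

lemma dense_pairs_numeric:
  fixes r t n b :: nat and h s c :: real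
  assumes t: "t \<ge> 3" and r: "r \<ge> 3" and n: "n \<ge> 1" and b: "1 \<le> b" "b \<le> t"
    and s: "s = real n powr plateau t" and h: "real n ^ (r - 1) \<le> h" and c: "c \<ge> 1"
  defines "d \<equiv> h * s / real n ^ 3 / c"
  shows "8 * (real n ^ (r - 3)) ^ b * h ^ (2 * b - 1) \<le> (8 * c ^ (3 * t)) * s ^ (2 * b - 1) * d ^ (3 * b - 1)"
proof -
  have n0: "real n > 0" using n by simp
  have h0: "h > 0" using h n0 by (smt (verit) zero_less_power)
  let ?x = "real n"
  obtain a where a: "b = Suc a" using b by (cases b) auto
  obtain r' where r': "r = r' + 3" using r by (metis add.commute le_Suc_ex)
  have "(?x ^ (r - 3)) ^ b * (?x ^ 3) ^ (3 * b - 1) = (?x ^ (r - 1)) ^ b * ?x ^ (7 * b - 3)"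
  proof -
    have "(r - 3) * b + 3 * (3 * b - 1) = (r - 1) * b + (7 * b - 3)" unfolding a r' by (simp add: algebra_simps)
    then show ?thesis by (simp only: power_mult[symmetric] power_add[symmetric])
  qed
  also have "\<dots> \<le> h ^ b * s ^ (5 * b - 2)"
    unfolding s using h n0 plateau_power2[OF t b(1) n] h0 by (intro mult_mono power_mono) auto
  finally have 1: "(?x ^ (r - 3)) ^ b * (?x ^ 3) ^ (3 * b - 1) \<le> h ^ b * s ^ (5 * b - 2)" .
  have 2: "c ^ (3 * b - 1) \<le> c ^ (3 * t)" using b c by (intro power_increasing) auto
  have "8 * (?x ^ (r - 3)) ^ b * h ^ (2 * b - 1) * (?x ^ 3 * c) ^ (3 * b - 1) =
     8 * h ^ (2 * b - 1) * (c ^ (3 * b - 1) * ((?x ^ (r - 3)) ^ b * (?x ^ 3) ^ (3 * b - 1)))"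
    by (simp add: power_mult_distrib)
  also have "\<dots> \<le> 8 * h ^ (2 * b - 1) * (c ^ (3 * t) * (h ^ b * s ^ (5 * b - 2)))"
    using h0 c n0 by (intro mult_left_mono mult_mono[OF 2 1]) auto
  also have "\<dots> = 8 * c ^ (3 * t) * (h ^ (2 * b - 1) * h ^ b) * s ^ (5 * b - 2)" by simp
  also have "h ^ (2 * b - 1) * h ^ b = h ^ (3 * b - 1)"
    unfolding power_add[symmetric] by (rule arg_cong[where f = "(^) h"]) (simp add: a)
  also have "s ^ (5 * b - 2) = s ^ (2 * b - 1) * s ^ (3 * b - 1)"
    unfolding power_add[symmetric] by (rule arg_cong[where f = "(^) s"]) (simp add: a)
  also have "8 * c ^ (3 * t) * h ^ (3 * b - 1) * (s ^ (2 * b - 1) * s ^ (3 * b - 1))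
      = (8 * c ^ (3 * t) * s ^ (2 * b - 1) * d ^ (3 * b - 1)) * (?x ^ 3 * c) ^ (3 * b - 1)"
  proof -
    have "d * (?x ^ 3 * c) = h * s" using n0 c by (simp add: d_def)
    then have E: "h ^ (3 * b - 1) * s ^ (3 * b - 1) = d ^ (3 * b - 1) * (?x ^ 3 * c) ^ (3 * b - 1)"
      by (simp only: power_mult_distrib[symmetric])
    have "8 * c ^ (3 * t) * h ^ (3 * b - 1) * (s ^ (2 * b - 1) * s ^ (3 * b - 1))
      = 8 * c ^ (3 * t) * s ^ (2 * b - 1) * (h ^ (3 * b - 1) * s ^ (3 * b - 1))" by (simp only: mult_ac)
    then show ?thesis unfolding E by (simp only: mult.assoc)
  qed
  finally show ?thesis by (rule mult_right_le_imp_le) (use n0 c in simp)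
qed

text \<open>Two cleanings serve the two cases. The first makes all degrees of (r-1)-sets large,
  which bounds triple degrees relative to pair degrees even when the latter are small. If few edges
  then contain a pair of degree below \<open>d0\<close>, these are dropped, and the second cleaning
  restores a lower bound \<open>d1\<close> on the pair degrees.\<close>

theorem supersaturation:
  fixes r t :: nat
  assumes r: "r \<ge> 3" and t: "t \<ge> 3"
  obtains K C :: real where "K \<ge> 1" "C > 0"
    "eventually (\<lambda>n. \<forall>H. H \<subseteq> r_sets r n \<longrightarrow> K * real n ^ (r - 1) \<le> card H \<longrightarrow>
       spread_copies H r t C (real n powr plateau t)) sequentially"
proof -
  define q where "q = real (2 + 2 * r * t + r)"
  \<comment> \<open>Chosen so that \<open>full_triple_degree\<close> says exactly that 8 q times a
    triple degree is at most the pair degree.\<close>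
  define Kf where "Kf = 1 + 8 * r * q"
  \<comment> \<open>The second cleaning is done at degree d0 / c1. The number of pairs is at most h
    r^2 / d0, so the cost is at most h / 8.\<close>
  define c1 where "c1 = 8 * real r ^ 2"
  define B where "B = (512 :: real) ^ t + 8 * real r + 8 * c1 ^ (3 * t)"
  let ?C = "2 ^ (2 * t) * real (2 * t) ^ (2 * t) * (r ^ (t + 3) * B ^ (t + 1))"
  have q1: "q \<ge> 1" using r by (simp add: q_def)
  have Kf1: "Kf \<ge> 1" using q1 by (simp add: Kf_def)
  have c1: "c1 \<ge> 1"
  proof -
    have "(1 :: real) \<le> real r ^ 2" using r by (intro one_le_power) auto
    then show ?thesis by (simp add: c1_def)
  qed
  have c1p: "1 \<le> c1 ^ j" for j using c1 by (rule one_le_power)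
  have B0: "B > 0" unfolding B_def using c1 by (auto intro!: add_pos_nonneg)
  have "0 < (512 :: real) ^ t" by simp
  then have B: "512 ^ t \<le> B" "8 * r \<le> B" "8 * c1 ^ (3 * t) \<le> B" "B > 0"
    using c1p[of "3 * t"] B0 unfolding B_def by linarith+
  let ?al = "plateau t"
  note al = plateau_bounds[OF t]
  \<comment> \<open>Quantitative forms of \<alpha> < 2, \<alpha> < 3/2 and \<alpha> > 1. The first
    two are used for low-degree pairs, the third to make pair degrees dominate triple degrees in the
    dense case.\<close>
  have ev: "eventually (\<lambda>n. 1 \<le> n \<and> 32 \<le> real n powr (2 - ?al) \<and> 2048 * q \<le> real n powr (3 - 2 * ?al) \<and>
      8 * q * c1 \<le> real n powr (?al - 1)) sequentially"
    using al by (intro eventually_conj eventually_ge_at_top eventually_le_powr) auto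
  have "eventually (\<lambda>n. \<forall>H. H \<subseteq> r_sets r n \<longrightarrow> 2 * Kf * real n ^ (r - 1) \<le> card H \<longrightarrow>
       spread_copies H r t ?C (real n powr ?al)) sequentially"
    using ev
  proof (eventually_elim, intro allI impI)
    fix n :: nat and H
    assume n: "1 \<le> n \<and> 32 \<le> real n powr (2 - ?al) \<and> 2048 * q \<le> real n powr (3 - 2 * ?al) \<and>
      8 * q * c1 \<le> real n powr (?al - 1)"
    assume H: "H \<subseteq> r_sets r n" "2 * Kf * real n ^ (r - 1) \<le> card H"
    define s where "s = real n powr ?al"
    let ?x = "real n" let ?h = "real (card H)"
    have x0: "?x > 0" using n by simp
    have finH: "finite H" by (rule finite_subset[OF H(1) finite_r_sets])
    have s0: "s > 0" using x0 by (simp add: s_def)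
    have n2: "32 * s \<le> ?x ^ 2"
    proof -
      have "32 * s \<le> ?x powr (2 - ?al) * s" using n s0 by (intro mult_right_mono) auto
      also have "\<dots> = ?x powr 2" using x0 by (simp add: s_def powr_add[symmetric])
      finally show ?thesis using x0 by simp
    qed
    have n3: "2048 * q * s ^ 2 \<le> ?x ^ 3"
    proof -
      have "2048 * q * s ^ 2 \<le> ?x powr (3 - 2 * ?al) * s ^ 2" using n s0 by (intro mult_right_mono) auto
      also have "\<dots> = ?x powr 3" using x0 by (simp add: s_def powr_power powr_add[symmetric])
      finally show ?thesis using x0 by simp
    qed
    have n1: "8 * q * c1 * ?x \<le> s"
    proof -
      have "8 * q * c1 * ?x \<le> ?x powr (?al - 1) * ?x powr 1" using n x0 by (intro mult_mono) auto
      also have "\<dots> = s" using x0 by (simp only: s_def powr_add[symmetric]) simp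
      finally show ?thesis .
    qed
    have hn: "?x ^ (r - 1) \<le> ?h"
    proof -
      have "1 * ?x ^ (r - 1) \<le> 2 * Kf * ?x ^ (r - 1)" using Kf1 by (intro mult_right_mono) auto
      then show ?thesis using H(2) by linarith
    qed
    have h0: "?h > 0" using hn x0 by (smt (verit) zero_less_power)
    obtain H' where H': "H' \<subseteq> H" "real (card H') \<ge> card H - Kf * card (\<Union>e\<in>H. {A. A \<subseteq> e \<and> card A = r - 1})"
      "\<forall>e\<in>H'. \<forall>A\<in>{A. A \<subseteq> e \<and> card A = r - 1}. Kf < card {e'\<in>H'. A \<in> {A. A \<subseteq> e' \<and> card A = r - 1}}"
    proof -
      have "finite {A. A \<subseteq> e \<and> card A = r - 1}" if "e \<in> H" for e
      proof -
        have "e \<subseteq> {..<n}" using that H(1) by (auto simp: r_sets_def)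
        then have "finite e" by (rule finite_subset) simp
        then show ?thesis by simp
      qed
      then show ?thesis
        using full_subfamily[of H "\<lambda>e. {A. A \<subseteq> e \<and> card A = r - 1}" Kf] finH Kf1 that by auto
    qed
    have finH': "finite H'" using H'(1) finH finite_subset by blast
    have Hr: "e \<subseteq> {..<n} \<and> card e = r" if "e \<in> H'" for e using that H'(1) H(1) by (auto simp: r_sets_def)
    have Hf: "finite e" if "e \<in> H'" for e using Hr[OF that] finite_subset by blast
    have half: "?h \<le> 2 * card H'"
    proof -
      have "card (\<Union>e\<in>H. {A. A \<subseteq> e \<and> card A = r - 1}) \<le> card {A. A \<subseteq> {..<n} \<and> card A = r - 1}"
        using H(1) by (intro card_mono) (auto simp: r_sets_def)
      also have "\<dots> = n choose (r - 1)" using n_subsets[of "{..<n}" "r - 1"] by simp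
      also have "\<dots> \<le> n ^ (r - 1)" by (rule choose_le_power)
      finally have "real (card (\<Union>e\<in>H. {A. A \<subseteq> e \<and> card A = r - 1})) \<le> ?x ^ (r - 1)"
        using of_nat_mono by fastforce
      then have "Kf * card (\<Union>e\<in>H. {A. A \<subseteq> e \<and> card A = r - 1}) \<le> Kf * ?x ^ (r - 1)"
        using Kf1 by (intro mult_left_mono) auto
      then show ?thesis using H(2) H'(2) by linarith
    qed
    have td: "8 * q * card {e\<in>pair_edges H' u w. z \<in> e} \<le> pdeg H' u w" if "z \<noteq> u" "z \<noteq> w" for u w z
    proof -
      have "(Kf - 1) * card {e\<in>pair_edges H' u w. z \<in> e} \<le> r * pdeg H' u w"
      proof (rule full_triple_degree[OF finH' _ _ that])
        fix e A assume e: "e \<in> H'" "A \<subseteq> e" "card A = r - 1"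
        then have "Kf < card {e'\<in>H'. A \<in> {A. A \<subseteq> e' \<and> card A = r - 1}}" using H'(3) by blast
        then show "Kf < card {e'\<in>H'. A \<subseteq> e'}" using e(3) by simp
      qed (use Hr Hf in auto)
      then have "r * (8 * q * card {e\<in>pair_edges H' u w. z \<in> e}) \<le> r * pdeg H' u w"
        by (simp add: Kf_def mult_ac)
      then show ?thesis using r by (simp only: mult_le_cancel_left_pos)
    qed
    define d0 where "d0 = ?h * s / ?x ^ 3"
    have d00: "d0 > 0" using h0 s0 x0 by (simp add: d0_def)
    define L where "L = {e\<in>H'. \<exists>u\<in>e. \<exists>w\<in>e. u \<noteq> w \<and> pdeg H' u w < d0}"
    show "spread_copies H r t ?C (?x powr ?al)"
    proof (cases "card H \<le> 4 * card L")
      case True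
      show ?thesis unfolding s_def[symmetric]
      proof (rule spread_copies_sparse_pairs[where V = "{..<n}" and n = ?x and G = H' and ?d0.0 = d0])
        show "card H \<le> 4 * card {e\<in>H'. \<exists>u\<in>e. \<exists>w\<in>e. u \<noteq> w \<and> pdeg H' u w < d0}" using True by (simp add: L_def)
        show "8 * real (2 + 2 * r * t + r) * card {e\<in>pair_edges H' u w. z \<in> e} \<le> pdeg H' u w"
          if "z \<noteq> u" "z \<noteq> w" for u w z using td[OF that] by (simp only: q_def)
        show "2048 * real (2 + 2 * r * t + r) * s ^ 2 \<le> ?x ^ 3" using n3 by (simp only: q_def)
        show "?x ^ (3 * b - 2) \<le> s ^ (2 * b - 1)" if "1 \<le> b" "b \<le> t" for b
          unfolding s_def using t that n by (intro plateau_power1) auto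
      qed (use finH H'(1) Hr r t h0 d0_def s0 n2 B in auto)
    next
      case False
      define HB where "HB = H' - L"
      have LH: "L \<subseteq> H'" by (auto simp: L_def)
      have HB: "?h \<le> 4 * card HB"
      proof -
        have "card HB = card H' - card L" unfolding HB_def using LH finH' finite_subset by (intro card_Diff_subset) auto
        moreover have "card L \<le> card H'" using LH finH' by (rule card_mono[rotated])
        ultimately show ?thesis using half False by linarith
      qed
      define d1 where "d1 = d0 / c1"
      have d10: "d1 > 0" using d00 c1 by (simp add: d1_def)
      let ?U = "\<Union>e\<in>HB. {A. A \<subseteq> e \<and> card A = 2}"
      obtain G where G: "G \<subseteq> HB" "real (card G) \<ge> card HB - d1 * card ?U"
        "\<forall>e\<in>G. \<forall>A\<in>{A. A \<subseteq> e \<and> card A = 2}. d1 < card {e'\<in>G. A \<in> {A. A \<subseteq> e' \<and> card A = 2}}"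
      proof -
        have "finite HB" using finH' by (simp add: HB_def)
        moreover have "finite {A. A \<subseteq> e \<and> card A = 2}" if "e \<in> HB" for e
          using Hf[of e] that by (simp add: HB_def)
        ultimately show ?thesis using full_subfamily[of HB "\<lambda>e. {A. A \<subseteq> e \<and> card A = 2}" d1] d10 that by auto
      qed
      have finU: "finite ?U" using finH' Hf by (auto simp: HB_def)
      \<comment> \<open>Pairs inside edges of \<open>HB\<close> have degree at least
        \<open>d0\<close> in \<open>H'\<close>, because the edges with a pair of smaller degree form
        \<open>L\<close>. Double counting in \<open>H'\<close> then bounds the number of such
        pairs.\<close>
      have "card ?U * d0 = (\<Sum>A\<in>?U. d0)" by simp
      also have "\<dots> \<le> (\<Sum>A\<in>?U. real (card {e\<in>H'. A \<subseteq> e}))"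
      proof (rule sum_mono)
        fix A assume "A \<in> ?U"
        then obtain e where e: "e \<in> HB" "A \<subseteq> e" "card A = 2" by blast
        then obtain u w where uw: "A = {u, w}" "u \<noteq> w" by (auto simp: card_2_iff)
        have "\<not> pdeg H' u w < d0" using e uw by (auto simp: HB_def L_def)
        moreover have "{e\<in>H'. A \<subseteq> e} = pair_edges H' u w" by (auto simp: uw pair_edges_def)
        ultimately show "d0 \<le> card {e\<in>H'. A \<subseteq> e}" by simp
      qed
      also have "\<dots> = real (\<Sum>A\<in>?U. card {e\<in>H'. A \<subseteq> e})" by simp
      also have "(\<Sum>A\<in>?U. card {e\<in>H'. A \<subseteq> e}) = (\<Sum>e\<in>H'. card {A\<in>?U. A \<subseteq> e})"
        using finU finH' by (intro sum_multicount_gen) auto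
      also have "real \<dots> \<le> real (\<Sum>e\<in>H'. r ^ 2)"
      proof (intro of_nat_mono sum_mono)
        fix e assume e: "e \<in> H'"
        have "card {A\<in>?U. A \<subseteq> e} \<le> card {A. A \<subseteq> e \<and> card A = 2}"
          using Hf[OF e] by (intro card_mono) auto
        also have "\<dots> = r choose 2" using n_subsets[OF Hf[OF e], of 2] Hr[OF e] by simp
        also have "\<dots> \<le> r ^ 2" by (rule choose_le_power)
        finally show "card {A\<in>?U. A \<subseteq> e} \<le> r ^ 2" .
      qed
      also have "\<dots> = card H' * real r ^ 2" by simp
      also have "\<dots> \<le> ?h * real r ^ 2" using H'(1) finH by (intro mult_right_mono of_nat_mono card_mono) auto
      finally have Ud: "card ?U * d0 \<le> ?h * real r ^ 2" .
      have "d1 * card ?U = (card ?U * d0) / c1" by (simp add: d1_def)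
      also have "\<dots> \<le> ?h * real r ^ 2 / c1" using Ud c1 by (intro divide_right_mono) auto
      also have "\<dots> = ?h / 8" using r by (simp add: c1_def)
      finally have big: "?h \<le> 8 * card G" using G(2) HB by linarith
      have GH: "G \<subseteq> H'" "G \<subseteq> H" using G(1) H'(1) by (auto simp: HB_def)
      have mB: "8 * (real n ^ (r - 3)) ^ b * ?h ^ (2 * b - 1) \<le> B * s ^ (2 * b - 1) * d1 ^ (3 * b - 1)"
        if b: "1 \<le> b" "b \<le> t" for b
      proof -
        have "8 * (real n ^ (r - 3)) ^ b * ?h ^ (2 * b - 1) \<le> (8 * c1 ^ (3 * t)) * s ^ (2 * b - 1) * d1 ^ (3 * b - 1)"
          unfolding d1_def d0_def using n by (intro dense_pairs_numeric t r b s_def hn c1) auto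
        also have "\<dots> \<le> B * s ^ (2 * b - 1) * d1 ^ (3 * b - 1)"
          using B s0 d10 by (intro mult_right_mono) auto
        finally show ?thesis .
      qed
      show ?thesis unfolding s_def[symmetric]
      proof (rule spread_copies_dense_pairs[where V = "{..<n}" and m = "?x ^ (r - 3)" and G = G and d = d1])
        show "card H \<le> 8 * card G" using big by linarith
        show "e \<subseteq> {..<n} \<and> card e = r" if "e \<in> G" for e using Hr that GH by blast
        show "d1 \<le> pdeg G u w" if "e \<in> G" "u \<in> e" "w \<in> e" "u \<noteq> w" for e u w
        proof -
          have "{u, w} \<in> {A. A \<subseteq> e \<and> card A = 2}" using that by simp
          then have "d1 < card {e'\<in>G. {u, w} \<in> {A. A \<subseteq> e' \<and> card A = 2}}" using G(3) that(1) by blast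
          also have "{e'\<in>G. {u, w} \<in> {A. A \<subseteq> e' \<and> card A = 2}} = pair_edges G u w"
            using that by (auto simp: pair_edges_def)
          finally show ?thesis by simp
        qed
        show "real (card {e\<in>pair_edges G u v. w \<in> e}) \<le> ?x ^ (r - 3)" if "u \<noteq> v" "u \<noteq> w" "v \<noteq> w" for u v w
          using card_triple_edges_le[OF _ r that, of G n] GH H(1) by (metis of_nat_le_iff of_nat_power subset_trans)
        \<comment> \<open>\<open>d1\<close> is of order at least n^(r-4) s, and s exceeds any
          constant multiple of n.\<close>
        show "8 * real (2 + 2 * r * t + r) * ?x ^ (r - 3) \<le> d1"
        proof -
          have "8 * q * ?x ^ (r - 3) * (?x ^ 3 * c1) = (8 * q * c1 * ?x) * ?x ^ (r - 1)"
          proof -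
            have "?x ^ (r - 3) * ?x ^ 3 = ?x ^ r" using r by (simp add: power_add[symmetric])
            moreover have "?x * ?x ^ (r - 1) = ?x ^ r" using r by (cases r) auto
            ultimately show ?thesis by (simp add: mult_ac)
          qed
          also have "\<dots> \<le> s * ?h" using n1 hn s0 x0 by (intro mult_mono) auto
          also have "\<dots> = d1 * (?x ^ 3 * c1)" using x0 c1 by (simp add: d1_def d0_def)
          finally show ?thesis unfolding q_def[symmetric] using x0 c1 by (simp add: mult_le_cancel_right)
        qed
        show "?x ^ (r - 3) * ?h \<le> B * s * d1 ^ 2" 
        proof -
          have "8 * (?x ^ (r - 3) * ?h) \<le> B * s * d1 ^ 2" using mB[of 1] t by simp
          moreover have "0 \<le> ?x ^ (r - 3) * ?h" by simp
          ultimately show ?thesis by linarith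
        qed
        show "8 * (?x ^ (r - 3)) ^ b * real (card H ^ (2 * b - 1)) \<le> B * s ^ (2 * b - 1) * d1 ^ (3 * b - 1)"
          if "1 \<le> b" "b \<le> t" for b using mB[OF that] by simp
      qed (use finH GH Hr r t h0 d10 s0 x0 B in auto)
    qed
  qed
  moreover have "2 * Kf \<ge> 1" using Kf1 by simp
  moreover have "?C > 0" using t r B by simp
  ultimately show ?thesis using that by blast
qed

section \<open>Containers for hypergraphs free of the target\<close>

lemma has_containers_subset:
  assumes "has_containers X x Q P" "X \<subseteq> V"
  shows "has_containers V x Q (\<lambda>I. I \<subseteq> X \<and> P I)"
proof -
  obtain c where c: "finite c" "real (card c) \<le> Q" "\<forall>C\<in>c. C \<subseteq> X \<and> real (card C) \<le> x"
    "\<forall>I. I \<subseteq> X \<longrightarrow> P I \<longrightarrow> (\<exists>C\<in>c. I \<subseteq> C)"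
    using assms(1) unfolding has_containers_def by blast
  have "\<forall>C\<in>c. C \<subseteq> V \<and> real (card C) \<le> x" using c(3) assms(2) by blast
  moreover have "\<exists>C\<in>c. I \<subseteq> C" if "I \<subseteq> X \<and> P I" for I using c(4) that by blast
  ultimately show ?thesis unfolding has_containers_def using c(1,2) by (intro exI[of _ c]) simp
qed

text \<open>Every container that is still larger than A is refined by \<open>step\<close>. After j
  rounds the size bound has been multiplied by (1 - \<delta>)^j, and each round multiplies the
  number of containers by at most Q.\<close>

lemma has_containers_iterate:
  fixes A \<delta> Q :: real
  assumes U: "finite U" and Q: "Q \<ge> 1" and \<delta>: "\<delta> < 1"
    and step: "\<And>V. V \<subseteq> U \<Longrightarrow> A < card V \<Longrightarrow> has_containers V ((1 - \<delta>) * card V) Q P"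
  shows "V \<subseteq> U \<Longrightarrow> card V * (1 - \<delta>) ^ j \<le> A \<Longrightarrow> has_containers V A (Q ^ j) P"
proof (induction j arbitrary: V)
  case 0
  then show ?case using U finite_subset by (intro has_containers_single[of V V]) auto
next
  case (Suc j)
  show ?case
  proof (cases "card V \<le> A")
    case True
    then show ?thesis using U Q Suc.prems finite_subset
      by (intro has_containers_single[of V V]) (auto intro: one_le_power simp del: power_Suc)
  next
    case False
    then have "has_containers V ((1 - \<delta>) * card V) Q P" using Suc.prems by (intro step) auto
    then obtain c where c: "finite c" "real (card c) \<le> Q" "\<forall>C\<in>c. C \<subseteq> V \<and> real (card C) \<le> (1 - \<delta>) * card V"
      "\<forall>I. I \<subseteq> V \<longrightarrow> P I \<longrightarrow> (\<exists>C\<in>c. I \<subseteq> C)"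
      unfolding has_containers_def by blast
    have Q0: "0 \<le> Q ^ j" using Q by simp
    have hc: "has_containers V A (real (card c) * Q ^ j) P"
    proof (rule has_containers_Union[OF c(1) _ Q0])
      fix X assume X: "X \<in> c"
      then have X': "X \<subseteq> V" "real (card X) \<le> (1 - \<delta>) * card V" using c(3) by auto
      have "card X * (1 - \<delta>) ^ j \<le> ((1 - \<delta>) * card V) * (1 - \<delta>) ^ j"
        using X' \<delta> by (intro mult_right_mono) auto
      also have "\<dots> \<le> A" using Suc.prems(2) by (simp add: mult_ac)
      finally have "has_containers X A (Q ^ j) P" using X' Suc.prems(1) by (intro Suc.IH) auto
      then show "has_containers V A (Q ^ j) (\<lambda>I. I \<subseteq> X \<and> P I)" using X'(1) by (rule has_containers_subset)
    next
      fix I assume "I \<subseteq> V" "P I"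
      then show "\<exists>X\<in>c. I \<subseteq> X \<and> P I" using c(4) by blast
    qed
    have le: "real (card c) * Q ^ j \<le> Q ^ Suc j" using c(2) Q0 by (simp add: mult_right_mono)
    show ?thesis by (rule has_containers_mono[OF hc order_refl le])
  qed
qed

definition free :: "nat \<Rightarrow> nat \<Rightarrow> nat \<Rightarrow> nat set set \<Rightarrow> bool" where
  "free r t n I \<longleftrightarrow> \<not> contains_copy (Hypergraph {..<n} I) (expansion r (complete_bipartite 2 t))"

text \<open>With \<tau> = s / |H|, the number \<tau> |H| of guessed vertices is s whatever the size
  of \<open>H\<close>, so all rounds of the iteration cost about the same.\<close>

lemma spread_copies_containers:
  fixes C :: real
  assumes C: "C > 0" and t: "t \<ge> 1"
  obtains \<delta> :: real where "\<delta> > 0" "\<delta> < 1"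
    "\<forall>n H s. H \<subseteq> r_sets r n \<longrightarrow> H \<noteq> {} \<longrightarrow> spread_copies H r t C s \<longrightarrow> s \<ge> 1 \<longrightarrow>
      has_containers H ((1 - \<delta>) * card H) ((real (card H) + 1) ^ (2 * t * (nat \<lceil>s\<rceil> + 1))) (free r t n)"
proof -
  \<comment> \<open>The factor 2^t compensates for a total mass that may be as small as
    2^-t.\<close>
  define \<beta> where "\<beta> = 1 + C * 2 ^ t"
  have \<beta>: "\<beta> \<ge> 1" "C * 2 ^ t \<le> \<beta>" using C by (simp_all add: \<beta>_def)
  have t2: "2 * t \<ge> 1" using t by simp
  from hypergraph_containers[OF t2 \<beta>(1), where 'a = "nat set"] obtain \<delta>0 :: real where \<delta>0: "\<delta>0 > 0"
    and cont: "\<forall>(V :: nat set set) w (\<tau>::real). finite V \<longrightarrow> V \<noteq> {} \<longrightarrow> \<tau> > 0 \<longrightarrow> \<tau> * card V \<ge> 1 \<longrightarrow>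
     uniform_weight V (2 * t) w \<longrightarrow> wdeg V w {} > 0 \<longrightarrow>
     (\<forall>\<sigma>. \<sigma> \<subseteq> V \<longrightarrow> \<sigma> \<noteq> {} \<longrightarrow> wdeg V w \<sigma> \<le> \<beta> * wdeg V w {} * \<tau> ^ (card \<sigma> - 1) / card V) \<longrightarrow>
     has_containers V ((1 - \<delta>0) * card V) ((real (card V) + 1) ^ (2 * t * (nat \<lceil>\<tau> * card V\<rceil> + 1))) (weight_free w)"
    by (elim exE conjE)
  \<comment> \<open>The cap 1/2 keeps 1 - \<delta> positive, so that the number of rounds can be
    computed from its logarithm.\<close>
  define \<delta> where "\<delta> = min \<delta>0 (1 / 2)"
  show ?thesis
  proof (rule that[of \<delta>], goal_cases)
    case 3
    show ?case
    proof (intro allI impI)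
      fix n H s assume H: "H \<subseteq> r_sets r n" "H \<noteq> {}" and sp: "spread_copies H r t C s" and s: "s \<ge> 1"
      have fin: "finite H" by (rule finite_subset[OF H(1) finite_r_sets])
      then have N: "real (card H) > 0" using H by (simp add: card_gt_0_iff)
      obtain W where W: "uniform_weight H (2 * t) W" "(1 / 2) ^ t \<le> wdeg H W {}"
        "\<forall>\<sigma>. \<sigma> \<subseteq> H \<longrightarrow> \<sigma> \<noteq> {} \<longrightarrow> wdeg H W \<sigma> \<le> C * (s / card H) ^ (card \<sigma> - 1) / card H"
        "\<forall>S K. W S \<noteq> 0 \<longrightarrow> S \<subseteq> edges K \<longrightarrow> (\<forall>e\<in>S. e \<subseteq> verts K) \<longrightarrow>
           contains_copy K (expansion r (complete_bipartite 2 t))"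
        using sp unfolding spread_copies_def by blast
      have M: "wdeg H W {} > 0" using W(2) by (smt (verit) zero_less_power zero_less_divide_1_iff)
      have "C \<le> \<beta> * wdeg H W {}"
      proof -
        have "C = C * 2 ^ t * (1 / 2) ^ t" by (simp add: power_one_over)
        also have "\<dots> \<le> \<beta> * wdeg H W {}" using \<beta> W(2) C by (intro mult_mono) auto
        finally show ?thesis .
      qed
      then have deg: "wdeg H W \<sigma> \<le> \<beta> * wdeg H W {} * (s / card H) ^ (card \<sigma> - 1) / card H" if "\<sigma> \<subseteq> H" "\<sigma> \<noteq> {}" for \<sigma>
        using W(3) that N s by (smt (verit) divide_right_mono mult_right_mono zero_le_power divide_nonneg_pos)
      have sN: "s / card H * card H = s" using N by simp
      have hc: "has_containers H ((1 - \<delta>0) * card H) ((real (card H) + 1) ^ (2 * t * (nat \<lceil>s\<rceil> + 1))) (weight_free W)"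
        using cont[rule_format, of H "s / card H" W, unfolded sN] fin H(2) N s W(1) M deg by simp
      show "has_containers H ((1 - \<delta>) * card H) ((real (card H) + 1) ^ (2 * t * (nat \<lceil>s\<rceil> + 1))) (free r t n)"
      proof (rule has_containers_mono[OF hc])
        show "(1 - \<delta>0) * card H \<le> (1 - \<delta>) * card H" by (intro mult_right_mono) (auto simp: \<delta>_def)
        fix I assume I: "I \<subseteq> H" "free r t n I"
        show "weight_free W I" unfolding weight_free_def
        proof (intro allI impI)
          fix S assume S: "S \<subseteq> I"
          show "W S = 0"
          proof (rule ccontr)
            assume nz: "W S \<noteq> 0"
            have "S \<subseteq> r_sets r n" using S I(1) H(1) by order
            then have "\<forall>e\<in>S. e \<subseteq> {..<n}" unfolding r_sets_def by blast
            then have "contains_copy (Hypergraph {..<n} I) (expansion r (complete_bipartite 2 t))"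
              using W(4)[rule_format, OF nz, of "Hypergraph {..<n} I"] S by simp
            then show False using I(2) by (simp add: free_def)
          qed
        qed
      qed simp
    qed
  qed (use \<delta>0 in \<open>auto simp: \<delta>_def\<close>)
qed

text \<open>The containers must shrink from at most n^r to K n^(r-1) sets, which takes O(ln n)
  rounds. A round guesses O(s) edges out of at most n^r, a factor exp(O(s ln n)); hence the square
  of the logarithm.\<close>

theorem free_containers:
  fixes r t :: nat
  assumes r: "r \<ge> 3" and t: "t \<ge> 3"
  obtains K C :: real where "K > 0" "C > 0"
    "eventually (\<lambda>n. has_containers (r_sets r n) (K * real n ^ (r - 1))
       (exp (C * real n powr plateau t * ln (real n) ^ 2)) (free r t n)) sequentially"
proof -
  obtain K C0 :: real where K: "K \<ge> 1" and C0: "C0 > 0"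
    and sup: "eventually (\<lambda>n. \<forall>H. H \<subseteq> r_sets r n \<longrightarrow> K * real n ^ (r - 1) \<le> card H \<longrightarrow>
       spread_copies H r t C0 (real n powr plateau t)) sequentially"
    by (rule supersaturation[OF r t])
  have t1: "t \<ge> 1" using t by simp
  obtain \<delta> :: real where \<delta>: "\<delta> > 0" "\<delta> < 1"
    and cont: "\<forall>n H s. H \<subseteq> r_sets r n \<longrightarrow> H \<noteq> {} \<longrightarrow> spread_copies H r t C0 s \<longrightarrow> s \<ge> 1 \<longrightarrow>
      has_containers H ((1 - \<delta>) * card H) ((real (card H) + 1) ^ (2 * t * (nat \<lceil>s\<rceil> + 1))) (free r t n)"
    by (rule spread_copies_containers[OF C0 t1, where r = r])
  define l where "l = - ln (1 - \<delta>)"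
  have l: "l > 0" using \<delta> by (simp add: l_def)
  define L where "L = 1 / l + 1"
  have L: "L > 0" using l by (simp add: L_def add_pos_pos)
  define C where "C = L * (6 * t) * (r + 1)"
  have "eventually (\<lambda>n. has_containers (r_sets r n) (K * real n ^ (r - 1))
       (exp (C * real n powr plateau t * ln (real n) ^ 2)) (free r t n)) sequentially"
    using sup eventually_ge_at_top[of 3]
  proof eventually_elim
    fix n :: nat
    assume sp: "\<forall>H. H \<subseteq> r_sets r n \<longrightarrow> K * real n ^ (r - 1) \<le> card H \<longrightarrow>
       spread_copies H r t C0 (real n powr plateau t)" and n: "3 \<le> n"
    let ?x = "real n" let ?A = "K * ?x ^ (r - 1)"
    define s where "s = ?x powr plateau t"
    define Q where "Q = (?x ^ r + 1) ^ (2 * t * (nat \<lceil>s\<rceil> + 1))"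
    define j where "j = nat \<lceil>ln ?x / l\<rceil>"
    have s1: "s \<ge> 1" unfolding s_def using n plateau_bounds[OF t] by (intro ge_one_powr_ge_zero) auto
    have ln1: "ln ?x \<ge> 1"
    proof -
      have "exp 1 \<le> ?x" using n exp_le by linarith
      then show ?thesis using n by (simp add: ln_ge_iff)
    qed
    have cr: "real (card H) \<le> ?x ^ r" if "H \<subseteq> r_sets r n" for H
    proof -
      have "card H \<le> card (r_sets r n)" using that by (intro card_mono) auto
      also have "\<dots> \<le> n ^ r" unfolding card_r_sets by (rule choose_le_power)
      finally show ?thesis using of_nat_mono by fastforce
    qed
    have Q1: "Q \<ge> 1" unfolding Q_def by (intro one_le_power) simp
    have hc: "has_containers (r_sets r n) ?A (Q ^ j) (free r t n)"
    proof (rule has_containers_iterate[where U = "r_sets r n" and \<delta> = \<delta>])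
      fix V assume V: "V \<subseteq> r_sets r n" "?A < card V"
      have "0 \<le> ?A" using K by simp
      then have "V \<noteq> {}" using V(2) by auto
      then have hc: "has_containers V ((1 - \<delta>) * card V) ((real (card V) + 1) ^ (2 * t * (nat \<lceil>s\<rceil> + 1))) (free r t n)"
        using V sp s1 unfolding s_def[symmetric] by (intro cont[rule_format]) auto
      have le: "(real (card V) + 1) ^ (2 * t * (nat \<lceil>s\<rceil> + 1)) \<le> Q"
        unfolding Q_def using cr[OF V(1)] by (intro power_mono) auto
      show "has_containers V ((1 - \<delta>) * card V) Q (free r t n)"
        by (rule has_containers_mono[OF hc order_refl le])
    next
      have "ln ?x / l \<le> j" unfolding j_def by linarith
      then have "ln ?x \<le> j * l" using l by (simp add: field_simps)
      have "(1 - \<delta>) ^ j = exp (ln (1 - \<delta>)) ^ j" using \<delta> by simp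
      also have "\<dots> = exp (- (j * l))" by (simp only: exp_of_nat_mult[symmetric] l_def) simp
      also have "\<dots> \<le> exp (- ln ?x)" using \<open>ln ?x \<le> j * l\<close> by simp
      also have "\<dots> = 1 / ?x" using n by (simp add: exp_minus inverse_eq_divide)
      finally have "(1 - \<delta>) ^ j \<le> 1 / ?x" .
      then have "card (r_sets r n) * (1 - \<delta>) ^ j \<le> ?x ^ r * (1 / ?x)"
        using cr[OF order_refl] \<delta> by (intro mult_mono) auto
      also have "\<dots> = ?x ^ (r - 1)" using n r by (cases r) auto
      also have "\<dots> \<le> ?A" using K n by simp
      finally show "card (r_sets r n) * (1 - \<delta>) ^ j \<le> ?A" .
    qed (use Q1 \<delta> in auto)
    have le: "Q ^ j \<le> exp (C * s * ln ?x ^ 2)"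
    proof -
      have x2: "?x ^ r + 1 \<le> ?x ^ (r + 1)"
      proof -
        have "1 \<le> ?x ^ r" using n by (intro one_le_power) auto
        then have "?x ^ r + 1 \<le> 2 * ?x ^ r" by simp
        also have "\<dots> \<le> ?x * ?x ^ r" using n by (intro mult_right_mono) auto
        finally show ?thesis by simp
      qed
      have "real j \<le> ln ?x / l + 1" using l ln1 unfolding j_def by (simp add: of_nat_nat)
      also have "\<dots> \<le> L * ln ?x" using ln1 by (simp add: L_def algebra_simps)
      finally have jL: "real j \<le> L * ln ?x" .
      have s3: "real (nat \<lceil>s\<rceil> + 1) \<le> 3 * s" using s1 by linarith
      have "Q ^ j = (?x ^ r + 1) ^ (2 * t * (nat \<lceil>s\<rceil> + 1) * j)" by (simp add: Q_def power_mult[symmetric])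
      also have "\<dots> \<le> (?x ^ (r + 1)) ^ (2 * t * (nat \<lceil>s\<rceil> + 1) * j)" using x2 by (intro power_mono) auto
      also have "\<dots> = exp (ln ?x) ^ ((r + 1) * (2 * t * (nat \<lceil>s\<rceil> + 1) * j))" using n by (simp only: power_mult[symmetric]) simp
      also have "\<dots> = exp (real ((r + 1) * (2 * t * (nat \<lceil>s\<rceil> + 1) * j)) * ln ?x)" by (rule exp_of_nat_mult[symmetric])
      also have "real ((r + 1) * (2 * t * (nat \<lceil>s\<rceil> + 1) * j)) * ln ?x =
          (r + 1) * (2 * t) * (real (nat \<lceil>s\<rceil> + 1) * real j) * ln ?x"
        by (simp only: of_nat_mult mult_ac)
      also have "exp \<dots> \<le> exp ((r + 1) * (2 * t) * (3 * s * (L * ln ?x)) * ln ?x)"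
        using s3 jL ln1 s1 by (intro iffD2[OF exp_le_cancel_iff] mult_right_mono mult_left_mono mult_mono) auto
      also have "(r + 1) * (2 * t) * (3 * s * (L * ln ?x)) * ln ?x = C * s * ln ?x ^ 2"
        by (simp add: C_def power2_eq_square algebra_simps)
      finally show ?thesis .
    qed
    show "has_containers (r_sets r n) ?A (exp (C * ?x powr plateau t * ln ?x ^ 2)) (free r t n)"
      unfolding s_def[symmetric] by (rule has_containers_mono[OF hc order_refl le])
  qed
  moreover have "C > 0" unfolding C_def using L t by simp
  ultimately show ?thesis using that[of K C] K by simp
qed

section \<open>Random subsets\<close>

text \<open>The edge set of the random r-graph, but over any ground set: it also serves to thin out
  a fixed edge set.\<close>

definition random_subset :: "'a set \<Rightarrow> real \<Rightarrow> 'a set pmf" where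
  "random_subset R p = map_pmf (\<lambda>\<omega>. {e\<in>R. \<omega> e}) (Pi_pmf R False (\<lambda>_. bernoulli_pmf p))"

lemma random_r_graph_eq:
  "random_r_graph r n p = map_pmf (Hypergraph {..<n}) (random_subset (r_sets r n) p)"
  by (simp add: random_r_graph_def random_subset_def pmf.map_comp o_def)

lemma prob_random_r_graph:
  "measure_pmf.prob (random_r_graph r n p) {G. P G} =
   measure_pmf.prob (random_subset (r_sets r n) p) {E. P (Hypergraph {..<n} E)}"
  unfolding random_r_graph_eq measure_map_pmf by (simp add: vimage_def)

lemma set_random_subset: "E \<in> set_pmf (random_subset R p) \<Longrightarrow> E \<subseteq> R"
  by (auto simp: random_subset_def)

lemma prob_random_subset_cong:
  assumes "\<And>E. E \<subseteq> R \<Longrightarrow> P E \<Longrightarrow> Q E"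
  shows "measure_pmf.prob (random_subset R p) {E. P E} \<le> measure_pmf.prob (random_subset R p) {E. Q E}"
proof -
  have "measure_pmf.prob (random_subset R p) {E. P E} = measure_pmf.prob (random_subset R p) ({E. P E} \<inter> set_pmf (random_subset R p))"
    by (simp add: measure_Int_set_pmf)
  also have "\<dots> \<le> measure_pmf.prob (random_subset R p) {E. Q E}"
    by (intro measure_pmf.finite_measure_mono) (auto dest!: set_random_subset intro: assms)
  finally show ?thesis .
qed

context
  fixes R :: "'a set" and p :: real
  assumes R: "finite R" and p: "0 \<le> p" "p \<le> 1"
begin

lemma finite_random_subset: "finite (set_pmf (random_subset R p))"
  using set_random_subset by (rule_tac finite_subset[of _ "Pow R"]) (use R in auto)

lemma integrable_random_subset: "integrable (measure_pmf (random_subset R p)) f" for f :: "'a set \<Rightarrow> real"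
  by (rule integrable_measure_pmf_finite[OF finite_random_subset])

lemma prob_subset:
  assumes S: "S \<subseteq> R"
  shows "measure_pmf.prob (random_subset R p) {E. S \<subseteq> E} = p ^ card S"
proof -
  let ?B = "\<lambda>e. if e \<in> S then {True} else UNIV"
  have "(\<lambda>\<omega>. {e\<in>R. \<omega> e}) -` {E. S \<subseteq> E} = Pi R ?B"
    using S by (auto simp: Pi_def)
  then have "measure_pmf.prob (random_subset R p) {E. S \<subseteq> E} = measure_pmf.prob (Pi_pmf R False (\<lambda>_. bernoulli_pmf p)) (Pi R ?B)"
    by (simp add: random_subset_def measure_map_pmf)
  also have "\<dots> = (\<Prod>e\<in>R. measure_pmf.prob (bernoulli_pmf p) (?B e))"
    by (rule measure_Pi_pmf_Pi[OF R])
  also have "\<dots> = (\<Prod>e\<in>R. if e \<in> S then p else 1)"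
    using p by (intro prod.cong) (auto simp: measure_pmf_single)
  also have "\<dots> = p ^ card S"
    using R S by (simp add: prod.If_cases Int_absorb1)
  finally show ?thesis .
qed

lemma expectation_count:
  assumes S: "finite \<S>" "\<And>S. S \<in> \<S> \<Longrightarrow> S \<subseteq> R"
  shows "measure_pmf.expectation (random_subset R p) (\<lambda>E. real (card {S\<in>\<S>. S \<subseteq> E})) = (\<Sum>S\<in>\<S>. p ^ card S)"
proof -
  have "(\<lambda>E. real (card {S\<in>\<S>. S \<subseteq> E})) = (\<lambda>E. \<Sum>S\<in>\<S>. indicator {E. S \<subseteq> E} E)"
  proof
    fix E
    have "real (card {S\<in>\<S>. S \<subseteq> E}) = (\<Sum>S\<in>{S\<in>\<S>. S \<subseteq> E}. 1)" by simp
    also have "\<dots> = (\<Sum>S\<in>\<S>. if S \<subseteq> E then 1 else 0)" using S by (subst sum.inter_filter) auto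
    finally show "real (card {S\<in>\<S>. S \<subseteq> E}) = (\<Sum>S\<in>\<S>. indicator {E. S \<subseteq> E} E)"
      by (simp add: indicator_def of_bool_def)
  qed
  then have "measure_pmf.expectation (random_subset R p) (\<lambda>E. real (card {S\<in>\<S>. S \<subseteq> E}))
    = (\<Sum>S\<in>\<S>. measure_pmf.expectation (random_subset R p) (indicator {E. S \<subseteq> E}))"
    using integrable_random_subset by (simp add: Bochner_Integration.integral_sum)
  also have "\<dots> = (\<Sum>S\<in>\<S>. p ^ card S)" using S by (intro sum.cong) (simp_all add: prob_subset)
  finally show ?thesis .
qed

lemma prob_count_ge:
  assumes S: "finite \<S>" "\<And>S. S \<in> \<S> \<Longrightarrow> S \<subseteq> R" and a: "a > 0"
  shows "measure_pmf.prob (random_subset R p) {E. a \<le> real (card {S\<in>\<S>. S \<subseteq> E})} \<le> (\<Sum>S\<in>\<S>. p ^ card S) / a"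
proof -
  have "measure_pmf.prob (random_subset R p) {E \<in> space (measure_pmf (random_subset R p)). a \<le> real (card {S\<in>\<S>. S \<subseteq> E})}
    \<le> measure_pmf.expectation (random_subset R p) (\<lambda>E. real (card {S\<in>\<S>. S \<subseteq> E})) / a"
    by (rule integral_Markov_inequality_measure[where A = "{}"]) (use a integrable_random_subset in auto)
  moreover have "measure_pmf.expectation (random_subset R p) (\<lambda>E. real (card {S\<in>\<S>. S \<subseteq> E})) = (\<Sum>S\<in>\<S>. p ^ card S)"
    by (rule expectation_count) (use S in auto)
  ultimately show ?thesis by simp
qed

text \<open>Edges are counted as singletons, so that \<open>expectation_count\<close> covers both
  edges and copies.\<close>

lemma card_Int_eq: "A \<subseteq> R \<Longrightarrow> card (A \<inter> E) = card {S\<in>(\<lambda>e. {e}) ` A. S \<subseteq> E}"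
proof -
  have "{S\<in>(\<lambda>e. {e}) ` A. S \<subseteq> E} = (\<lambda>e. {e}) ` (A \<inter> E)" by auto
  then show ?thesis by (simp add: card_image)
qed

text \<open>Chebyshev's inequality; the variance is at most the mean.\<close>

lemma prob_card_deviates:
  assumes A: "A \<subseteq> R" "A \<noteq> {}" and p0: "p > 0" and \<epsilon>: "\<epsilon> > 0"
  shows "measure_pmf.prob (random_subset R p) {E. \<epsilon> * (p * card A) \<le> \<bar>real (card (A \<inter> E)) - p * card A\<bar>}
     \<le> 1 / (\<epsilon> ^ 2 * (p * card A))"
proof -
  let ?M = "random_subset R p" let ?m = "p * card A" let ?X = "\<lambda>E. real (card (A \<inter> E))"
  have fA: "finite A" using A R finite_subset by blast
  then have m0: "?m > 0" using A p0 by (simp add: card_gt_0_iff)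
  have EX: "measure_pmf.expectation ?M ?X = ?m"
  proof -
    have "measure_pmf.expectation ?M ?X = (\<Sum>S\<in>(\<lambda>e. {e}) ` A. p ^ card S)"
      unfolding card_Int_eq[OF A(1)] by (rule expectation_count) (use fA A in auto)
    also have "\<dots> = (\<Sum>e\<in>A. p)" by (subst sum.reindex) auto
    finally show ?thesis by simp
  qed
  have sq: "?X E ^ 2 = (\<Sum>e\<in>A. \<Sum>f\<in>A. indicator {E. {e, f} \<subseteq> E} E)" for E
  proof -
    have "?X E = (\<Sum>e\<in>A. if e \<in> E then 1 else 0)" using fA by (simp add: sum.If_cases Int_def)
    then have "?X E ^ 2 = (\<Sum>e\<in>A. \<Sum>f\<in>A. (if e \<in> E then 1 else 0) * (if f \<in> E then 1 else 0))"
      by (simp add: power2_eq_square sum_product)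
    also have "\<dots> = (\<Sum>e\<in>A. \<Sum>f\<in>A. indicator {E. {e, f} \<subseteq> E} E)"
      by (intro sum.cong refl) simp
    finally show ?thesis .
  qed
  have "measure_pmf.expectation ?M (\<lambda>E. ?X E ^ 2) = (\<Sum>e\<in>A. \<Sum>f\<in>A. p ^ card {e, f})"
  proof -
    have "measure_pmf.expectation ?M (\<lambda>E. ?X E ^ 2)
       = (\<Sum>e\<in>A. \<Sum>f\<in>A. measure_pmf.expectation ?M (indicator {E. {e, f} \<subseteq> E}))"
      unfolding sq using integrable_random_subset
      by (simp add: Bochner_Integration.integral_sum del: insert_subset)
    also have "\<dots> = (\<Sum>e\<in>A. \<Sum>f\<in>A. p ^ card {e, f})"
    proof (intro sum.cong refl)
      fix e f assume "e \<in> A" "f \<in> A"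
      then have "{e, f} \<subseteq> R" using A(1) by auto
      from prob_subset[OF this] show "measure_pmf.expectation ?M (indicator {E. {e, f} \<subseteq> E}) = p ^ card {e, f}" by simp
    qed
    finally show ?thesis .
  qed
  also have "\<dots> \<le> (\<Sum>e\<in>A. \<Sum>f\<in>A. p ^ 2 + (if e = f then p else 0))"
  proof (intro sum_mono)
    fix e f show "p ^ card {e, f} \<le> p ^ 2 + (if e = f then p else 0)"
      using p by (cases "e = f") (auto simp: power2_eq_square)
  qed
  also have "\<dots> = ?m ^ 2 + ?m" using fA by (simp add: sum.distrib power2_eq_square algebra_simps)
  finally have EX2: "measure_pmf.expectation ?M (\<lambda>E. ?X E ^ 2) \<le> ?m ^ 2 + ?m" .
  have "measure_pmf.expectation ?M (\<lambda>E. (?X E - ?m) ^ 2) = measure_pmf.expectation ?M (\<lambda>E. ?X E ^ 2 - 2 * ?m * ?X E + ?m ^ 2)"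
    by (simp add: power2_diff algebra_simps)
  also have "\<dots> = measure_pmf.expectation ?M (\<lambda>E. ?X E ^ 2) - 2 * ?m * ?m + ?m ^ 2"
    using integrable_random_subset EX by (simp add: Bochner_Integration.integral_diff Bochner_Integration.integral_add)
  also have "\<dots> \<le> ?m" using EX2 unfolding power2_eq_square by linarith
  finally have var: "measure_pmf.expectation ?M (\<lambda>E. (?X E - ?m) ^ 2) \<le> ?m" .
  let ?a = "(\<epsilon> * ?m) ^ 2"
  have a0: "?a > 0" using mult_pos_pos[OF \<epsilon> m0] by (rule zero_less_power)
  have "measure_pmf.prob ?M {E. \<epsilon> * ?m \<le> \<bar>?X E - ?m\<bar>} \<le> measure_pmf.prob ?M {E \<in> space (measure_pmf ?M). ?a \<le> (?X E - ?m) ^ 2}"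
  proof (intro measure_pmf.finite_measure_mono subsetI)
    fix E assume "E \<in> {E. \<epsilon> * ?m \<le> \<bar>?X E - ?m\<bar>}"
    then have "?a \<le> \<bar>?X E - ?m\<bar> ^ 2" using \<epsilon> m0 by (intro power_mono) auto
    then show "E \<in> {E \<in> space (measure_pmf ?M). ?a \<le> (?X E - ?m) ^ 2}" by simp
  qed auto
  also have "\<dots> \<le> measure_pmf.expectation ?M (\<lambda>E. (?X E - ?m) ^ 2) / ?a"
    by (rule integral_Markov_inequality_measure[where A = "{}"]) (use a0 integrable_random_subset in auto)
  also have "\<dots> \<le> ?m / ?a" using var a0 by (intro divide_right_mono) auto
  also have "\<dots> = 1 / (\<epsilon> ^ 2 * ?m)" using m0 by (simp add: power2_eq_square)
  finally show ?thesis .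
qed

lemma exists_ge_expectation:
  fixes f :: "'a set \<Rightarrow> real"
  obtains E where "E \<subseteq> R" "f E \<ge> measure_pmf.expectation (random_subset R p) f"
proof -
  have "\<exists>E\<in>set_pmf (random_subset R p). f E \<ge> measure_pmf.expectation (random_subset R p) f"
  proof (rule ccontr)
    let ?M = "random_subset R p" let ?e = "measure_pmf.expectation ?M f"
    assume no: "\<not> (\<exists>E\<in>set_pmf ?M. f E \<ge> ?e)"
    have lt: "f E < ?e" if "E \<in> set_pmf ?M" for E using no that by force
    have "?e = (\<Sum>E\<in>set_pmf ?M. f E * pmf ?M E)"
      using finite_random_subset by (subst integral_measure_pmf_real[OF finite_random_subset]) auto
    also have "\<dots> < (\<Sum>E\<in>set_pmf ?M. ?e * pmf ?M E)"
      using finite_random_subset lt by (intro sum_strict_mono) (auto simp: set_pmf_not_empty pmf_positive)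
    also have "\<dots> = ?e * (\<Sum>E\<in>set_pmf ?M. pmf ?M E)" by (simp add: sum_distrib_left)
    also have "\<dots> = ?e" using sum_pmf_eq_1[OF finite_random_subset order_refl] by simp
    finally show False by simp
  qed
  then show ?thesis using that set_random_subset by blast
qed

text \<open>The alteration method: take a random subset and remove one element from each member of
  the family that survives in it. Some outcome is at least as good as the average.\<close>

lemma deletion:
  assumes S: "finite \<S>" "\<forall>S\<in>\<S>. S \<subseteq> R \<and> S \<noteq> {}"
  shows "\<exists>I. I \<subseteq> R \<and> (\<forall>S\<in>\<S>. \<not> S \<subseteq> I) \<and> real (card I) \<ge> p * card R - (\<Sum>S\<in>\<S>. p ^ card S)"
proof -
  let ?M = "random_subset R p"
  let ?f = "\<lambda>E. real (card (R \<inter> E)) - real (card {S\<in>\<S>. S \<subseteq> E})"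
  have "measure_pmf.expectation ?M (\<lambda>E. real (card (R \<inter> E))) = p * card R"
  proof -
    have "measure_pmf.expectation ?M (\<lambda>E. real (card (R \<inter> E))) = (\<Sum>S\<in>(\<lambda>e. {e}) ` R. p ^ card S)"
      unfolding card_Int_eq[OF order_refl] by (rule expectation_count) (use R in auto)
    also have "\<dots> = (\<Sum>e\<in>R. p)" by (subst sum.reindex) auto
    finally show ?thesis by simp
  qed
  then have Ef: "measure_pmf.expectation ?M ?f = p * card R - (\<Sum>S\<in>\<S>. p ^ card S)"
    using integrable_random_subset expectation_count[OF S(1)] S(2) by (simp add: Bochner_Integration.integral_diff)
  obtain E where E: "E \<subseteq> R" "?f E \<ge> p * card R - (\<Sum>S\<in>\<S>. p ^ card S)"
    using exists_ge_expectation[of ?f] unfolding Ef by blast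
  define D where "D = (\<lambda>S. SOME e. e \<in> S) ` {S\<in>\<S>. S \<subseteq> E}"
  have "card D \<le> card {S\<in>\<S>. S \<subseteq> E}" unfolding D_def using S by (intro card_image_le) auto
  moreover have "finite D" unfolding D_def using S by simp
  moreover have "card E - card D \<le> card (E - D)" using \<open>finite D\<close> by (rule diff_card_le_card_Diff)
  moreover have "R \<inter> E = E" using E by blast
  ultimately have "real (card (E - D)) \<ge> ?f E" by simp
  moreover have "\<not> S \<subseteq> E - D" if "S \<in> \<S>" for S
  proof
    assume "S \<subseteq> E - D"
    moreover have "(SOME e. e \<in> S) \<in> S" using S(2) that some_in_eq by blast
    ultimately show False using that by (auto simp: D_def)
  qed
  moreover have "E - D \<subseteq> R" using E(1) by blast
  ultimately show ?thesis using E(2) by (intro exI[of _ "E - D"]) auto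
qed

end

lemma power_over_fact_le_exp: "real m ^ m / fact m \<le> exp (real m)"
proof -
  have "summable (\<lambda>k. inverse (fact k) * real m ^ k)" by (rule summable_exp)
  then have "(\<Sum>k\<in>{m}. inverse (fact k) * real m ^ k) \<le> (\<Sum>k. inverse (fact k) * real m ^ k)"
    by (intro sum_le_suminf) auto
  then show ?thesis by (simp add: exp_def field_simps)
qed

text \<open>A union bound over the m-subsets of X, together with (|X| choose m) \<le> (e |X| /
  m)^m.\<close>

lemma prob_card_ge:
  fixes R :: "'a set"
  assumes R: "finite R" and p: "0 \<le> p" "p \<le> 1" and X: "X \<subseteq> R" and m: "m \<ge> 1"
  shows "measure_pmf.prob (random_subset R p) {E. m \<le> card (X \<inter> E)} \<le> (exp 1 * card X * p / m) ^ m"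
proof -
  have fX: "finite X" using X R finite_subset by blast
  let ?S = "{S. S \<subseteq> X \<and> card S = m}"
  have "measure_pmf.prob (random_subset R p) {E. m \<le> card (X \<inter> E)} \<le>
     measure_pmf.prob (random_subset R p) {E. 1 \<le> real (card {S\<in>?S. S \<subseteq> E})}"
  proof (rule prob_random_subset_cong)
    fix E assume "E \<subseteq> R" "m \<le> card (X \<inter> E)"
    then obtain S where "S \<subseteq> X \<inter> E" "card S = m" by (meson obtain_subset_with_card_n)
    then have "S \<in> {S\<in>?S. S \<subseteq> E}" by auto
    moreover have "finite {S\<in>?S. S \<subseteq> E}" using fX by simp
    ultimately have "card {S\<in>?S. S \<subseteq> E} > 0" by (auto simp: card_gt_0_iff)
    then show "1 \<le> real (card {S\<in>?S. S \<subseteq> E})" by linarith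
  qed
  also have "\<dots> \<le> (\<Sum>S\<in>?S. p ^ card S) / 1" by (rule prob_count_ge[OF R p]) (use fX X in auto)
  also have "\<dots> = real (card X choose m) * p ^ m" using n_subsets[OF fX, of m] by simp
  also have "\<dots> \<le> (real (card X) ^ m * exp m / m ^ m) * p ^ m"
  proof (rule mult_right_mono)
    have "real (card X choose m) * fact m \<le> real (card X) ^ m"
      using binomial_fact_pow[of "card X" m] by (metis of_nat_fact of_nat_le_iff of_nat_mult of_nat_power)
    then have "real (card X choose m) \<le> real (card X) ^ m / fact m" by (simp add: field_simps)
    also have "\<dots> = real (card X) ^ m / m ^ m * (real m ^ m / fact m)" using m by simp
    also have "\<dots> \<le> real (card X) ^ m / m ^ m * exp m"
      using power_over_fact_le_exp by (intro mult_left_mono) auto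
    finally show "real (card X choose m) \<le> real (card X) ^ m * exp m / m ^ m" by simp
  qed (use p in simp)
  also have "\<dots> = (exp 1 * card X * p / m) ^ m"
    by (simp add: power_divide power_mult_distrib exp_of_nat_mult[symmetric])
  finally show ?thesis .
qed

section \<open>Extremal numbers and copies of the target\<close>

abbreviation target :: "nat \<Rightarrow> nat \<Rightarrow> ((nat + nat) + (nat + nat) set \<times> nat) hypergraph" where
  "target r t \<equiv> expansion r (complete_bipartite 2 t)"

lemma edges_complete_bipartite:
  "edges (complete_bipartite s t) = (\<lambda>(i, j). {Inl i, Inr j}) ` ({..<s} \<times> {..<t})"
  by (auto simp: complete_bipartite_def)

lemma edge_complete_bipartiteI: "i < s \<Longrightarrow> j < t \<Longrightarrow> {Inl i, Inr j} \<in> edges (complete_bipartite s t)"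
  unfolding complete_bipartite_def hypergraph.sel by blast

lemma card_edges_complete_bipartite: "card (edges (complete_bipartite s t)) = s * t"
  unfolding edges_complete_bipartite
  by (subst card_image) (auto simp: inj_on_def doubleton_eq_iff card_cartesian_product)

lemma finite_edges_complete_bipartite [simp]: "finite (edges (complete_bipartite s t))"
  by (simp add: edges_complete_bipartite)

text \<open>For r \<ge> 3 there is at least one new vertex, and it carries its edge as a
  label.\<close>

lemma inj_on_expand_edge: "r \<ge> 3 \<Longrightarrow> inj_on (\<lambda>e. e <+> {e} \<times> {..<r - 2}) E"
  for r :: nat
proof (rule inj_onI)
  fix e e' assume r: "r \<ge> 3" and "e <+> {e} \<times> {..<r - 2} = e' <+> {e'} \<times> {..<r - 2}"
  moreover have "Inr (e, 0) \<in> e <+> {e} \<times> {..<r - 2}" using r by auto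
  ultimately have "Inr (e, 0) \<in> e' <+> {e'} \<times> {..<r - 2}" by simp
  then show "e = e'" by auto
qed

lemma card_edges_target: "r \<ge> 3 \<Longrightarrow> card (edges (target r t)) = 2 * t"
  unfolding expansion_def by (simp add: card_image inj_on_expand_edge card_edges_complete_bipartite)

lemma finite_edges_target [simp]: "finite (edges (target r t))"
  by (simp add: expansion_def)

lemma card_verts_target:
  "finite (verts (target r t)) \<and> card (verts (target r t)) = 2 + t + 2 * t * (r - 2)"
proof -
  have "verts (target r t) = (({..<2} <+> {..<t}) <+> edges (complete_bipartite 2 t) \<times> {..<r - 2})"
    by (simp add: expansion_def complete_bipartite_def)
  then show ?thesis
    by (simp add: card_Plus card_cartesian_product card_edges_complete_bipartite)
qed

lemma edge_target_subset: "e \<in> edges (target r t) \<Longrightarrow> e \<subseteq> verts (target r t)"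
  using r_graph_complete_bipartite[of 2 t] by (fastforce simp: expansion_def r_graph_def)

lemma edge_target_card: "r \<ge> 3 \<Longrightarrow> e \<in> edges (target r t) \<Longrightarrow> card e = r"
  using r_graph_expansion[OF r_graph_complete_bipartite, of r 2 t] by (auto simp: r_graph_def)

lemma vertex_target_covered:
  assumes r: "r \<ge> 3" and t: "t \<ge> 1" and x: "x \<in> verts (target r t)"
  shows "\<exists>e\<in>edges (target r t). x \<in> e"
proof (cases x)
  case (Inl a)
  have "\<exists>f\<in>edges (complete_bipartite 2 t). a \<in> f"
  proof (cases a)
    case (Inl i)
    then have "i < 2" using x \<open>x = Inl a\<close> by (auto simp: expansion_def complete_bipartite_def)
    then have "{Inl i, Inr 0} \<in> edges (complete_bipartite 2 t)" using t by (intro edge_complete_bipartiteI) auto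
    then show ?thesis using Inl by blast
  next
    case (Inr j)
    then have "j < t" using x \<open>x = Inl a\<close> by (auto simp: expansion_def complete_bipartite_def)
    then have "{Inl 0, Inr j} \<in> edges (complete_bipartite 2 t)" by (intro edge_complete_bipartiteI) auto
    then show ?thesis using Inr by blast
  qed
  then show ?thesis using Inl by (auto simp: expansion_def)
next
  case (Inr b)
  obtain e m where b: "b = (e, m)" by (cases b)
  then have "e \<in> edges (complete_bipartite 2 t)" "m < r - 2" using x Inr by (auto simp: expansion_def)
  then show ?thesis using Inr b by (auto simp: expansion_def)
qed

text \<open>Every vertex of the target lies in an edge, so a copy is placed by the edges alone. This
  lets \<open>ex_num\<close>, a maximum over subhypergraphs, be treated as a maximum over edge
  sets.\<close>

lemma contains_copy_full_verts:
  assumes r: "r \<ge> 3" and t: "t \<ge> 1" and H: "\<forall>e\<in>edges H. e \<subseteq> verts H"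
    and K: "contains_copy K (target r t)" "edges K = edges H"
  shows "contains_copy H (target r t)"
proof -
  obtain \<phi> where \<phi>: "inj_on \<phi> (verts (target r t))" "\<forall>e\<in>edges (target r t). \<phi> ` e \<in> edges K"
    using K unfolding contains_copy_def by blast
  have "\<phi> x \<in> verts H" if x: "x \<in> verts (target r t)" for x
  proof -
    obtain e where e: "e \<in> edges (target r t)" "x \<in> e" using vertex_target_covered[OF r t x] by blast
    then have "\<phi> ` e \<in> edges H" using \<phi>(2) K(2) by simp
    then have "\<phi> ` e \<subseteq> verts H" using H by simp
    then show ?thesis using e(2) by auto
  qed
  then show ?thesis unfolding contains_copy_def using \<phi> K(2) by (intro exI[of _ \<phi>]) auto
qed

lemma ex_num_ge:
  assumes I: "I \<subseteq> E" "E \<subseteq> r_sets r n" and f: "free r t n I"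
  shows "card I \<le> ex_num (Hypergraph {..<n} E) (target r t)"
  unfolding ex_num_def
proof (rule Max_ge)
  have fE: "finite E" by (rule finite_subset[OF I(2) finite_r_sets])
  show "finite {card (edges H) |H. subhypergraph H (Hypergraph {..<n} E) \<and> \<not> contains_copy H (target r t)}"
  proof (rule finite_subset)
    show "{card (edges H) |H. subhypergraph H (Hypergraph {..<n} E) \<and> \<not> contains_copy H (target r t)} \<subseteq> {..card E}"
      using fE by (auto simp: subhypergraph_def intro: card_mono)
  qed simp
  have "I \<subseteq> r_sets r n" using I by order
  then have "\<forall>e\<in>I. e \<subseteq> {..<n}" unfolding r_sets_def by blast
  then have "subhypergraph (Hypergraph {..<n} I) (Hypergraph {..<n} E)"
    using I by (simp add: subhypergraph_def)
  then show "card I \<in> {card (edges H) |H. subhypergraph H (Hypergraph {..<n} E) \<and> \<not> contains_copy H (target r t)}"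
    using f unfolding free_def by (intro CollectI exI[of _ "Hypergraph {..<n} I"]) auto
qed

lemma ex_num_attained:
  assumes r: "r \<ge> 3" and t: "t \<ge> 1" and E: "E \<subseteq> r_sets r n"
  obtains I where "I \<subseteq> E" "free r t n I" "card I = ex_num (Hypergraph {..<n} E) (target r t)"
proof -
  let ?S = "{card (edges H) |H. subhypergraph H (Hypergraph {..<n} E) \<and> \<not> contains_copy H (target r t)}"
  have fE: "finite E" by (rule finite_subset[OF E finite_r_sets])
  have "finite ?S"
  proof (rule finite_subset)
    show "?S \<subseteq> {..card E}" using fE by (auto simp: subhypergraph_def intro: card_mono)
  qed simp
  moreover have "?S \<noteq> {}"
  proof -
    have "Inl (Inl 0) \<in> verts (target r t)" by (auto simp: expansion_def complete_bipartite_def)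
    then have "\<not> contains_copy (Hypergraph {} {} :: nat hypergraph) (target r t)" by (auto simp: contains_copy_def)
    moreover have "subhypergraph (Hypergraph {} {}) (Hypergraph {..<n} E)" by (simp add: subhypergraph_def)
    ultimately show ?thesis by blast
  qed
  ultimately have "Max ?S \<in> ?S" by (rule Max_in)
  then obtain H where H: "ex_num (Hypergraph {..<n} E) (target r t) = card (edges H)"
    "subhypergraph H (Hypergraph {..<n} E)" "\<not> contains_copy H (target r t)"
    unfolding ex_num_def by auto
  show ?thesis
  proof (rule that[of "edges H"])
    show "edges H \<subseteq> E" using H(2) by (simp add: subhypergraph_def)
    have "\<forall>e\<in>edges H. e \<subseteq> verts H" using H(2) by (simp add: subhypergraph_def)
    from contains_copy_full_verts[OF r t this, of "Hypergraph {..<n} (edges H)"] H(3)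
    show "free r t n (edges H)" by (auto simp: free_def)
  qed (use H in simp)
qed

text \<open>The edge sets of all copies in the complete r-graph on n vertices; extensional maps make
  the family finite.\<close>

definition target_copies :: "nat \<Rightarrow> nat \<Rightarrow> nat \<Rightarrow> nat set set set" where
  "target_copies r t n = (\<lambda>\<phi>. (`) \<phi> ` edges (target r t)) `
     {\<phi> \<in> PiE (verts (target r t)) (\<lambda>_. {..<n}). inj_on \<phi> (verts (target r t))}"

lemma not_free_copy:
  assumes "\<not> free r t n I"
  obtains S where "S \<in> target_copies r t n" "S \<subseteq> I"
proof -
  obtain \<phi> where \<phi>: "inj_on \<phi> (verts (target r t))" "\<phi> ` verts (target r t) \<subseteq> {..<n}"
     "\<forall>e\<in>edges (target r t). \<phi> ` e \<in> I"
    using assms unfolding free_def contains_copy_def by auto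
  let ?\<psi> = "restrict \<phi> (verts (target r t))"
  have eq: "?\<psi> ` e = \<phi> ` e" if "e \<in> edges (target r t)" for e
    using edge_target_subset[OF that] by (intro image_cong) auto
  show ?thesis
  proof (rule that)
    show "(`) ?\<psi> ` edges (target r t) \<in> target_copies r t n"
    proof -
      have "?\<psi> \<in> PiE (verts (target r t)) (\<lambda>_. {..<n})" using \<phi>(2) by auto
      moreover have "inj_on ?\<psi> (verts (target r t))" using \<phi>(1) by (simp only: inj_on_restrict_eq)
      ultimately show ?thesis unfolding target_copies_def by (intro imageI CollectI conjI)
    qed
    show "(`) ?\<psi> ` edges (target r t) \<subseteq> I" using \<phi>(3) eq by auto
  qed
qed

lemma finite_target_copies [simp]: "finite (target_copies r t n)"
  unfolding target_copies_def
  by (rule finite_imageI, rule finite_subset[OF _ finite_PiE[of "verts (target r t)" "\<lambda>_. {..<n}"]])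
     (use card_verts_target in auto)

lemma card_target_copies: "card (target_copies r t n) \<le> n ^ (2 + t + 2 * t * (r - 2))"
proof -
  have fin: "finite (PiE (verts (target r t)) (\<lambda>_. {..<n}))"
    using card_verts_target by (intro finite_PiE) auto
  let ?A = "{\<phi> \<in> PiE (verts (target r t)) (\<lambda>_. {..<n}). inj_on \<phi> (verts (target r t))}"
  have "card (target_copies r t n) \<le> card ?A"
    unfolding target_copies_def using fin by (intro card_image_le) auto
  also have "\<dots> \<le> card (PiE (verts (target r t)) (\<lambda>_. {..<n}))"
    using fin by (intro card_mono) auto
  also have "\<dots> = n ^ (2 + t + 2 * t * (r - 2))"
    using card_verts_target[of r t] by (simp add: card_PiE)
  finally show ?thesis .
qed

lemma target_copies:
  assumes r: "r \<ge> 3" and S: "S \<in> target_copies r t n"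
  shows "S \<subseteq> r_sets r n" "card S = 2 * t"
proof -
  obtain \<phi> where \<phi>: "\<phi> \<in> PiE (verts (target r t)) (\<lambda>_. {..<n})" "inj_on \<phi> (verts (target r t))"
    "S = (`) \<phi> ` edges (target r t)"
    using S unfolding target_copies_def by blast
  show "S \<subseteq> r_sets r n"
  proof
    fix x assume "x \<in> S"
    then obtain e where e: "e \<in> edges (target r t)" "x = \<phi> ` e" using \<phi>(3) by blast
    have "x \<subseteq> {..<n}" using e edge_target_subset[OF e(1)] \<phi>(1) by (auto simp: PiE_def Pi_def)
    moreover have "card x = r"
      using e edge_target_card[OF r e(1)] inj_on_subset[OF \<phi>(2) edge_target_subset[OF e(1)]]
      by (simp add: card_image)
    ultimately show "x \<in> r_sets r n" by (simp add: r_sets_def)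
  qed
  have "inj_on ((`) \<phi>) (edges (target r t))"
  proof (rule inj_onI)
    fix e e' assume "e \<in> edges (target r t)" "e' \<in> edges (target r t)" "\<phi> ` e = \<phi> ` e'"
    then show "e = e'" using \<phi>(2) edge_target_subset by (metis inj_on_image_eq_iff)
  qed
  then show "card S = 2 * t" unfolding \<phi>(3) by (simp add: card_image card_edges_target[OF r])
qed

text \<open>All edges of a star share a vertex, whereas the target has two disjoint edges.\<close>

lemma free_star:
  assumes r: "r \<ge> 3" and t: "t \<ge> 2" and I: "\<And>e. e \<in> I \<Longrightarrow> v \<in> e"
  shows "free r t n I"
  unfolding free_def
proof
  assume "contains_copy (Hypergraph {..<n} I) (target r t)"
  then obtain \<phi> where \<phi>: "inj_on \<phi> (verts (target r t))" "\<forall>e\<in>edges (target r t). \<phi> ` e \<in> I"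
    unfolding contains_copy_def by auto
  let ?E = "\<lambda>i j. {Inl i, Inr j} <+> {{Inl i, Inr j}} \<times> {..<r - 2} :: ((nat + nat) + (nat + nat) set \<times> nat) set"
  have E: "?E i j \<in> edges (target r t)" if "i < 2" "j < t" for i j
    using edge_complete_bipartiteI[OF that] unfolding expansion_def hypergraph.sel by blast
  have "v \<in> \<phi> ` ?E 0 0" "v \<in> \<phi> ` ?E 1 1" using \<phi>(2) E t I by auto
  then obtain x y where xy: "x \<in> ?E 0 0" "y \<in> ?E 1 1" "\<phi> x = \<phi> y" by auto
  have "x \<in> verts (target r t)" "y \<in> verts (target r t)"
    using xy edge_target_subset[OF E[of 0 0]] edge_target_subset[OF E[of 1 1]] t by auto
  then have "x = y" using \<phi>(1) xy(3) by (auto dest: inj_onD)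
  then have x: "x \<in> ?E 0 0" "x \<in> ?E 1 1" using xy by simp_all
  show False
  proof (cases x)
    case (Inl a)
    then have "a \<in> {Inl 0, Inr 0}" "a \<in> {Inl 1, Inr 1}" using x by auto
    then show False by auto
  next
    case (Inr b)
    have *: "fst b = e" if "Inr b \<in> A <+> {e} \<times> B" for e A and B :: "nat set" using that by auto
    have "{Inl 0, Inr 0} = ({Inl 1, Inr 1} :: (nat + nat) set)"
      using *[OF x(1)[unfolded Inr]] *[OF x(2)[unfolded Inr]] by (rule trans[OF sym])
    then have "Inl 0 \<in> ({Inl 1, Inr 1} :: (nat + nat) set)" by blast
    then show False by simp
  qed
qed

section \<open>Asymptotics\<close>

lemma aasI:
  assumes le: "eventually (\<lambda>n. measure_pmf.prob (M n) {x. \<not> A n x} \<le> b n) sequentially"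
    and b: "b \<longlonglongrightarrow> 0"
  shows "aas M A"
  unfolding aas_def
proof (rule tendsto_sandwich[where f = "\<lambda>n. 1 - b n" and h = "\<lambda>_. 1"])
  have eq: "measure_pmf.prob (M n) {x. A n x} = 1 - measure_pmf.prob (M n) {x. \<not> A n x}" for n
    using measure_pmf.prob_compl[of "{x. A n x}" "M n"] by (simp add: Compl_eq_Diff_UNIV[symmetric] Collect_neg_eq[symmetric])
  show "eventually (\<lambda>n. 1 - b n \<le> measure_pmf.prob (M n) {x. A n x}) sequentially"
    using le by eventually_elim (simp add: eq)
  show "(\<lambda>n. 1 - b n) \<longlonglongrightarrow> 1" using tendsto_diff[OF tendsto_const b, of 1] by simp
qed auto

lemma aasD: "aas M A \<Longrightarrow> (\<lambda>n. measure_pmf.prob (M n) {x. \<not> A n x}) \<longlonglongrightarrow> 0"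
proof -
  assume "aas M A"
  then have "(\<lambda>n. 1 - measure_pmf.prob (M n) {x. A n x}) \<longlonglongrightarrow> 1 - 1"
    unfolding aas_def by (intro tendsto_diff tendsto_const)
  moreover have "1 - measure_pmf.prob (M n) {x. A n x} = measure_pmf.prob (M n) {x. \<not> A n x}" for n
    using measure_pmf.prob_compl[of "{x. A n x}" "M n"] by (simp add: Compl_eq_Diff_UNIV[symmetric] Collect_neg_eq[symmetric])
  ultimately show ?thesis by simp
qed

lemma aas_conj:
  assumes "aas M A" "aas M B"
  shows "aas M (\<lambda>n x. A n x \<and> B n x)"
proof (rule aasI)
  show "(\<lambda>n. measure_pmf.prob (M n) {x. \<not> A n x} + measure_pmf.prob (M n) {x. \<not> B n x}) \<longlonglongrightarrow> 0"
    using tendsto_add[OF aasD[OF assms(1)] aasD[OF assms(2)]] by simp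
  have "{x. \<not> (A n x \<and> B n x)} = {x. \<not> A n x} \<union> {x. \<not> B n x}" for n by auto
  then show "eventually (\<lambda>n. measure_pmf.prob (M n) {x. \<not> (A n x \<and> B n x)}
      \<le> measure_pmf.prob (M n) {x. \<not> A n x} + measure_pmf.prob (M n) {x. \<not> B n x}) sequentially"
    by (simp add: measure_Un_le)
qed

definition aas_edges :: "nat \<Rightarrow> (nat \<Rightarrow> real) \<Rightarrow> (nat \<Rightarrow> nat set set \<Rightarrow> bool) \<Rightarrow> bool" where
  "aas_edges r p A \<longleftrightarrow> aas (\<lambda>n. random_subset (r_sets r n) (p n)) A"

lemma aas_random_r_graph:
  "aas (\<lambda>n. random_r_graph r n (p n)) A \<longleftrightarrow> aas_edges r p (\<lambda>n E. A n (Hypergraph {..<n} E))"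
  unfolding aas_def aas_edges_def prob_random_r_graph ..

lemma aas_edges_mono:
  assumes A: "aas_edges r p A" and imp: "eventually (\<lambda>n. \<forall>E. E \<subseteq> r_sets r n \<longrightarrow> A n E \<longrightarrow> B n E) sequentially"
  shows "aas_edges r p B"
  unfolding aas_edges_def
proof (rule aasI)
  show "(\<lambda>n. measure_pmf.prob (random_subset (r_sets r n) (p n)) {x. \<not> A n x}) \<longlonglongrightarrow> 0"
    using A unfolding aas_edges_def by (rule aasD)
  show "eventually (\<lambda>n. measure_pmf.prob (random_subset (r_sets r n) (p n)) {x. \<not> B n x}
      \<le> measure_pmf.prob (random_subset (r_sets r n) (p n)) {x. \<not> A n x}) sequentially"
    using imp by eventually_elim (rule prob_random_subset_cong, blast)
qed

lemma aas_edges_conj: "aas_edges r p A \<Longrightarrow> aas_edges r p B \<Longrightarrow> aas_edges r p (\<lambda>n E. A n E \<and> B n E)"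
  unfolding aas_edges_def by (rule aas_conj)

lemma aas_edges_concentration:
  fixes p :: "nat \<Rightarrow> real"
  assumes p: "\<And>n. 0 < p n \<and> p n \<le> 1" and A: "\<And>n. A n \<subseteq> r_sets r n"
    and lim: "filterlim (\<lambda>n. p n * card (A n)) at_top sequentially" and \<epsilon>: "\<epsilon> > 0"
  shows "aas_edges r p (\<lambda>n E. \<bar>real (card (A n \<inter> E)) - p n * card (A n)\<bar> \<le> \<epsilon> * (p n * card (A n)))"
  unfolding aas_edges_def
proof (rule aasI)
  show "eventually (\<lambda>n. measure_pmf.prob (random_subset (r_sets r n) (p n))
      {E. \<not> \<bar>real (card (A n \<inter> E)) - p n * card (A n)\<bar> \<le> \<epsilon> * (p n * card (A n))}
      \<le> 1 / (\<epsilon> ^ 2 * (p n * card (A n)))) sequentially"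
    using filterlim_at_top_dense[THEN iffD1, OF lim, rule_format, of 0]
  proof eventually_elim
    fix n assume "0 < p n * card (A n)"
    then have ne: "A n \<noteq> {}" by auto
    have "measure_pmf.prob (random_subset (r_sets r n) (p n))
      {E. \<not> \<bar>real (card (A n \<inter> E)) - p n * card (A n)\<bar> \<le> \<epsilon> * (p n * card (A n))}
      \<le> measure_pmf.prob (random_subset (r_sets r n) (p n))
      {E. \<epsilon> * (p n * card (A n)) \<le> \<bar>real (card (A n \<inter> E)) - p n * card (A n)\<bar>}"
      by (rule prob_random_subset_cong) linarith
    also have "\<dots> \<le> 1 / (\<epsilon> ^ 2 * (p n * card (A n)))"
      using p[of n] by (intro prob_card_deviates A ne \<epsilon>) auto
    finally show "measure_pmf.prob (random_subset (r_sets r n) (p n))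
      {E. \<not> \<bar>real (card (A n \<inter> E)) - p n * card (A n)\<bar> \<le> \<epsilon> * (p n * card (A n))}
      \<le> 1 / (\<epsilon> ^ 2 * (p n * card (A n)))" .
  qed
  have "filterlim (\<lambda>n. \<epsilon> ^ 2 * (p n * card (A n))) at_top sequentially"
    using \<epsilon> lim by (intro filterlim_tendsto_pos_mult_at_top[OF tendsto_const]) auto
  then show "(\<lambda>n. 1 / (\<epsilon> ^ 2 * (p n * card (A n)))) \<longlonglongrightarrow> 0"
    by (intro real_tendsto_divide_at_top[OF tendsto_const])
qed

section \<open>Edges and copies at and around the threshold density\<close>

definition num_copies :: "nat \<Rightarrow> nat \<Rightarrow> nat \<Rightarrow> nat set set \<Rightarrow> real" where
  "num_copies r t n E = real (card {S\<in>target_copies r t n. S \<subseteq> E})"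

definition threshold :: "nat \<Rightarrow> nat \<Rightarrow> nat \<Rightarrow> real" where
  "threshold r t n = real n powr (- real r + plateau t)"

lemma threshold_pos: "n \<ge> 1 \<Longrightarrow> threshold r t n > 0"
  by (simp add: threshold_def)

lemma threshold_power: "n \<ge> 1 \<Longrightarrow> threshold r t n * real n ^ r = real n powr plateau t"
  by (simp add: threshold_def powr_realpow[symmetric] powr_add[symmetric])

text \<open>For v vertices and 2t edges the exponent is v + 2t (\<alpha> - r), and its equality with
  \<alpha> is the equation (2t - 1) \<alpha> = 3t - 2.\<close>

lemma threshold_copies:
  assumes t: "t \<ge> 3" and r: "r \<ge> 3" and n: "n \<ge> 1"
  shows "real n ^ (2 + t + 2 * t * (r - 2)) * threshold r t n ^ (2 * t) = real n powr plateau t"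
proof -
  have "(2 * real t - 1) * plateau t = 3 * real t - 2" using t by (simp add: plateau_def)
  then have e: "real (2 + t + 2 * t * (r - 2)) + (- real r + plateau t) * real (2 * t) = plateau t"
    using r by (simp add: of_nat_diff algebra_simps)
  have pow: "real n ^ v = real n powr real v" for v using n by (simp add: powr_realpow)
  have powpow: "(real n powr x) ^ v = real n powr (x * real v)" for x v
    using n by (simp add: powr_realpow[symmetric] powr_powr)
  show ?thesis unfolding threshold_def pow powpow powr_add[symmetric] e ..
qed

text \<open>Markov's inequality, expressed through the ratio of p to the threshold: the expected
  number of copies scales with its 2t-th power, that of edges with its first.\<close>

lemma prob_many_copies:
  fixes p a :: real
  assumes t: "t \<ge> 3" and r: "r \<ge> 3" and p: "0 < p" "p \<le> 1" and a: "a > 0" and n: "n \<ge> 1"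
  shows "measure_pmf.prob (random_subset (r_sets r n) p) {E. a \<le> num_copies r t n E}
     \<le> real n powr plateau t * (p / threshold r t n) ^ (2 * t) / a"
proof -
  have "measure_pmf.prob (random_subset (r_sets r n) p) {E. a \<le> num_copies r t n E}
     \<le> (\<Sum>S\<in>target_copies r t n. p ^ card S) / a"
    unfolding num_copies_def using p target_copies(1)[OF r] by (intro prob_count_ge a) auto
  also have "(\<Sum>S\<in>target_copies r t n. p ^ card S) = card (target_copies r t n) * p ^ (2 * t)"
    using target_copies(2)[OF r] by simp
  also have "\<dots> \<le> real n ^ (2 + t + 2 * t * (r - 2)) * p ^ (2 * t)"
  proof (rule mult_right_mono)
    have "real (card (target_copies r t n)) \<le> real (n ^ (2 + t + 2 * t * (r - 2)))"
      using card_target_copies by (rule of_nat_mono)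
    then show "real (card (target_copies r t n)) \<le> real n ^ (2 + t + 2 * t * (r - 2))"
      by (simp only: of_nat_power)
  qed (use p in simp)
  also have "\<dots> = real n ^ (2 + t + 2 * t * (r - 2)) * threshold r t n ^ (2 * t) * (p / threshold r t n) ^ (2 * t)"
    using threshold_pos[OF n, of r t] by (simp add: power_divide)
  also have "\<dots> = real n powr plateau t * (p / threshold r t n) ^ (2 * t)"
    by (simp only: threshold_copies[OF t r n])
  finally show ?thesis using a by (simp add: divide_right_mono)
qed

text \<open>A second retention probability q is applied inside a fixed edge set E. Below the
  threshold q = 1 is used; above it, q brings the density down first.\<close>

lemma ex_num_deletion:
  fixes q :: real
  assumes r: "r \<ge> 3" and t: "t \<ge> 1" and E: "E \<subseteq> r_sets r n" and q: "0 \<le> q" "q \<le> 1"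
  shows "q * card E - q ^ (2 * t) * num_copies r t n E \<le> ex_num (Hypergraph {..<n} E) (target r t)"
proof -
  let ?S = "{S\<in>target_copies r t n. S \<subseteq> E}"
  have fE: "finite E" by (rule finite_subset[OF E finite_r_sets])
  have S: "finite ?S" "\<forall>S\<in>?S. S \<subseteq> E \<and> S \<noteq> {}"
    using target_copies(2)[OF r] t by fastforce+
  obtain I where I: "I \<subseteq> E" "\<forall>S\<in>?S. \<not> S \<subseteq> I" "real (card I) \<ge> q * card E - (\<Sum>S\<in>?S. q ^ card S)"
    using deletion[OF fE q S] by blast
  have "free r t n I"
  proof (rule ccontr)
    assume "\<not> free r t n I"
    then obtain S where "S \<in> target_copies r t n" "S \<subseteq> I" by (rule not_free_copy)
    then show False using I(1,2) by blast
  qed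
  then have "card I \<le> ex_num (Hypergraph {..<n} E) (target r t)" using I(1) E by (intro ex_num_ge)
  moreover have "(\<Sum>S\<in>?S. q ^ card S) = (\<Sum>S\<in>?S. q ^ (2 * t))"
    using target_copies(2)[OF r] by (intro sum.cong) auto
  then have "(\<Sum>S\<in>?S. q ^ card S) = q ^ (2 * t) * num_copies r t n E"
    by (simp add: num_copies_def)
  ultimately show ?thesis using I(3) by linarith
qed

lemma ex_num_le_card:
  assumes r: "r \<ge> 3" and t: "t \<ge> 1" and E: "E \<subseteq> r_sets r n"
  shows "ex_num (Hypergraph {..<n} E) (target r t) \<le> card E"
proof -
  obtain I where "I \<subseteq> E" "card I = ex_num (Hypergraph {..<n} E) (target r t)"
    using ex_num_attained[OF r t E] by metis
  then show ?thesis using card_mono[OF finite_subset[OF E finite_r_sets]] by metis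
qed

lemma choose_bounds:
  assumes "1 \<le> r" "r \<le> n"
  shows "real n ^ r / real r ^ r \<le> real (n choose r)"
  using binomial_ge_n_over_k_pow_k[OF assms(2), where 'a = real] by (simp add: power_divide)

text \<open>The ratio of copies to edges is of order (p / threshold)^(2t-1) in expectation and tends
  to 0, so deleting an edge from each copy is negligible. The lower bound on p makes the number of
  edges concentrate.\<close>

lemma ex_num_below_threshold:
  fixes p :: "nat \<Rightarrow> real"
  assumes r: "r \<ge> 3" and t: "t \<ge> 3" and p: "\<And>n. 0 < p n \<and> p n \<le> 1"
    and lo: "much_less (\<lambda>n. real n powr (- real r)) p" and hi: "much_less p (threshold r t)" and \<epsilon>: "\<epsilon> > 0"
  shows "aas_edges r p (\<lambda>n E. \<bar>real (ex_num (Hypergraph {..<n} E) (target r t)) - p n * real (n choose r)\<bar>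
     \<le> \<epsilon> * \<bar>p n * real (n choose r)\<bar>)"
proof -
  let ?N = "\<lambda>n. real (n choose r)"
  have r1: "1 \<le> r" using r by simp
  have pn: "filterlim (\<lambda>n. p n * real n ^ r) at_top sequentially"
  proof -
    have lim: "filterlim (\<lambda>n. inverse (real n powr (- real r) / p n)) at_top sequentially"
    proof (rule filterlim_inverse_at_top)
      show "(\<lambda>n. real n powr (- real r) / p n) \<longlonglongrightarrow> 0" using lo by (simp add: much_less_def)
      show "eventually (\<lambda>n. 0 < real n powr (- real r) / p n) sequentially"
        using eventually_ge_at_top[of 1] by eventually_elim (use p in auto)
    qed
    have ev: "eventually (\<lambda>n. inverse (real n powr (- real r) / p n) = p n * real n ^ r) sequentially"
      using eventually_ge_at_top[of 1] by eventually_elim (simp add: powr_minus powr_realpow divide_inverse)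
    show ?thesis using filterlim_cong[OF refl refl ev] lim by simp
  qed
  have pN: "eventually (\<lambda>n. p n * real n ^ r / real r ^ r \<le> p n * ?N n) sequentially"
    using eventually_ge_at_top[of r]
  proof eventually_elim
    fix n assume "r \<le> n"
    then have "p n * (real n ^ r / real r ^ r) \<le> p n * ?N n"
      using p[of n] choose_bounds[OF r1] by (intro mult_left_mono) auto
    then show "p n * real n ^ r / real r ^ r \<le> p n * ?N n" by simp
  qed
  have pNinf: "filterlim (\<lambda>n. p n * real (card (r_sets r n))) at_top sequentially"
    unfolding card_r_sets
  proof (rule filterlim_at_top_mono[OF _ pN])
    have "filterlim (\<lambda>n. inverse (real r ^ r) * (p n * real n ^ r)) at_top sequentially"
      using r pn by (intro filterlim_tendsto_pos_mult_at_top[OF tendsto_const]) auto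
    then show "filterlim (\<lambda>n. p n * real n ^ r / real r ^ r) at_top sequentially" by (simp add: field_simps)
  qed
  have A1: "aas_edges r p (\<lambda>n E. \<bar>real (card (r_sets r n \<inter> E)) - p n * card (r_sets r n)\<bar> \<le> (\<epsilon> / 2) * (p n * card (r_sets r n)))"
    using \<epsilon> by (intro aas_edges_concentration p pNinf) auto
  have A2: "aas_edges r p (\<lambda>n E. num_copies r t n E < (\<epsilon> / 2) * (p n * ?N n))"
    unfolding aas_edges_def
  proof (rule aasI)
    let ?y = "\<lambda>n. p n / threshold r t n"
    show "eventually (\<lambda>n. measure_pmf.prob (random_subset (r_sets r n) (p n)) {E. \<not> num_copies r t n E < (\<epsilon> / 2) * (p n * ?N n)}
        \<le> ?y n ^ (2 * t - 1) * (2 * real r ^ r / \<epsilon>)) sequentially"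
      using pN eventually_ge_at_top[of 1]
    proof eventually_elim
      fix n assume le: "p n * real n ^ r / real r ^ r \<le> p n * ?N n" and n: "1 \<le> n"
      have th: "threshold r t n > 0" using n by (rule threshold_pos)
      have a0: "(\<epsilon> / 2) * (p n * real n ^ r / real r ^ r) > 0" using \<epsilon> p[of n] n r by simp
      have le': "(\<epsilon> / 2) * (p n * real n ^ r / real r ^ r) \<le> (\<epsilon> / 2) * (p n * ?N n)"
        using le \<epsilon> by (intro mult_left_mono) auto
      have "measure_pmf.prob (random_subset (r_sets r n) (p n)) {E. \<not> num_copies r t n E < (\<epsilon> / 2) * (p n * ?N n)}
        \<le> measure_pmf.prob (random_subset (r_sets r n) (p n)) {E. (\<epsilon> / 2) * (p n * real n ^ r / real r ^ r) \<le> num_copies r t n E}"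
        using le' by (intro prob_random_subset_cong) linarith
      also have "\<dots> \<le> real n powr plateau t * ?y n ^ (2 * t) / ((\<epsilon> / 2) * (p n * real n ^ r / real r ^ r))"
        using p[of n] by (intro prob_many_copies t r a0 n) auto
      also have "\<dots> = ?y n ^ (2 * t - 1) * (2 * real r ^ r / \<epsilon>)"
      proof -
        have y: "?y n ^ (2 * t) = ?y n ^ (2 * t - 1) * ?y n"
          using t by (simp only: power_Suc2[symmetric]) simp
        have "real n powr plateau t * (z * ?y n) / ((\<epsilon> / 2) * (p n * real n ^ r / real r ^ r)) = z * (2 * real r ^ r / \<epsilon>)" for z
          unfolding threshold_power[OF n, of r t, symmetric] using th \<epsilon> p[of n] n r by simp
        then show ?thesis unfolding y .
      qed
      finally show "measure_pmf.prob (random_subset (r_sets r n) (p n)) {E. \<not> num_copies r t n E < (\<epsilon> / 2) * (p n * ?N n)}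
        \<le> ?y n ^ (2 * t - 1) * (2 * real r ^ r / \<epsilon>)" .
    qed
    have "?y \<longlonglongrightarrow> 0" using hi by (simp add: much_less_def)
    then have L: "(\<lambda>n. ?y n ^ (2 * t - 1) * (2 * real r ^ r / \<epsilon>)) \<longlonglongrightarrow> 0 ^ (2 * t - 1) * (2 * real r ^ r / \<epsilon>)"
      by (intro tendsto_intros)
    have z: "(0 :: real) ^ (2 * t - 1) * (2 * real r ^ r / \<epsilon>) = 0" using t by (simp add: zero_power)
    show "(\<lambda>n. ?y n ^ (2 * t - 1) * (2 * real r ^ r / \<epsilon>)) \<longlonglongrightarrow> 0" using L unfolding z .
  qed
  show ?thesis
  proof (rule aas_edges_mono[OF aas_edges_conj[OF A1 A2]], intro always_eventually allI impI)
    fix n E assume E: "E \<subseteq> r_sets r n"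
      and *: "\<bar>real (card (r_sets r n \<inter> E)) - p n * card (r_sets r n)\<bar> \<le> (\<epsilon> / 2) * (p n * card (r_sets r n)) \<and>
        num_copies r t n E < (\<epsilon> / 2) * (p n * ?N n)"
    have RE: "r_sets r n \<inter> E = E" using E by blast
    have c: "\<bar>real (card E) - p n * ?N n\<bar> \<le> (\<epsilon> / 2) * (p n * ?N n)" "num_copies r t n E < (\<epsilon> / 2) * (p n * ?N n)"
      using * by (simp_all only: RE card_r_sets)
    have t1: "t \<ge> 1" using t by simp
    have lo: "real (card E) - num_copies r t n E \<le> ex_num (Hypergraph {..<n} E) (target r t)"
      using ex_num_deletion[OF r t1 E, of 1] by simp
    have hi: "real (ex_num (Hypergraph {..<n} E) (target r t)) \<le> card E"
      using ex_num_le_card[OF r t1 E] by simp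
    have pN0: "0 \<le> p n * ?N n" using p[of n] by simp
    have e0: "0 \<le> \<epsilon> * (p n * ?N n)" using \<epsilon> pN0 by simp
    have half: "\<epsilon> / 2 * (p n * ?N n) = \<epsilon> * (p n * ?N n) / 2" by simp
    show "\<bar>real (ex_num (Hypergraph {..<n} E) (target r t)) - p n * ?N n\<bar> \<le> \<epsilon> * \<bar>p n * ?N n\<bar>"
      unfolding abs_of_nonneg[OF pN0] using c lo hi e0 unfolding half by linarith
  qed
qed

section \<open>Lower bounds above the threshold\<close>

lemma card_star_ge:
  assumes r: "r \<ge> 3" and n: "n \<ge> r"
  shows "(1 / (2 * real r)) ^ (r - 1) * real n ^ (r - 1) \<le> card {e\<in>r_sets r n. 0 \<in> e}"
proof -
  have "card {B. B \<subseteq> {1..<n} \<and> card B = r - 1} \<le> card {e\<in>r_sets r n. 0 \<in> e}"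
  proof (rule card_inj_on_le[where f = "insert 0"])
    show "inj_on (insert 0) {B. B \<subseteq> {1..<n} \<and> card B = r - 1}"
    proof (rule inj_onI)
      fix A B :: "nat set"
      assume AB: "A \<in> {B. B \<subseteq> {1..<n} \<and> card B = r - 1}" "B \<in> {B. B \<subseteq> {1..<n} \<and> card B = r - 1}"
        and eq: "insert 0 A = insert 0 B"
      have "0 \<notin> A" "0 \<notin> B" using AB by auto
      then show "A = B" using eq by (metis insert_ident)
    qed
    show "insert 0 ` {B. B \<subseteq> {1..<n} \<and> card B = r - 1} \<subseteq> {e\<in>r_sets r n. 0 \<in> e}"
    proof
      fix e assume "e \<in> insert 0 ` {B. B \<subseteq> {1..<n} \<and> card B = r - 1}"
      then obtain B where B: "B \<subseteq> {1..<n}" "card B = r - 1" "e = insert 0 B" by blast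
      have "finite B" using B(1) finite_subset by blast
      moreover have "0 \<notin> B" using B(1) by auto
      ultimately have "card e = r" using B r by simp
      moreover have "e \<subseteq> {..<n}" using B n r by auto
      ultimately show "e \<in> {e\<in>r_sets r n. 0 \<in> e}" using B(3) by (simp add: r_sets_def)
    qed
  qed simp
  then have "real ((n - 1) choose (r - 1)) \<le> card {e\<in>r_sets r n. 0 \<in> e}"
    using n_subsets[of "{1..<n}" "r - 1"] by simp
  moreover have "(real (n - 1) / real (r - 1)) ^ (r - 1) \<le> real ((n - 1) choose (r - 1))"
    using n by (intro binomial_ge_n_over_k_pow_k) auto
  moreover have "(1 / (2 * real r)) ^ (r - 1) * real n ^ (r - 1) \<le> (real (n - 1) / real (r - 1)) ^ (r - 1)"
  proof -
    have "real n / 2 \<le> real (n - 1)" using n r by (simp add: of_nat_diff)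
    then have "(real n / 2) / real r \<le> real (n - 1) / real (r - 1)"
      using r by (intro frac_le) auto
    then have "(1 / (2 * real r) * real n) ^ (r - 1) \<le> (real (n - 1) / real (r - 1)) ^ (r - 1)"
      by (intro power_mono) auto
    then show ?thesis by (simp only: power_mult_distrib)
  qed
  ultimately show ?thesis by linarith
qed

lemma threshold_ratio_at_top:
  assumes p: "\<And>n. 0 < p n" and hi: "much_less (threshold r t) p"
  shows "filterlim (\<lambda>n. p n / threshold r t n) at_top sequentially"
proof -
  have "filterlim (\<lambda>n. inverse (threshold r t n / p n)) at_top sequentially"
  proof (rule filterlim_inverse_at_top)
    show "(\<lambda>n. threshold r t n / p n) \<longlonglongrightarrow> 0" using hi by (simp add: much_less_def)
    show "eventually (\<lambda>n. 0 < threshold r t n / p n) sequentially"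
      using eventually_ge_at_top[of 1] by eventually_elim (use p threshold_pos in simp)
  qed
  then show ?thesis by simp
qed

lemma ln_ge_eventually: "eventually (\<lambda>n. c \<le> ln (real n)) sequentially"
  by real_asymp

text \<open>The star at vertex 0 has order n^(r-1) members. Its expected number of edges tends to
  infinity since threshold * n^(r-1) \<ge> 1, so concentration applies.\<close>

lemma ex_num_ge_star:
  fixes p :: "nat \<Rightarrow> real"
  assumes r: "r \<ge> 3" and t: "t \<ge> 3" and p: "\<And>n. 0 < p n \<and> p n \<le> 1"
    and hi: "much_less (threshold r t) p"
  shows "aas_edges r p (\<lambda>n E. (1 / (2 * real r)) ^ (r - 1) / 2 * p n * real n ^ (r - 1)
     \<le> ex_num (Hypergraph {..<n} E) (target r t))"
proof -
  let ?c = "(1 / (2 * real r)) ^ (r - 1)"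
  let ?A = "\<lambda>n. {e\<in>r_sets r n. 0 \<in> e}"
  have c0: "?c > 0" using r by simp
  have lim: "filterlim (\<lambda>n. p n * card (?A n)) at_top sequentially"
  proof (rule filterlim_at_top_mono)
    show "filterlim (\<lambda>n. ?c * (p n / threshold r t n)) at_top sequentially"
      using c0 threshold_ratio_at_top[OF _ hi] p
      by (intro filterlim_tendsto_pos_mult_at_top[OF tendsto_const]) auto
    show "eventually (\<lambda>n. ?c * (p n / threshold r t n) \<le> p n * card (?A n)) sequentially"
      using eventually_ge_at_top[of r]
    proof eventually_elim
      fix n assume n: "r \<le> n"
      then have n1: "1 \<le> n" using r by simp
      have "1 \<le> threshold r t n * real n ^ (r - 1)"
      proof -
        have "real n powr 1 \<le> real n powr plateau t"
          using n1 plateau_bounds[OF t] by (intro powr_mono) auto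
        also have "\<dots> = threshold r t n * real n ^ (r - 1) * real n"
          unfolding threshold_power[OF n1, of r t, symmetric] using r by (cases r) auto
        finally show ?thesis using n1 by simp
      qed
      then have "1 / threshold r t n \<le> real n ^ (r - 1)"
        using threshold_pos[OF n1, of r t] by (simp add: field_simps)
      then have "?c * p n * (1 / threshold r t n) \<le> ?c * p n * real n ^ (r - 1)"
        using p[of n] c0 by (intro mult_left_mono) auto
      also have "\<dots> = p n * (?c * real n ^ (r - 1))" by simp
      also have "\<dots> \<le> p n * card (?A n)" using p[of n] card_star_ge[OF r n] by (intro mult_left_mono) auto
      finally show "?c * (p n / threshold r t n) \<le> p n * card (?A n)" by simp
    qed
  qed
  have A: "aas_edges r p (\<lambda>n E. \<bar>real (card (?A n \<inter> E)) - p n * card (?A n)\<bar> \<le> 1 / 2 * (p n * card (?A n)))"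
    using p lim by (intro aas_edges_concentration) auto
  show ?thesis
  proof (rule aas_edges_mono[OF A])
    show "eventually (\<lambda>n. \<forall>E. E \<subseteq> r_sets r n \<longrightarrow>
      \<bar>real (card (?A n \<inter> E)) - p n * card (?A n)\<bar> \<le> 1 / 2 * (p n * card (?A n)) \<longrightarrow>
      ?c / 2 * p n * real n ^ (r - 1) \<le> ex_num (Hypergraph {..<n} E) (target r t)) sequentially"
      using eventually_ge_at_top[of r]
    proof (eventually_elim, intro allI impI)
      fix n E assume n: "r \<le> n" and E: "E \<subseteq> r_sets r n"
        and d: "\<bar>real (card (?A n \<inter> E)) - p n * card (?A n)\<bar> \<le> 1 / 2 * (p n * card (?A n))"
      have "free r t n (?A n \<inter> E)" using t by (intro free_star[where v = 0] r) auto
      then have "card (?A n \<inter> E) \<le> ex_num (Hypergraph {..<n} E) (target r t)" using E by (intro ex_num_ge) auto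
      moreover have "p n * (?c * real n ^ (r - 1)) \<le> p n * card (?A n)"
        using p[of n] card_star_ge[OF r n] by (intro mult_left_mono) auto
      moreover have "?c / 2 * p n * real n ^ (r - 1) = p n * (?c * real n ^ (r - 1)) / 2" by simp
      ultimately show "?c / 2 * p n * real n ^ (r - 1) \<le> ex_num (Hypergraph {..<n} E) (target r t)"
        using d by linarith
    qed
  qed
qed

text \<open>
  Above the threshold \<open>n\<^sup>-\<^sup>r\<^sup>+\<^sup>\<alpha>\<close> the random hypergraph is thinned out to density \<open>n\<^sup>-\<^sup>r\<^sup>+\<^sup>\<alpha> / ln n\<close> before
  deleting an edge from every copy.
\<close>

lemma ex_num_ge_plateau:
  fixes p :: "nat \<Rightarrow> real"
  assumes r: "r \<ge> 3" and t: "t \<ge> 3" and p: "\<And>n. 0 < p n \<and> p n \<le> 1"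
    and hi: "much_less (threshold r t) p"
  shows "aas_edges r p (\<lambda>n E. real n powr plateau t / ln (real n) ^ 3
     \<le> ex_num (Hypergraph {..<n} E) (target r t))"
proof -
  let ?N = "\<lambda>n. real (n choose r)" let ?s = "\<lambda>n. real n powr plateau t" let ?x = "\<lambda>n. ln (real n)"
  let ?y = "\<lambda>n. p n / threshold r t n"
  have r1: "1 \<le> r" using r by simp
  have ratio: "filterlim ?y at_top sequentially" using threshold_ratio_at_top[OF _ hi] p by auto
  have Nge: "real n ^ r / real r ^ r \<le> ?N n" if "r \<le> n" for n using choose_bounds[OF r1 that] .
  have lim: "filterlim (\<lambda>n. p n * card (r_sets r n)) at_top sequentially"
    unfolding card_r_sets
  proof (rule filterlim_at_top_mono)
    show "filterlim (\<lambda>n. inverse (real r ^ r) * ?y n) at_top sequentially"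
      using r ratio by (intro filterlim_tendsto_pos_mult_at_top[OF tendsto_const]) auto
    show "eventually (\<lambda>n. inverse (real r ^ r) * ?y n \<le> p n * ?N n) sequentially"
      using eventually_ge_at_top[of r]
    proof eventually_elim
      fix n assume n: "r \<le> n"
      then have n1: "1 \<le> n" using r by simp
      have th: "threshold r t n > 0" by (rule threshold_pos[OF n1])
      have "1 \<le> threshold r t n * real n ^ r"
        unfolding threshold_power[OF n1] using n1 plateau_bounds[OF t] by (intro ge_one_powr_ge_zero) auto
      then have "1 / threshold r t n \<le> real n ^ r" using th by (simp add: field_simps)
      then have "p n * inverse (real r ^ r) * (1 / threshold r t n) \<le> p n * inverse (real r ^ r) * real n ^ r"
        using p[of n] by (intro mult_left_mono) auto
      also have "\<dots> = p n * (real n ^ r / real r ^ r)" by (simp add: field_simps)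
      also have "\<dots> \<le> p n * ?N n" using p[of n] Nge[OF n] by (intro mult_left_mono) auto
      finally show "inverse (real r ^ r) * ?y n \<le> p n * ?N n" by (simp add: mult_ac)
    qed
  qed
  have A1: "aas_edges r p (\<lambda>n E. \<bar>real (card (r_sets r n \<inter> E)) - p n * card (r_sets r n)\<bar> \<le> 1 / 2 * (p n * card (r_sets r n)))"
    using p lim by (intro aas_edges_concentration) auto
  \<comment> \<open>The additional factor ln n bounds the failure probability in Markov's inequality
    by 1 / ln n.\<close>
  have A2: "aas_edges r p (\<lambda>n E. num_copies r t n E < ?s n * ?y n ^ (2 * t) * ?x n)"
    unfolding aas_edges_def
  proof (rule aasI)
    show "eventually (\<lambda>n. measure_pmf.prob (random_subset (r_sets r n) (p n)) {E. \<not> num_copies r t n E < ?s n * ?y n ^ (2 * t) * ?x n}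
        \<le> 1 / ?x n) sequentially"
      using eventually_ge_at_top[of 1] ln_ge_eventually[of 1]
    proof eventually_elim
      fix n assume n: "(1::nat) \<le> n" and x: "1 \<le> ?x n"
      have y: "?y n > 0" using p[of n] threshold_pos[OF n] by simp
      have b0: "?s n * ?y n ^ (2 * t) > 0" using n y by simp
      have a0: "?s n * ?y n ^ (2 * t) * ?x n > 0" by (rule mult_pos_pos[OF b0]) (use x in simp)
      have "measure_pmf.prob (random_subset (r_sets r n) (p n)) {E. \<not> num_copies r t n E < ?s n * ?y n ^ (2 * t) * ?x n}
         \<le> ?s n * ?y n ^ (2 * t) / (?s n * ?y n ^ (2 * t) * ?x n)"
        unfolding not_less using p[of n] by (intro prob_many_copies t r a0 n) auto
      also have "\<dots> = 1 / ?x n"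
      proof -
        have "w / (w * z) = 1 / z" if "w > 0" for w z :: real using that by simp
        from this[OF b0] show ?thesis .
      qed
      finally show "measure_pmf.prob (random_subset (r_sets r n) (p n)) {E. \<not> num_copies r t n E < ?s n * ?y n ^ (2 * t) * ?x n}
        \<le> 1 / ?x n" .
    qed
    show "(\<lambda>n. 1 / ?x n) \<longlonglongrightarrow> 0" by real_asymp
  qed
  show ?thesis
  proof (rule aas_edges_mono[OF aas_edges_conj[OF A1 A2]])
    have ev: "eventually (\<lambda>n. 1 \<le> ?y n) sequentially"
      using ratio unfolding filterlim_at_top by blast
    show "eventually (\<lambda>n. \<forall>E. E \<subseteq> r_sets r n \<longrightarrow>
      \<bar>real (card (r_sets r n \<inter> E)) - p n * card (r_sets r n)\<bar> \<le> 1 / 2 * (p n * card (r_sets r n)) \<and>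
      num_copies r t n E < ?s n * ?y n ^ (2 * t) * ?x n \<longrightarrow>
      ?s n / ?x n ^ 3 \<le> ex_num (Hypergraph {..<n} E) (target r t)) sequentially"
      using eventually_ge_at_top[of r] ev ln_ge_eventually[of "4 * real r ^ r"]
    proof (eventually_elim, intro allI impI)
      fix n E assume n: "r \<le> n" and y1: "1 \<le> ?y n" and x: "4 * real r ^ r \<le> ?x n" and E: "E \<subseteq> r_sets r n"
        and *: "\<bar>real (card (r_sets r n \<inter> E)) - p n * card (r_sets r n)\<bar> \<le> 1 / 2 * (p n * card (r_sets r n)) \<and>
          num_copies r t n E < ?s n * ?y n ^ (2 * t) * ?x n"
      have n1: "1 \<le> n" using n r by simp
      have t1: "t \<ge> 1" using t by simp
      have th: "threshold r t n > 0" by (rule threshold_pos[OF n1])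
      have rr: "1 \<le> real r ^ r" using r by (intro one_le_power) auto
      have x4: "?x n \<ge> 4" using x rr by linarith
      have RE: "r_sets r n \<inter> E = E" using E by blast
      have c: "p n * ?N n / 2 \<le> card E" using * unfolding RE card_r_sets by linarith
      \<comment> \<open>This gives q p = threshold / ln n.\<close>
      define q where "q = 1 / (?y n * ?x n)"
      have "1 * 1 \<le> ?y n * ?x n" using y1 x4 by (intro mult_mono) auto
      moreover have "0 \<le> 1 / z \<and> 1 / z \<le> 1" if "1 * 1 \<le> z" for z :: real using that by simp
      ultimately have q: "0 \<le> q" "q \<le> 1" unfolding q_def by blast+
      have qp: "q * p n = threshold r t n / ?x n" using p[of n] th x4 by (simp add: q_def)
      have low: "?s n / (2 * real r ^ r * ?x n) \<le> q * card E"
      proof -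
        have "?s n / (2 * real r ^ r * ?x n) = (threshold r t n / ?x n) * (real n ^ r / real r ^ r) / 2"
          unfolding threshold_power[OF n1, of r t, symmetric] by simp
        also have "\<dots> \<le> (threshold r t n / ?x n) * ?N n / 2"
          using Nge[OF n] th x4 by (intro divide_right_mono mult_left_mono) auto
        also have "\<dots> = q * (p n * ?N n / 2)" by (simp add: qp[symmetric])
        also have "\<dots> \<le> q * card E" using c q by (intro mult_left_mono) auto
        finally show ?thesis .
      qed
      have high: "q ^ (2 * t) * num_copies r t n E \<le> ?s n / ?x n ^ 3"
      proof -
        have "q ^ (2 * t) * num_copies r t n E \<le> q ^ (2 * t) * (?s n * ?y n ^ (2 * t) * ?x n)"
          using * q by (intro mult_left_mono) auto
        also have "\<dots> = ?s n * ?x n * (q * ?y n) ^ (2 * t)" by (simp only: power_mult_distrib mult_ac)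
        also have "q * ?y n = 1 / ?x n" using p[of n] th by (simp add: q_def)
        \<comment> \<open>Four of the 2t factors 1 / ln n suffice: one cancels the ln n of the copy
          count, and three remain against the single one lost in the number of edges.\<close>
        also have "?s n * ?x n * (1 / ?x n) ^ (2 * t) \<le> ?s n * ?x n * (1 / ?x n) ^ 4"
          using x4 t by (intro mult_left_mono power_decreasing) auto
        also have "\<dots> = ?s n / ?x n ^ 3" using x4 by (simp add: power_divide power3_eq_cube power4_eq_xxxx)
        finally show ?thesis .
      qed
      have "2 * (?s n / ?x n ^ 3) \<le> ?s n / (2 * real r ^ r * ?x n)"
      proof -
        have "2 * (2 * real r ^ r * ?x n) \<le> ?x n * ?x n" using x x4 by (simp add: mult_right_mono)
        also have "\<dots> \<le> ?x n * ?x n * ?x n" using x4 by simp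
        finally have "2 * (2 * real r ^ r * ?x n) \<le> ?x n ^ 3" by (simp add: power3_eq_cube)
        then have "2 * (?s n * (2 * real r ^ r * ?x n)) \<le> ?s n * ?x n ^ 3"
          using mult_left_mono[of "2 * (2 * real r ^ r * ?x n)" "?x n ^ 3" "?s n"] by simp
        then have "(2 * ?s n) * (2 * real r ^ r * ?x n) \<le> ?s n * ?x n ^ 3" by simp
        moreover have "a / c \<le> b / d" if "a * d \<le> b * c" "c > 0" "d > 0" for a b c d :: real
          using that by (simp add: field_simps)
        moreover have "?x n ^ 3 > 0" using x4 by simp
        moreover have "2 * real r ^ r * ?x n > 0" using x4 r by (intro mult_pos_pos) auto
        ultimately have "(2 * ?s n) / ?x n ^ 3 \<le> ?s n / (2 * real r ^ r * ?x n)" by blast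
        then show ?thesis by simp
      qed
      moreover have "q * card E - q ^ (2 * t) * num_copies r t n E \<le> ex_num (Hypergraph {..<n} E) (target r t)"
        by (rule ex_num_deletion[OF r t1 E q])
      ultimately show "?s n / ?x n ^ 3 \<le> ex_num (Hypergraph {..<n} E) (target r t)"
        using low high by linarith
    qed
  qed
qed

text \<open>If the extremal number exceeds the bound, a free subset of E lies in some container X,
  and |X \<inter> E| \<ge> m for the next integer m. For a single X this has probability at most
  e^-m, and m \<ge> s ln^3 n outweighs the exp(O(s ln^2 n)) containers.\<close>

lemma ex_num_upper:
  fixes r t :: nat
  assumes r: "r \<ge> 3" and t: "t \<ge> 3"
  shows "\<exists>C::real. C \<ge> 3 \<and> (\<forall>p :: nat \<Rightarrow> real. (\<forall>n. 0 < p n \<and> p n \<le> 1) \<longrightarrow>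
      aas_edges r p (\<lambda>n E. real (ex_num (Hypergraph {..<n} E) (target r t))
        \<le> max (C * p n * real n ^ (r - 1)) (real n powr plateau t * ln (real n) powr C)))"
proof -
  obtain K C1 :: real where K: "K > 0" and C1: "C1 > 0"
    and cont: "eventually (\<lambda>n. has_containers (r_sets r n) (K * real n ^ (r - 1))
       (exp (C1 * real n powr plateau t * ln (real n) ^ 2)) (free r t n)) sequentially"
    by (rule free_containers[OF r t])
  \<comment> \<open>The 3 provides m \<ge> s ln^3 n. The term e^2 K makes e |X| p at most m / e for
    every container X.\<close>
  define C where "C = max 3 (exp 1 * exp 1 * K)"
  have C: "C \<ge> 3" "exp 1 * exp 1 * K \<le> C" by (simp_all add: C_def)
  show ?thesis
  proof (intro exI[of _ C] conjI C(1) allI impI)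
    fix p :: "nat \<Rightarrow> real" assume p: "\<forall>n. 0 < p n \<and> p n \<le> 1"
    let ?b = "\<lambda>n. max (C * p n * real n ^ (r - 1)) (real n powr plateau t * ln (real n) powr C)"
    show "aas_edges r p (\<lambda>n E. real (ex_num (Hypergraph {..<n} E) (target r t)) \<le> ?b n)"
      unfolding aas_edges_def
    proof (rule aasI)
      show "(\<lambda>n. 1 / real n) \<longlonglongrightarrow> 0" by real_asymp
      show "eventually (\<lambda>n. measure_pmf.prob (random_subset (r_sets r n) (p n))
          {E. \<not> real (ex_num (Hypergraph {..<n} E) (target r t)) \<le> ?b n} \<le> 1 / real n) sequentially"
        using cont eventually_ge_at_top[of 1] ln_ge_eventually[of "C1 + 1"]
      proof eventually_elim
        fix n :: nat
        let ?s = "real n powr plateau t" let ?x = "ln (real n)"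
        assume hc: "has_containers (r_sets r n) (K * real n ^ (r - 1)) (exp (C1 * ?s * ?x ^ 2)) (free r t n)"
          and n: "1 \<le> n" and x: "C1 + 1 \<le> ?x"
        obtain \<C> where \<C>: "finite \<C>" "real (card \<C>) \<le> exp (C1 * ?s * ?x ^ 2)"
          "\<forall>X\<in>\<C>. X \<subseteq> r_sets r n \<and> real (card X) \<le> K * real n ^ (r - 1)"
          "\<forall>I. I \<subseteq> r_sets r n \<longrightarrow> free r t n I \<longrightarrow> (\<exists>X\<in>\<C>. I \<subseteq> X)"
          using hc unfolding has_containers_def by blast
        have x1: "1 \<le> ?x" using x C1 by linarith
        have s1: "1 \<le> ?s" using n plateau_bounds[OF t] by (intro ge_one_powr_ge_zero) auto
        have b0: "0 \<le> ?b n" by (simp add: le_max_iff_disj)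
        define m where "m = nat (\<lfloor>?b n\<rfloor> + 1)"
        have m: "?b n < m" "m \<ge> 1" using b0 by (simp_all add: m_def) linarith+
        have mle: "m \<le> k" if "?b n < real k" for k
          using that b0 by (simp add: m_def) linarith
        have sm: "?s * ?x ^ 3 \<le> m"
        proof -
          have "?x ^ 3 = ?x powr 3" using x1 by simp
          also have "\<dots> \<le> ?x powr C" using x1 C by (intro powr_mono) auto
          finally have "?s * ?x ^ 3 \<le> ?s * ?x powr C" by (intro mult_left_mono) auto
          then show ?thesis using m(1) by linarith
        qed
        have each: "measure_pmf.prob (random_subset (r_sets r n) (p n)) {E. m \<le> card (X \<inter> E)} \<le> exp (- real m)"
          if X: "X \<in> \<C>" for X
        proof -
          have Xs: "X \<subseteq> r_sets r n" "real (card X) \<le> K * real n ^ (r - 1)" using \<C>(3) X by auto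
          have "exp 1 * card X * p n \<le> exp 1 * (K * real n ^ (r - 1)) * p n"
            using Xs(2) p[rule_format, of n] by (intro mult_right_mono mult_left_mono) auto
          also have "\<dots> = (exp 1 * exp 1 * K) * p n * real n ^ (r - 1) * exp (- 1)"
            by (simp add: exp_minus field_simps)
          also have "\<dots> \<le> C * p n * real n ^ (r - 1) * exp (- 1)"
            using C(2) p[rule_format, of n] by (intro mult_right_mono) auto
          also have "\<dots> \<le> real m * exp (- 1)" using m(1) by (intro mult_right_mono) auto
          finally have le: "exp 1 * card X * p n / m \<le> exp (- 1)" using m(2) by (simp add: field_simps)
          have "measure_pmf.prob (random_subset (r_sets r n) (p n)) {E. m \<le> card (X \<inter> E)} \<le> (exp 1 * card X * p n / m) ^ m"
            using p[rule_format, of n] by (intro prob_card_ge Xs m) auto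
          also have "\<dots> \<le> exp (- 1) ^ m" using le p[rule_format, of n] by (intro power_mono) auto
          also have "\<dots> = exp (- real m)" by (simp only: exp_of_nat_mult[symmetric]) simp
          finally show ?thesis .
        qed
        have "measure_pmf.prob (random_subset (r_sets r n) (p n))
            {E. \<not> real (ex_num (Hypergraph {..<n} E) (target r t)) \<le> ?b n}
          \<le> measure_pmf.prob (random_subset (r_sets r n) (p n)) {E. \<exists>X\<in>\<C>. m \<le> card (X \<inter> E)}"
        proof (rule prob_random_subset_cong)
          fix E assume E: "E \<subseteq> r_sets r n" and big: "\<not> real (ex_num (Hypergraph {..<n} E) (target r t)) \<le> ?b n"
          have t1: "t \<ge> 1" using t by simp
          obtain I where I: "I \<subseteq> E" "free r t n I" "card I = ex_num (Hypergraph {..<n} E) (target r t)"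
            by (rule ex_num_attained[OF r t1 E])
          have "I \<subseteq> r_sets r n" using I(1) E by order
          then obtain X where X: "X \<in> \<C>" "I \<subseteq> X" using \<C>(4) I(2) by blast
          have "m \<le> card I" unfolding I(3) by (rule mle) (use big in linarith)
          also have "\<dots> \<le> card (X \<inter> E)"
            using I(1) X(2) finite_subset[OF E finite_r_sets] by (intro card_mono) auto
          finally show "\<exists>X\<in>\<C>. m \<le> card (X \<inter> E)" using X(1) by blast
        qed
        also have "{E. \<exists>X\<in>\<C>. m \<le> card (X \<inter> E)} = (\<Union>X\<in>\<C>. {E. m \<le> card (X \<inter> E)})" by auto
        also have "measure_pmf.prob (random_subset (r_sets r n) (p n)) (\<Union>X\<in>\<C>. {E. m \<le> card (X \<inter> E)})
          \<le> (\<Sum>X\<in>\<C>. measure_pmf.prob (random_subset (r_sets r n) (p n)) {E. m \<le> card (X \<inter> E)})"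
          using \<C>(1) by (intro measure_UNION_le) auto
        also have "\<dots> \<le> (\<Sum>X\<in>\<C>. exp (- real m))" using each by (intro sum_mono)
        also have "\<dots> = card \<C> * exp (- real m)" by simp
        also have "\<dots> \<le> exp (C1 * ?s * ?x ^ 2) * exp (- (?s * ?x ^ 3))"
          using \<C>(2) sm by (intro mult_mono) auto
        also have "\<dots> = exp (?s * ?x ^ 2 * (C1 - ?x))"
          by (simp add: exp_add[symmetric] power2_eq_square power3_eq_cube algebra_simps)
        also have "\<dots> \<le> exp (- ?x)"
        proof -
          have "1 * ?x \<le> ?s * ?x ^ 2" using s1 x1 by (intro mult_mono) (auto simp: power2_eq_square)
          then have "?x * 1 \<le> ?s * ?x ^ 2 * (?x - C1)" using x x1 by (intro mult_mono) auto
          then show ?thesis by (simp add: algebra_simps)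
        qed
        also have "\<dots> = 1 / real n" using n by (simp add: exp_minus inverse_eq_divide)
        finally show "measure_pmf.prob (random_subset (r_sets r n) (p n))
          {E. \<not> real (ex_num (Hypergraph {..<n} E) (target r t)) \<le> ?b n} \<le> 1 / real n" .
      qed
    qed
  qed
qed

theorem theorem2p2:
  fixes r t :: nat
  assumes "r \<ge> 3" and "t \<ge> 3"
  shows "\<exists>c C :: real. c > 0 \<and> C > 0 \<and>
    (\<forall>p :: nat \<Rightarrow> real. (\<forall>n. 0 < p n \<and> p n \<le> 1) \<longrightarrow>
      (much_less (\<lambda>n. real n powr (- real r + (3 * real t - 2) / (2 * real t - 1))) p \<longrightarrow>
        aas (\<lambda>n. random_r_graph r n (p n)) (\<lambda>n G.
          max (c * p n * real n ^ (r - 1))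
              (real n powr ((3 * real t - 2) / (2 * real t - 1)) * ln (real n) powr (- C))
            \<le> real (ex_num G (expansion r (complete_bipartite 2 t))) \<and>
          real (ex_num G (expansion r (complete_bipartite 2 t)))
            \<le> max (C * p n * real n ^ (r - 1))
                  (real n powr ((3 * real t - 2) / (2 * real t - 1)) * ln (real n) powr C))) \<and>
      (much_less (\<lambda>n. real n powr (- real r)) p \<and>
       much_less p (\<lambda>n. real n powr (- real r + (3 * real t - 2) / (2 * real t - 1))) \<longrightarrow>
        aas_asymp (\<lambda>n. random_r_graph r n (p n))
          (\<lambda>n G. real (ex_num G (expansion r (complete_bipartite 2 t))))
          (\<lambda>n. p n * real (n choose r))))"
proof -
  note r = assms(1) and t = assms(2)
  have th: "(\<lambda>n. real n powr (- real r + plateau t)) = threshold r t"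
    by (rule ext) (simp add: threshold_def)
  let ?c = "(1 / (2 * real r)) ^ (r - 1) / 2"
  obtain C :: real where C: "C \<ge> 3"
    and up: "\<forall>p :: nat \<Rightarrow> real. (\<forall>n. 0 < p n \<and> p n \<le> 1) \<longrightarrow>
      aas_edges r p (\<lambda>n E. real (ex_num (Hypergraph {..<n} E) (target r t))
        \<le> max (C * p n * real n ^ (r - 1)) (real n powr plateau t * ln (real n) powr C))"
    using ex_num_upper[OF r t] by (elim exE conjE)
  show ?thesis
    unfolding plateau_def[of t, symmetric] th
  proof (rule exI[of _ ?c], rule exI[of _ C], intro conjI allI impI)
    show "?c > 0" "C > 0" using r C by auto
  next
    fix p :: "nat \<Rightarrow> real" assume "\<forall>n. 0 < p n \<and> p n \<le> 1" and hi: "much_less (threshold r t) p"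
    then have p: "\<And>n. 0 < p n \<and> p n \<le> 1" by blast
    show "aas (\<lambda>n. random_r_graph r n (p n)) (\<lambda>n G.
          max (?c * p n * real n ^ (r - 1)) (real n powr plateau t * ln (real n) powr (- C))
            \<le> real (ex_num G (target r t)) \<and>
          real (ex_num G (target r t))
            \<le> max (C * p n * real n ^ (r - 1)) (real n powr plateau t * ln (real n) powr C))"
      unfolding aas_random_r_graph
    proof (rule aas_edges_mono[OF aas_edges_conj[OF ex_num_ge_star[OF r t p hi]
          aas_edges_conj[OF ex_num_ge_plateau[OF r t p hi] up[rule_format, OF p]]]])
      show "eventually (\<lambda>n. \<forall>E. E \<subseteq> r_sets r n \<longrightarrow>
        ?c * p n * real n ^ (r - 1) \<le> ex_num (Hypergraph {..<n} E) (target r t) \<and>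
        real n powr plateau t / ln (real n) ^ 3 \<le> ex_num (Hypergraph {..<n} E) (target r t) \<and>
        real (ex_num (Hypergraph {..<n} E) (target r t))
          \<le> max (C * p n * real n ^ (r - 1)) (real n powr plateau t * ln (real n) powr C) \<longrightarrow>
        max (?c * p n * real n ^ (r - 1)) (real n powr plateau t * ln (real n) powr (- C))
            \<le> real (ex_num (Hypergraph {..<n} E) (target r t)) \<and>
        real (ex_num (Hypergraph {..<n} E) (target r t))
            \<le> max (C * p n * real n ^ (r - 1)) (real n powr plateau t * ln (real n) powr C)) sequentially"
        using ln_ge_eventually[of 1]
      proof (eventually_elim, intro allI impI)
        fix n E assume x: "1 \<le> ln (real n)"
          and *: "?c * p n * real n ^ (r - 1) \<le> ex_num (Hypergraph {..<n} E) (target r t) \<and>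
        real n powr plateau t / ln (real n) ^ 3 \<le> ex_num (Hypergraph {..<n} E) (target r t) \<and>
        real (ex_num (Hypergraph {..<n} E) (target r t))
          \<le> max (C * p n * real n ^ (r - 1)) (real n powr plateau t * ln (real n) powr C)"
        \<comment> \<open>C \<ge> 3 weakens the cubed logarithm of \<open>ex_num_ge_plateau\<close>
          to the exponent C shared with the upper bound.\<close>
        have "ln (real n) powr (- C) \<le> ln (real n) powr (- 3)" using x C by (intro powr_mono) auto
        also have "\<dots> = 1 / ln (real n) ^ 3" using x by (simp add: powr_minus inverse_eq_divide)
        finally have "real n powr plateau t * ln (real n) powr (- C) \<le> real n powr plateau t * (1 / ln (real n) ^ 3)"
          by (intro mult_left_mono) auto
        then have "real n powr plateau t * ln (real n) powr (- C) \<le> ex_num (Hypergraph {..<n} E) (target r t)"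
          using * by simp
        then show "max (?c * p n * real n ^ (r - 1)) (real n powr plateau t * ln (real n) powr (- C))
            \<le> real (ex_num (Hypergraph {..<n} E) (target r t)) \<and>
        real (ex_num (Hypergraph {..<n} E) (target r t))
            \<le> max (C * p n * real n ^ (r - 1)) (real n powr plateau t * ln (real n) powr C)"
          using * by (simp only: max.bounded_iff)
      qed
    qed
  next
    fix p :: "nat \<Rightarrow> real" assume "\<forall>n. 0 < p n \<and> p n \<le> 1"
      and ml: "much_less (\<lambda>n. real n powr (- real r)) p \<and> much_less p (threshold r t)"
    then have p: "\<And>n. 0 < p n \<and> p n \<le> 1" by blast
    show "aas_asymp (\<lambda>n. random_r_graph r n (p n)) (\<lambda>n G. real (ex_num G (target r t))) (\<lambda>n. p n * real (n choose r))"
      unfolding aas_asymp_def aas_random_r_graph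
    proof (intro allI impI)
      fix \<epsilon> :: real assume "0 < \<epsilon>"
      then show "aas_edges r p (\<lambda>n E. \<bar>real (ex_num (Hypergraph {..<n} E) (target r t)) - p n * real (n choose r)\<bar>
          \<le> \<epsilon> * \<bar>p n * real (n choose r)\<bar>)"
        using ml by (intro ex_num_below_threshold[OF r t p]) auto
    qed
  qed
qed

end
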